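(* Let $n\ge 2$, let $\Omega\subset\mathbb{R}^n$ be a bounded Lipschitz domain, and let $p,q,\varkappa$ satisfy $$\varkappa>0\quad\text{and}\quad 1<p<q\le p+\varkappa\max\left\{\tfrac{p}{n},1\right\}.$$ Let $a:\Omega\to[0,\infty)$ belong to $\mathcal{Z}^\varkappa(\Omega)$, let $\mathcal{F}[u]=\int_\Omega |\nabla u(x)|^p+a(x)|\nabla u(x)|^q\,dx$, and let $W(\Omega)=\{\varphi\in W^{1,1}_0(\Omega):\int_\Omega|\nabla\varphi|^p+a(x)|\nabla\varphi|^q\,dx<\infty\}$. Then for every $u_0\in W^{1,1}(\Omega)$ with $\mathcal{F}[u_0]<\infty$, $$\inf_{v\in u_0+W(\Omega)}\mathcal{F}[v]=\inf_{w\in u_0+C_c^\infty(\Omega)}\mathcal{F}[w].$$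
   Context: For $\varkappa\in(0,\infty)$, the class $\mathcal{Z}^\varkappa(\Omega)$ consists of all (Lebesgue measurable) functions $a:\Omega\to[0,\infty)$ for which there is a constant $C>0$ such that $a(x)\le C\,(a(y)+|x-y|^\varkappa)$ for all $x,y\in\Omega$. All functions $u$ are real-valued. *)

theory Defs
  imports "HOL-Analysis.Analysis"
begin

text \<open>
  A function on \<open>\<Omega>\<close> is represented by a total function whose values outside \<open>\<Omega>\<close> are
  irrelevant; only test functions are required to vanish outside \<open>\<Omega>\<close>. Sobolev
  functions are kept as functions rather than as classes modulo equality almost everywhere.
\<close>

text \<open>
  The boundary is locally the graph of a Lipschitz function over the hyperplane orthogonal
  to a unit vector \<open>e\<close>, with \<open>\<Omega>\<close> lying strictly on one side. The point
  \<open>x - (x \<bullet> e) *\<^sub>R e\<close> and the number \<open>x \<bullet> e\<close> are the coordinates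
  of \<open>x\<close> in a rotated frame whose last axis is \<open>e\<close>.
\<close>

definition lipschitz_boundary :: "'a::euclidean_space set \<Rightarrow> bool" where
  "lipschitz_boundary \<Omega> \<longleftrightarrow>
     (\<forall>z\<in>frontier \<Omega>. \<exists>r>0. \<exists>e \<gamma> L. norm e = 1 \<and> lipschitz_on L {y. y \<bullet> e = 0} \<gamma> \<and>
        \<Omega> \<inter> ball z r = {x \<in> ball z r. \<gamma> (x - (x \<bullet> e) *\<^sub>R e) < x \<bullet> e})"

definition bounded_lipschitz_domain :: "'a::euclidean_space set \<Rightarrow> bool" where
  "bounded_lipschitz_domain \<Omega> \<longleftrightarrow>
     open \<Omega> \<and> connected \<Omega> \<and> \<Omega> \<noteq> {} \<and> bounded \<Omega> \<and> lipschitz_boundary \<Omega>"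

primrec C_k :: "nat \<Rightarrow> ('a::euclidean_space \<Rightarrow> real) \<Rightarrow> bool" where
  "C_k 0 f \<longleftrightarrow> continuous_on UNIV f"
| "C_k (Suc k) f \<longleftrightarrow>
     (\<forall>x. f differentiable (at x)) \<and> (\<forall>v. C_k k (\<lambda>x. frechet_derivative f (at x) v))"

definition test_functions :: "'a::euclidean_space set \<Rightarrow> ('a \<Rightarrow> real) set" where
  "test_functions \<Omega> =
     {\<phi>. (\<forall>k. C_k k \<phi>) \<and> compact (closure {x. \<phi> x \<noteq> 0}) \<and> closure {x. \<phi> x \<noteq> 0} \<subseteq> \<Omega>}"

definition locally_integrable ::
    "'a::euclidean_space set \<Rightarrow> ('a \<Rightarrow> 'b::{banach, second_countable_topology}) \<Rightarrow> bool" where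
  "locally_integrable \<Omega> f \<longleftrightarrow> (\<forall>K. compact K \<and> K \<subseteq> \<Omega> \<longrightarrow> integrable (lebesgue_on K) f)"

definition has_weak_gradient ::
    "'a::euclidean_space set \<Rightarrow> ('a \<Rightarrow> real) \<Rightarrow> ('a \<Rightarrow> 'a) \<Rightarrow> bool" where
  "has_weak_gradient \<Omega> u G \<longleftrightarrow>
     locally_integrable \<Omega> u \<and> locally_integrable \<Omega> G \<and>
     (\<forall>\<phi>\<in>test_functions \<Omega>. \<forall>b\<in>Basis.
        (\<integral>x. u x * frechet_derivative \<phi> (at x) b \<partial>lebesgue_on \<Omega>) =
        - (\<integral>x. (G x \<bullet> b) * \<phi> x \<partial>lebesgue_on \<Omega>))"

text \<open>
  The weak gradient is determined up to null sets. It is used below only inside integrals,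
  so the choice of the representative does not matter.
\<close>

definition weak_gradient :: "'a::euclidean_space set \<Rightarrow> ('a \<Rightarrow> real) \<Rightarrow> 'a \<Rightarrow> 'a" where
  "weak_gradient \<Omega> u = (SOME G. has_weak_gradient \<Omega> u G)"

definition W11 :: "'a::euclidean_space set \<Rightarrow> ('a \<Rightarrow> real) set" where
  "W11 \<Omega> = {u. integrable (lebesgue_on \<Omega>) u \<and>
               (\<exists>G. has_weak_gradient \<Omega> u G \<and> integrable (lebesgue_on \<Omega>) G)}"

definition W11_norm :: "'a::euclidean_space set \<Rightarrow> ('a \<Rightarrow> real) \<Rightarrow> real" where
  "W11_norm \<Omega> u =
     (\<integral>x. \<bar>u x\<bar> \<partial>lebesgue_on \<Omega>) + (\<integral>x. norm (weak_gradient \<Omega> u x) \<partial>lebesgue_on \<Omega>)"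

definition W11_0 :: "'a::euclidean_space set \<Rightarrow> ('a \<Rightarrow> real) set" where
  "W11_0 \<Omega> = {u \<in> W11 \<Omega>. \<forall>\<epsilon>>0. \<exists>\<phi>\<in>test_functions \<Omega>. W11_norm \<Omega> (\<lambda>x. u x - \<phi> x) < \<epsilon>}"

definition Z_class :: "real \<Rightarrow> 'a::euclidean_space set \<Rightarrow> ('a \<Rightarrow> real) set" where
  "Z_class \<kappa> \<Omega> = {a. a \<in> borel_measurable (lebesgue_on \<Omega>) \<and> (\<forall>x\<in>\<Omega>. 0 \<le> a x) \<and>
     (\<exists>C>0. \<forall>x\<in>\<Omega>. \<forall>y\<in>\<Omega>. a x \<le> C * (a y + norm (x - y) powr \<kappa>))}"

definition double_phase ::
    "real \<Rightarrow> real \<Rightarrow> ('a::euclidean_space \<Rightarrow> real) \<Rightarrow> 'a set \<Rightarrow> ('a \<Rightarrow> real) \<Rightarrow> ennreal" where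
  "double_phase p q a \<Omega> u =
     (\<integral>\<^sup>+x. ennreal (norm (weak_gradient \<Omega> u x) powr p
                  + a x * norm (weak_gradient \<Omega> u x) powr q) \<partial>lebesgue_on \<Omega>)"

definition energy_space ::
    "real \<Rightarrow> real \<Rightarrow> ('a::euclidean_space \<Rightarrow> real) \<Rightarrow> 'a set \<Rightarrow> ('a \<Rightarrow> real) set" where
  "energy_space p q a \<Omega> = {\<phi> \<in> W11_0 \<Omega>. double_phase p q a \<Omega> \<phi> < \<infinity>}"

end

theory Submission
  imports Defs
begin

text \<open>
  Only one inequality needs work: every \<open>\<phi>\<close> in the energy space has to be approximated by test
  functions in the modular \<open>\<integral> |v|^p + a |v|^q\<close> of the gradients; convexity of the integrand then carries
  the approximation over to \<open>u\<^sub>0 + \<phi>\<close>. First \<open>\<phi>\<close> is replaced by the bounded function \<open>k arctan (\<phi> / k)\<close>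
  and cut by a partition of unity into pieces supported near a point of the closure of \<open>\<Omega>\<close>. Each piece,
  extended by zero, is convolved with a mollifier at scale \<open>\<delta>\<close> whose support is shifted into the
  direction in which the Lipschitz boundary opens, so that the result has compact support in \<open>\<Omega>\<close>.

  The mollified gradient \<open>g\<^sub>\<delta>\<close> is at most \<open>M / \<delta>\<close> because the function is bounded, and at most
  \<open>M \<delta> powr (- n / p)\<close> because the gradient is in \<open>L\<^sup>p\<close>; the bound on \<open>q\<close> makes one of the two satisfy
  \<open>\<delta> powr \<kappa> * |g\<^sub>\<delta>| powr (q - p) \<le> K\<close>. As \<open>a x \<le> C (a y + \<delta> powr \<kappa>)\<close> for \<open>|x - y| \<le> \<delta>\<close>, Jensen's inequality
  bounds the integrand of \<open>g\<^sub>\<delta>\<close> by a multiple of the mollified integrand of the original gradient, which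
  converges in \<open>L\<^sup>1\<close>. Dominated convergence finishes the proof.
\<close>

subsection \<open>Smooth functions and bumps\<close>

text \<open>The obstacle is the power \<open>q\<close> at a point \<open>x\<close> where
  \<open>a x\<close> is positive but \<open>a\<close> is far smaller at a neighbour
  \<open>y\<close>: there the energy controls essentially \<open>|g y| powr p\<close> only, and
  averaging carries this value to \<open>x\<close>. The comparison of weights limits the damage to
  \<open>\<delta> powr \<kappa>\<close>, and splitting \<open>|g| powr q\<close> as
  \<open>|g| powr (q - p) * |g| powr p\<close> shows that a sup bound of order
  \<open>\<delta> powr (- s)\<close> repairs it as soon as
  \<open>s * (q - p) \<le> \<kappa>\<close>. The values \<open>s = 1\<close> and
  \<open>s = n / p\<close> correspond to the two entries of the maximum. Truncation precedes
  localisation because the product rule creates the term \<open>\<phi> * grad \<eta>\<close>, whose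
  energy is finite since \<open>\<phi>\<close> is bounded. The arctangent is chosen since its
  derivative is continuous and lies between 0 and 1: composition stays within \<open>C^1\<close> and
  never increases the energy density. Localisation is needed since one direction of shift does not
  serve the whole boundary. In the final comparison the convexity weights \<open>1 - t\<close> and
  \<open>t\<close> let the approximation error vanish for fixed \<open>t\<close> first; only then
  does \<open>t\<close> tend to 0.\<close>

lemma C_k_SucD: "C_k (Suc k) f \<Longrightarrow> C_k k f"
proof (induction k arbitrary: f)
  case 0
  then show ?case
    by (auto intro!: differentiable_imp_continuous_on simp: differentiable_on_def
        intro: differentiable_at_withinI)
next
  case (Suc k)
  then show ?case by (metis C_k.simps(2))
qed

text \<open>\<open>C_k\<close> speaks about \<open>frechet_derivative\<close>; uniqueness of
  derivatives lets each rule below supply an explicit formula \<open>D\<close> instead.\<close>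

lemma C_k_derivI:
  assumes "\<And>x. (f has_derivative D x) (at x)" "\<And>v. C_k k (\<lambda>x. D x v)"
  shows "C_k (Suc k) f"
proof -
  have "frechet_derivative f (at x) = D x" for x
    using frechet_derivative_at[OF assms(1)] by simp
  with assms show ?thesis by (auto simp: differentiable_def)
qed

lemma C_k_has_derivative:
  assumes "C_k (Suc k) f"
  shows "(f has_derivative frechet_derivative f (at x)) (at x)"
  using assms by (simp add: frechet_derivative_works[symmetric])

lemma C_k_const: "C_k k (\<lambda>x. c)"
proof (induction k arbitrary: c)
  case (Suc k)
  show ?case by (rule C_k_derivI[where D="\<lambda>_ _. 0"]) (auto intro: Suc)
qed simp

lemma C_k_add:
  assumes "C_k k f" "C_k k g"
  shows "C_k k (\<lambda>x. f x + g x)"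
  using assms
proof (induction k arbitrary: f g)
  case (Suc k)
  show ?case
    by (rule C_k_derivI[OF has_derivative_add[OF Suc.prems[THEN C_k_has_derivative]]])
      (use Suc in auto)
qed (auto intro: continuous_intros)

lemma C_k_mult:
  assumes "C_k k f" "C_k k g"
  shows "C_k k (\<lambda>x. f x * g x)"
  using assms
proof (induction k arbitrary: f g)
  case (Suc k)
  show ?case
    by (rule C_k_derivI[OF has_derivative_mult[OF Suc.prems[THEN C_k_has_derivative]]])
      (use Suc Suc.prems[THEN C_k_SucD] in \<open>auto intro!: C_k_add\<close>)
qed (auto intro: continuous_intros)

lemma C_k_cmult: "C_k k f \<Longrightarrow> C_k k (\<lambda>x. c * f x)"
  by (intro C_k_mult C_k_const)

lemma C_k_diff: "C_k k f \<Longrightarrow> C_k k g \<Longrightarrow> C_k k (\<lambda>x. f x - g x)"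
  using C_k_add[of k f "\<lambda>x. -1 * g x"] C_k_cmult[of k g "-1"] by simp

lemma C_k_inner: "C_k k (\<lambda>x. x \<bullet> v)"
proof (cases k)
  case (Suc m)
  show ?thesis unfolding Suc
    by (rule C_k_derivI[where D="\<lambda>_ h. h \<bullet> v"]) (auto intro!: derivative_eq_intros C_k_const)
qed (auto intro: continuous_intros)

lemma C_k_affine:
  fixes f :: "'a::euclidean_space \<Rightarrow> real"
  assumes "C_k k f"
  shows "C_k k (\<lambda>x. f (c *\<^sub>R x + w))"
  using assms
proof (induction k arbitrary: f)
  case 0
  then have "continuous_on UNIV f" by simp
  then show ?case
    by (auto intro!: continuous_intros continuous_on_compose2[of UNIV f])
next
  case (Suc k)
  show ?case
  proof (rule C_k_derivI)
    fix x
    show "((\<lambda>x. f (c *\<^sub>R x + w)) has_derivative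
        (\<lambda>h. frechet_derivative f (at (c *\<^sub>R x + w)) (c *\<^sub>R h))) (at x)"
      by (rule has_derivative_compose[of "\<lambda>x. c *\<^sub>R x + w" "\<lambda>h. c *\<^sub>R h", OF _ C_k_has_derivative[OF Suc.prems]])
         (auto intro!: derivative_eq_intros)
  next
    fix v
    show "C_k k (\<lambda>x. frechet_derivative f (at (c *\<^sub>R x + w)) (c *\<^sub>R v))"
      using Suc.IH[of "\<lambda>x. frechet_derivative f (at x) (c *\<^sub>R v)"] Suc.prems by simp
  qed
qed

text \<open>The derivative of each member of this family is a linear combination of two others.\<close>

definition flat_exp :: "nat \<Rightarrow> real \<Rightarrow> real" where
  "flat_exp m t = (if t > 0 then exp (- inverse t) * inverse t ^ m else 0)"

text \<open>With \<open>s = inverse t\<close> this is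
  \<open>s ^ m / exp s \<longlongrightarrow> 0\<close> at infinity; on the left of 0 the function
  vanishes identically.\<close>

lemma flat_tendsto_0: "(flat_exp m \<longlongrightarrow> 0) (at 0)"
proof -
  have "((\<lambda>t. inverse t ^ m / exp (inverse t)) \<longlongrightarrow> 0) (at_right (0::real))"
    using tendsto_power_div_exp_0[of m] filterlim_inverse_at_top_right
    by (rule filterlim_compose[rotated, rotated])
  moreover have "\<forall>\<^sub>F t in at_right (0::real). flat_exp m t = inverse t ^ m / exp (inverse t)"
    using eventually_at_right_less[of 0]
    by (rule eventually_mono) (simp add: flat_exp_def exp_minus field_simps)
  ultimately have 1: "(flat_exp m \<longlongrightarrow> 0) (at_right 0)"
    by (simp add: filterlim_cong)
  have "\<forall>\<^sub>F t in at_left (0::real). flat_exp m t = 0"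
    by (auto simp: eventually_at_filter flat_exp_def)
  then have 2: "(flat_exp m \<longlongrightarrow> 0) (at_left 0)"
    by (simp add: tendsto_eventually)
  from 1 2 show ?thesis
    by (simp add: filterlim_split_at)
qed

lemma flat_DERIV: "(flat_exp m has_real_derivative (flat_exp (m + 2) t - real m * flat_exp (m + 1) t)) (at t)"
proof -
  consider "t > 0" | "t < 0" | "t = 0" by linarith
  then show ?thesis
  proof cases
    case 1
    have "((\<lambda>t. exp (- inverse t) * inverse t ^ m) has_real_derivative
        (flat_exp (m + 2) t - real m * flat_exp (m + 1) t)) (at t)"
    proof (cases m)
      case 0
      then show ?thesis
        using 1 by (auto intro!: derivative_eq_intros simp: flat_exp_def power2_eq_square)
    next
      case (Suc j)
      have "((\<lambda>t. exp (- inverse t) * inverse t ^ Suc j) has_real_derivative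
          exp (- inverse t) * (inverse t * inverse t) * inverse t ^ Suc j +
          exp (- inverse t) * (real (Suc j) * inverse t ^ j * (- (inverse t * inverse t)))) (at t)"
        using 1
        by (auto intro!: derivative_eq_intros simp del: power_Suc)
      also have "exp (- inverse t) * (inverse t * inverse t) * inverse t ^ Suc j +
          exp (- inverse t) * (real (Suc j) * inverse t ^ j * (- (inverse t * inverse t)))
          = flat_exp (m + 2) t - real m * flat_exp (m + 1) t"
        using 1 Suc by (simp add: flat_exp_def algebra_simps)
      finally show ?thesis using Suc by simp
    qed
    then show ?thesis
      by (rule has_field_derivative_transform_within_open[where S="{0<..}"])
        (use 1 in \<open>auto simp: flat_exp_def\<close>)
  next
    case 2
    have "(flat_exp m has_real_derivative 0) (at t)"
      by (rule has_field_derivative_transform_within_open[OF DERIV_const[of 0], where S="{..<0}"])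
        (use 2 in \<open>auto simp: flat_exp_def\<close>)
    moreover have "flat_exp (m + 2) t - real m * flat_exp (m + 1) t = 0"
      using 2 by (simp add: flat_exp_def)
    ultimately show ?thesis by (simp only:)
  next
    case 3
    \<comment> \<open>At 0 the difference quotient is itself a member of the family: dividing by
      \<open>h\<close> raises the index by one. So the derivative at 0 is the limit already
      computed.\<close>
    have "(\<lambda>h. (flat_exp m (0 + h) - flat_exp m 0) / h) = flat_exp (m + 1)"
      by (rule ext) (simp add: flat_exp_def divide_inverse)
    moreover have "flat_exp (m + 2) t - real m * flat_exp (m + 1) t = 0"
      using 3 by (simp add: flat_exp_def)
    ultimately show ?thesis
      using 3 flat_tendsto_0[of "m + 1"] by (simp only: DERIV_def)
  qed
qed

text \<open>The argument \<open>1 - x \<bullet> x\<close> is polynomial, hence smooth also at the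
  origin, unlike \<open>1 - norm x\<close>. The index \<open>m\<close> is generalised because every
  differentiation raises it.\<close>

lemma C_k_flat: "C_k k (\<lambda>x::'a::euclidean_space. flat_exp m (1 - x \<bullet> x))"
proof (induction k arbitrary: m)
  case 0
  have "continuous_on UNIV (flat_exp m)"
    by (intro DERIV_continuous_on) (use flat_DERIV has_field_derivative_at_within in blast)
  then show ?case
    by (auto intro!: continuous_intros continuous_on_compose2[of UNIV "flat_exp m"])
next
  case (Suc k)
  show ?case
  proof (rule C_k_derivI)
    fix x :: 'a
    have 1: "((\<lambda>x. 1 - x \<bullet> x) has_derivative (\<lambda>h. - 2 * (x \<bullet> h))) (at x)"
      by (auto intro!: derivative_eq_intros simp: inner_commute)
    show "((\<lambda>x. flat_exp m (1 - x \<bullet> x)) has_derivative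
       (\<lambda>h. (flat_exp (m + 2) (1 - x \<bullet> x) - real m * flat_exp (m + 1) (1 - x \<bullet> x)) * (- 2 * (x \<bullet> h)))) (at x)"
      using has_derivative_compose[OF 1 flat_DERIV[unfolded has_field_derivative_def]] .
  next
    fix v :: 'a
    show "C_k k (\<lambda>x. (flat_exp (m + 2) (1 - x \<bullet> x) - real m * flat_exp (m + 1) (1 - x \<bullet> x)) * (- 2 * (x \<bullet> v)))"
      by (intro C_k_mult C_k_diff C_k_const C_k_inner Suc)
  qed
qed

section \<open>Smooth functions and a normalised bump\<close>

definition smooth :: "('a::euclidean_space \<Rightarrow> real) \<Rightarrow> bool" where
  "smooth f \<longleftrightarrow> (\<forall>k. C_k k f)"

lemma smooth_continuous: "smooth f \<Longrightarrow> continuous_on A f"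
  unfolding smooth_def by (metis C_k.simps(1) continuous_on_subset subset_UNIV)

lemma smooth_has_derivative:
  "smooth f \<Longrightarrow> (f has_derivative frechet_derivative f (at x)) (at x)"
  unfolding smooth_def using C_k_has_derivative by blast

lemma smooth_derivative: "smooth f \<Longrightarrow> smooth (\<lambda>x. frechet_derivative f (at x) v)"
  unfolding smooth_def by (metis C_k.simps(2))

lemma smooth_affine: "smooth f \<Longrightarrow> smooth (\<lambda>x. f (c *\<^sub>R x + w))"
  by (simp add: smooth_def C_k_affine)

lemma ex_bump:
  obtains \<rho> :: "'a::euclidean_space \<Rightarrow> real"
  where "smooth \<rho>" "\<And>x. 0 \<le> \<rho> x" "\<And>x. \<rho> x \<noteq> 0 \<Longrightarrow> norm x < 1"
    "integrable lborel \<rho>" "(\<integral>x. \<rho> x \<partial>lborel) = 1"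
proof -
  define \<phi> :: "'a \<Rightarrow> real" where "\<phi> x = flat_exp 0 (1 - x \<bullet> x)" for x
  have cont: "continuous_on UNIV \<phi>"
    using C_k_flat[of 0 0] by (simp add: \<phi>_def)
  have nonneg: "0 \<le> \<phi> x" for x by (simp add: \<phi>_def flat_exp_def)
  have supp: "norm x < 1" if "\<phi> x \<noteq> 0" for x
  proof -
    have "(norm x)\<^sup>2 < 1\<^sup>2"
      using that by (auto simp: \<phi>_def flat_exp_def power2_norm_eq_inner split: if_splits)
    then show ?thesis by (rule power2_less_imp_less) simp
  qed
  have int: "integrable lborel \<phi>"
  proof -
    have "integrable lborel (\<lambda>x. indicator (cball 0 1) x *\<^sub>R \<phi> x)"
      by (rule borel_integrable_compact) (auto intro: continuous_on_subset[OF cont])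
    moreover have "(\<lambda>x. indicator (cball 0 1) x *\<^sub>R \<phi> x) = \<phi>"
      using supp by (force simp: indicator_def)
    ultimately show ?thesis by simp
  qed
  \<comment> \<open>A nonnegative function with zero integral vanishes almost everywhere, but
    \<open>\<phi>\<close> is nonzero on an open set containing 0. The integral can therefore serve
    as a divisor below.\<close>
  have "(\<integral>x. \<phi> x \<partial>lborel) \<noteq> 0"
  proof
    assume "(\<integral>x. \<phi> x \<partial>lborel) = 0"
    then have "AE x in lborel. \<phi> x = 0"
      using integral_nonneg_eq_0_iff_AE[OF int] nonneg by simp
    moreover have "open {x. \<phi> x \<noteq> 0}"
      by (rule open_Collect_neq[OF cont]) simp
    moreover have "{x. \<phi> x \<noteq> 0} \<in> null_sets lborel" if "AE x in lborel. \<phi> x = 0" "open {x. \<phi> x \<noteq> 0}"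
      using AE_iff_null_sets[of "{x. \<phi> x \<noteq> 0}" lborel] that by simp
    ultimately have "negligible {x. \<phi> x \<noteq> 0}"
      using null_sets_completionI[of _ lborel] by (auto simp: negligible_iff_null_sets)
    with \<open>open {x. \<phi> x \<noteq> 0}\<close> have "{x. \<phi> x \<noteq> 0} = {}"
      using open_not_negligible by blast
    moreover have "\<phi> 0 \<noteq> 0" by (simp add: \<phi>_def flat_exp_def)
    ultimately show False by blast
  qed
  with nonneg have pos: "(\<integral>x. \<phi> x \<partial>lborel) > 0"
    by (simp add: less_le integral_nonneg_AE)
  show thesis
  proof
    show "smooth (\<lambda>x. inverse (\<integral>x. \<phi> x \<partial>lborel) * \<phi> x)"
      unfolding smooth_def \<phi>_def by (intro allI C_k_cmult C_k_flat)
  qed (use nonneg pos supp int in auto)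
qed

subsection \<open>Mollification in \<open>L\<^sup>1\<close>\<close>

text \<open>The formula \<open>lborel_affine\<close> writes Lebesgue measure as a multiple of the
  push-forward; multiplying by the reciprocal constant solves it for the push-forward.\<close>

lemma lborel_density_affine:
  fixes t :: "'a::euclidean_space"
  assumes "c \<noteq> 0"
  shows "distr lborel borel (\<lambda>x. t + c *\<^sub>R x) = density lborel (\<lambda>_. ennreal (inverse (\<bar>c\<bar> ^ DIM('a))))"
proof -
  have "density lborel (\<lambda>_. ennreal (inverse (\<bar>c\<bar> ^ DIM('a)))) =
      density (density (distr lborel borel (\<lambda>x. t + c *\<^sub>R x)) (\<lambda>_. \<bar>c\<bar>^DIM('a))) (\<lambda>_. ennreal (inverse (\<bar>c\<bar> ^ DIM('a))))"
    using lborel_affine[OF assms, of t] by simp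
  also have "\<dots> = density (distr lborel borel (\<lambda>x. t + c *\<^sub>R x)) (\<lambda>_. 1)"
    using assms by (subst density_density_eq) (auto simp: ennreal_mult[symmetric])
  finally show ?thesis by (simp add: density_1)
qed

lemma
  fixes f :: "'a::euclidean_space \<Rightarrow> 'b::{banach, second_countable_topology}"
  assumes [measurable]: "f \<in> borel_measurable borel" and c: "c \<noteq> 0"
  shows lborel_integral_affine:
      "(\<integral>x. f (t + c *\<^sub>R x) \<partial>lborel) = inverse (\<bar>c\<bar> ^ DIM('a)) *\<^sub>R (\<integral>x. f x \<partial>lborel)"
    and lborel_integrable_affine_iff:
      "integrable lborel (\<lambda>x. f (t + c *\<^sub>R x)) \<longleftrightarrow> integrable lborel f"
proof -
  have "(\<integral>x. f (t + c *\<^sub>R x) \<partial>lborel) = (\<integral>x. f x \<partial>distr lborel borel (\<lambda>x. t + c *\<^sub>R x))"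
    by (subst integral_distr) auto
  also have "\<dots> = (\<integral>x. inverse (\<bar>c\<bar> ^ DIM('a)) *\<^sub>R f x \<partial>lborel)"
    unfolding lborel_density_affine[OF c] by (subst integral_density) auto
  finally show "(\<integral>x. f (t + c *\<^sub>R x) \<partial>lborel) = inverse (\<bar>c\<bar> ^ DIM('a)) *\<^sub>R (\<integral>x. f x \<partial>lborel)"
    by simp
  have "integrable lborel (\<lambda>x. f (t + c *\<^sub>R x)) \<longleftrightarrow> integrable (distr lborel borel (\<lambda>x. t + c *\<^sub>R x)) f"
    by (subst integrable_distr_eq) auto
  also have "\<dots> \<longleftrightarrow> integrable lborel (\<lambda>x. inverse (\<bar>c\<bar> ^ DIM('a)) *\<^sub>R f x)"
    unfolding lborel_density_affine[OF c] by (subst integrable_density) auto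
  also have "\<dots> \<longleftrightarrow> integrable lborel f"
  proof
    assume "integrable lborel (\<lambda>x. inverse (\<bar>c\<bar> ^ DIM('a)) *\<^sub>R f x)"
    then have "integrable lborel (\<lambda>x. (\<bar>c\<bar> ^ DIM('a)) *\<^sub>R inverse (\<bar>c\<bar> ^ DIM('a)) *\<^sub>R f x)"
      by (rule integrable_scaleR_right)
    then show "integrable lborel f" using c by simp
  qed auto
  finally show "integrable lborel (\<lambda>x. f (t + c *\<^sub>R x)) \<longleftrightarrow> integrable lborel f" .
qed

lemma distr_lborel_reflect: "distr lborel borel (\<lambda>y. x - y) = (lborel :: 'a::euclidean_space measure)"
  using lborel_density_affine[of "-1" x] by (simp add: density_1)

lemma distr_lborel_translate: "distr lborel borel (\<lambda>y. y - x) = (lborel :: 'a::euclidean_space measure)"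
  using lborel_density_affine[of "1" "-x"] by (simp add: density_1)

lemma nn_integral_translate:
  fixes x :: "'a::euclidean_space"
  assumes [measurable]: "f \<in> borel_measurable borel"
  shows "(\<integral>\<^sup>+y. f (y - x) \<partial>lborel) = (\<integral>\<^sup>+y. f y \<partial>lborel)"
proof -
  have "(\<integral>\<^sup>+y. f (y - x) \<partial>lborel) = (\<integral>\<^sup>+y. f y \<partial>distr lborel borel (\<lambda>y. y - x))"
    by (subst nn_integral_distr) auto
  then show ?thesis unfolding distr_lborel_translate .
qed

lemma
  fixes f :: "'a::euclidean_space \<Rightarrow> 'b::{banach, second_countable_topology}"
  assumes "f \<in> borel_measurable borel"
  shows integral_reflect: "(\<integral>y. f (x - y) \<partial>lborel) = (\<integral>y. f y \<partial>lborel)"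
    and integrable_reflect: "integrable lborel (\<lambda>y. f (x - y)) \<longleftrightarrow> integrable lborel f"
  using lborel_integral_affine[OF assms, of "-1" x] lborel_integrable_affine_iff[OF assms, of "-1" x]
  by simp_all

lemma integrable_indicator_cball: "integrable lborel (\<lambda>x. indicator (cball (z::'a::euclidean_space) R) x :: real)"
  using emeasure_lborel_cball_finite[of z R] by (intro integrable_real_indicator) auto

text \<open>Measurability alone yields continuous functions \<open>G n\<close> converging to
  \<open>f\<close> almost everywhere, but without a common bound. A continuous cut-off
  \<open>c m\<close> and a continuous clipping \<open>T m\<close> are applied to \<open>f\<close>
  and to each \<open>G n\<close>; they cost little for large \<open>m\<close> and make the sequence
  dominated.\<close>

lemma L1_dense_continuous:
  fixes f :: "'a::euclidean_space \<Rightarrow> real"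
  assumes f: "integrable lborel f" and "\<epsilon> > 0"
  obtains g R where "continuous_on UNIV g" "R > 0" "\<And>x. norm x > R \<Longrightarrow> g x = 0"
    "integrable lborel g" "(\<integral>x. \<bar>f x - g x\<bar> \<partial>lborel) < \<epsilon>"
proof -
  have [measurable]: "f \<in> borel_measurable borel" using f by simp
  have "f \<in> borel_measurable (lebesgue_on UNIV)"
    by (simp add: lebesgue_on_UNIV_eq measurable_completion)
  then have "f measurable_on UNIV"
    by (subst measurable_on_iff_borel_measurable) auto
  then obtain N G where N: "negligible N" and G: "\<And>n. continuous_on UNIV (G n)"
    and lim: "\<And>x. x \<notin> N \<Longrightarrow> (\<lambda>n. G n x) \<longlonglongrightarrow> f x"
    unfolding measurable_on_def by auto
  have AE_lim: "AE x in lborel. (\<lambda>n. G n x) \<longlonglongrightarrow> f x"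
  proof -
    have "AE x in lebesgue. x \<notin> N"
      using N by (simp add: negligible_iff_null_sets AE_not_in)
    then have "AE x in lebesgue. (\<lambda>n. G n x) \<longlonglongrightarrow> f x"
      by eventually_elim (rule lim)
    then show ?thesis by (simp add: AE_completion_iff)
  qed
  have [measurable]: "G n \<in> borel_measurable borel" for n
    using G by (rule borel_measurable_continuous_onI)
  \<comment> \<open>The product \<open>c m x * T m s\<close> is continuous in both variables,
    bounded by \<open>\<bar>s\<bar>\<close>, and bounded by \<open>m\<close> on a fixed ball: the
    first bound serves the limit in \<open>m\<close>, the second the limit in
    \<open>n\<close>.\<close>
  define c :: "nat \<Rightarrow> 'a \<Rightarrow> real" where "c m x = max 0 (min 1 (real m + 1 - norm x))" for m x
  define T :: "nat \<Rightarrow> real \<Rightarrow> real" where "T m s = max (- real m) (min (real m) s)" for m s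
  have c01: "0 \<le> c m x" "c m x \<le> 1" for m x by (auto simp: c_def)
  have T: "\<bar>T m s\<bar> \<le> \<bar>s\<bar>" "\<bar>T m s\<bar> \<le> real m" for m s by (auto simp: T_def)
  have cT: "\<bar>c m x * T m s\<bar> \<le> \<bar>s\<bar>" "\<bar>c m x * T m s\<bar> \<le> real m * indicator (cball 0 (real m + 1)) x" for m x s
  proof -
    have "\<bar>c m x * T m s\<bar> \<le> 1 * \<bar>T m s\<bar>"
      unfolding abs_mult by (intro mult_right_mono) (use c01[of m x] in auto)
    then show "\<bar>c m x * T m s\<bar> \<le> \<bar>s\<bar>" using T(1)[of m s] by simp
    from \<open>\<bar>c m x * T m s\<bar> \<le> 1 * \<bar>T m s\<bar>\<close> show "\<bar>c m x * T m s\<bar> \<le> real m * indicator (cball 0 (real m + 1)) x"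
      using T(2)[of m s] by (auto simp: indicator_def c_def)
  qed
  have [measurable]: "c m \<in> borel_measurable borel" "T m \<in> borel_measurable borel" for m
    unfolding c_def T_def by measurable
  have "(\<lambda>m. \<integral>x. \<bar>f x - c m x * T m (f x)\<bar> \<partial>lborel) \<longlonglongrightarrow> (\<integral>x. 0 \<partial>(lborel :: 'a measure))"
  proof (rule integral_dominated_convergence[where w="\<lambda>x. 2 * \<bar>f x\<bar>"])
    show "AE x in lborel. (\<lambda>m. \<bar>f x - c m x * T m (f x)\<bar>) \<longlonglongrightarrow> 0"
    proof (rule AE_I2, rule tendsto_eventually)
      fix x :: 'a
      obtain m0 :: nat where m0: "real m0 \<ge> \<bar>f x\<bar> + norm x" using real_arch_simple by blast
      have "\<bar>f x - c m x * T m (f x)\<bar> = 0" if "m \<ge> m0" for m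
      proof -
        have "real m \<ge> \<bar>f x\<bar> + norm x" using that m0 by linarith
        then have "real m \<ge> \<bar>f x\<bar>" "real m \<ge> norm x" using norm_ge_zero[of x] by linarith+
        then show ?thesis by (auto simp: c_def T_def min_def max_def)
      qed
      then show "\<forall>\<^sub>F m in sequentially. \<bar>f x - c m x * T m (f x)\<bar> = 0"
        by (auto simp: eventually_sequentially)
    qed
    show "AE x in lborel. norm \<bar>f x - c m x * T m (f x)\<bar> \<le> 2 * \<bar>f x\<bar>" for m
    proof (rule AE_I2)
      fix x show "norm \<bar>f x - c m x * T m (f x)\<bar> \<le> 2 * \<bar>f x\<bar>"
        using cT(1)[of m x "f x"] by simp
    qed
  qed (use f in auto)
  then have "\<forall>\<^sub>F m in sequentially. (\<integral>x. \<bar>f x - c m x * T m (f x)\<bar> \<partial>lborel) < \<epsilon> / 2"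
    using order_tendstoD(2)[of _ 0 sequentially "\<epsilon>/2"] \<open>\<epsilon> > 0\<close> by simp
  then obtain m where m: "(\<integral>x. \<bar>f x - c m x * T m (f x)\<bar> \<partial>lborel) < \<epsilon> / 2"
    by (auto simp: eventually_sequentially)
  have ib: "integrable lborel (\<lambda>x::'a. real m * indicator (cball 0 (real m + 1)) x)"
    by (intro integrable_mult_right integrable_indicator_cball)
  have int: "integrable lborel (\<lambda>x. c m x * T m (h x))" if [measurable]: "h \<in> borel_measurable borel" for h
    by (rule Bochner_Integration.integrable_bound[OF ib]) (use cT(2) in auto)
  \<comment> \<open>Here \<open>m\<close> is fixed, so a multiple of the indicator of one ball
    dominates.\<close>
  have "(\<lambda>n. \<integral>x. \<bar>c m x * T m (f x) - c m x * T m (G n x)\<bar> \<partial>lborel) \<longlonglongrightarrow> (\<integral>x. 0 \<partial>(lborel :: 'a measure))"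
  proof (rule integral_dominated_convergence[where w="\<lambda>x. 2 * (real m * indicator (cball 0 (real m + 1)) x)"])
    show "AE x in lborel. (\<lambda>n. \<bar>c m x * T m (f x) - c m x * T m (G n x)\<bar>) \<longlonglongrightarrow> 0"
      using AE_lim
    proof eventually_elim
      case (elim x)
      have "(\<lambda>n. T m (G n x)) \<longlonglongrightarrow> T m (f x)"
        unfolding T_def by (intro tendsto_intros elim)
      then have "(\<lambda>n. \<bar>c m x * T m (f x) - c m x * T m (G n x)\<bar>) \<longlonglongrightarrow> \<bar>c m x * T m (f x) - c m x * T m (f x)\<bar>"
        by (intro tendsto_intros)
      then show ?case by simp
    qed
    show "AE x in lborel. norm \<bar>c m x * T m (f x) - c m x * T m (G n x)\<bar> \<le> 2 * (real m * indicator (cball 0 (real m + 1)) x)" for n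
    proof (rule AE_I2)
      fix x show "norm \<bar>c m x * T m (f x) - c m x * T m (G n x)\<bar> \<le> 2 * (real m * indicator (cball 0 (real m + 1)) x)"
        using cT(2)[of m x "f x"] cT(2)[of m x "G n x"] by simp
    qed
    show "integrable lborel (\<lambda>x::'a. 2 * (real m * indicator (cball 0 (real m + 1)) x))"
      using ib by (rule integrable_mult_right)
  qed auto
  then have "\<forall>\<^sub>F n in sequentially. (\<integral>x. \<bar>c m x * T m (f x) - c m x * T m (G n x)\<bar> \<partial>lborel) < \<epsilon> / 2"
    using order_tendstoD(2)[of _ 0 sequentially "\<epsilon>/2"] \<open>\<epsilon> > 0\<close> by simp
  then obtain n where n: "(\<integral>x. \<bar>c m x * T m (f x) - c m x * T m (G n x)\<bar> \<partial>lborel) < \<epsilon> / 2"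
    by (auto simp: eventually_sequentially)
  show thesis
  proof
    show "continuous_on UNIV (\<lambda>x. c m x * T m (G n x))"
      unfolding c_def T_def by (intro continuous_intros G)
    show "real m + 1 > 0" by simp
    show "c m x * T m (G n x) = 0" if "norm x > real m + 1" for x
      using that by (simp add: c_def)
    show "integrable lborel (\<lambda>x. c m x * T m (G n x))" by (rule int) simp
    have "(\<integral>x. \<bar>f x - c m x * T m (G n x)\<bar> \<partial>lborel) \<le>
      (\<integral>x. \<bar>f x - c m x * T m (f x)\<bar> + \<bar>c m x * T m (f x) - c m x * T m (G n x)\<bar> \<partial>lborel)"
      by (intro integral_mono Bochner_Integration.integrable_add integrable_abs Bochner_Integration.integrable_diff f int) auto
    also have "\<dots> = (\<integral>x. \<bar>f x - c m x * T m (f x)\<bar> \<partial>lborel) + (\<integral>x. \<bar>c m x * T m (f x) - c m x * T m (G n x)\<bar> \<partial>lborel)"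
      by (intro Bochner_Integration.integral_add integrable_abs Bochner_Integration.integrable_diff f int) auto
    also have "\<dots> < \<epsilon>" using m n by simp
    finally show "(\<integral>x. \<bar>f x - c m x * T m (G n x)\<bar> \<partial>lborel) < \<epsilon>" .
  qed
qed

section \<open>Convolution and approximate identities\<close>

definition conv :: "('a::euclidean_space \<Rightarrow> real) \<Rightarrow> ('a \<Rightarrow> 'b::euclidean_space) \<Rightarrow> 'a \<Rightarrow> 'b" where
  "conv k f x = (\<integral>y. k (x - y) *\<^sub>R f y \<partial>lborel)"

definition bounded_support :: "('a::real_normed_vector \<Rightarrow> 'b::zero) \<Rightarrow> bool" where
  "bounded_support k \<longleftrightarrow> (\<exists>R. \<forall>x. k x \<noteq> 0 \<longrightarrow> norm x \<le> R)"

lemma continuous_bdd_supp_bounded: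
  fixes k :: "'a::euclidean_space \<Rightarrow> 'b::real_normed_vector"
  assumes "continuous_on UNIV k" "bounded_support k"
  obtains B where "B > 0" "\<And>x. norm (k x) \<le> B"
proof -
  obtain R where R: "\<And>x. k x \<noteq> 0 \<Longrightarrow> norm x \<le> R" using assms by (auto simp: bounded_support_def)
  have "bounded (k ` cball 0 R)"
    by (intro compact_imp_bounded compact_continuous_image) (use assms continuous_on_subset in auto)
  then obtain B where B: "B > 0" "\<And>x. x \<in> cball 0 R \<Longrightarrow> norm (k x) \<le> B"
    by (auto simp: bounded_pos)
  have "norm (k x) \<le> B" for x
    using R[of x] B by (cases "k x = 0") auto
  with B show thesis using that by blast
qed

lemma continuous_bdd_supp_integrable:
  fixes k :: "'a::euclidean_space \<Rightarrow> 'b::{banach, second_countable_topology}"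
  assumes "continuous_on UNIV k" "bounded_support k"
  shows "integrable lborel k"
proof -
  obtain R where R: "\<And>x. k x \<noteq> 0 \<Longrightarrow> norm x \<le> R" using assms by (auto simp: bounded_support_def)
  have "integrable lborel (\<lambda>x. indicator (cball 0 R) x *\<^sub>R k x)"
    by (rule borel_integrable_compact) (auto intro: continuous_on_subset[OF assms(1)])
  moreover have "(\<lambda>x. indicator (cball 0 R) x *\<^sub>R k x) = k"
    using R by (force simp: indicator_def)
  ultimately show ?thesis by simp
qed

lemma integrable_kernel_mult:
  fixes f :: "'a::euclidean_space \<Rightarrow> 'b::{banach, second_countable_topology}"
  assumes f: "integrable lborel f" and k: "continuous_on UNIV k" "bounded_support k"
  shows "integrable lborel (\<lambda>y. k (x - y) *\<^sub>R f y)"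
proof -
  obtain B where B: "\<And>x. norm (k x) \<le> B" using continuous_bdd_supp_bounded[OF k] by metis
  have [measurable]: "k \<in> borel_measurable borel" using k by (simp add: borel_measurable_continuous_onI)
  have [measurable]: "f \<in> borel_measurable borel" using f by simp
  have "integrable lborel (\<lambda>y. B *\<^sub>R f y)" using f by simp
  then show ?thesis
  proof (rule Bochner_Integration.integrable_bound)
    show "AE y in lborel. norm (k (x - y) *\<^sub>R f y) \<le> norm (B *\<^sub>R f y)"
    proof (rule AE_I2)
      fix y
      have "\<bar>k (x - y)\<bar> \<le> \<bar>B\<bar>" using B[of "x - y"] by simp
      then show "norm (k (x - y) *\<^sub>R f y) \<le> norm (B *\<^sub>R f y)"
        by (simp add: mult_right_mono)
    qed
  qed simp
qed

lemma borel_measurable_conv[measurable]: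
  assumes [measurable]: "k \<in> borel_measurable borel" "f \<in> borel_measurable borel"
  shows "conv k f \<in> borel_measurable borel"
proof -
  have "(\<lambda>x. conv k f x) \<in> borel_measurable lborel"
    unfolding conv_def by (intro lborel.borel_measurable_lebesgue_integral) measurable
  then show ?thesis by simp
qed

text \<open>Young's inequality for two factors in \<open>L^1\<close>: the norm goes inside the
  integral, the order of integration is exchanged, and the inner integral is translation
  invariant.\<close>

lemma nn_integral_conv_le:
  fixes f :: "'a::euclidean_space \<Rightarrow> 'b::euclidean_space"
  assumes [measurable]: "k \<in> borel_measurable borel" "f \<in> borel_measurable borel"
    and int: "\<And>x. integrable lborel (\<lambda>y. k (x - y) *\<^sub>R f y)"
  shows "(\<integral>\<^sup>+x. ennreal (norm (conv k f x)) \<partial>lborel) \<le>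
    (\<integral>\<^sup>+x. ennreal \<bar>k x\<bar> \<partial>lborel) * (\<integral>\<^sup>+x. ennreal (norm (f x)) \<partial>lborel)"
proof -
  have "(\<integral>\<^sup>+x. ennreal (norm (conv k f x)) \<partial>lborel) \<le>
      (\<integral>\<^sup>+x. \<integral>\<^sup>+y. ennreal \<bar>k (x - y)\<bar> * ennreal (norm (f y)) \<partial>lborel \<partial>lborel)"
    unfolding conv_def
    using integral_norm_bound_ennreal[OF int] by (intro nn_integral_mono) (simp add: ennreal_mult)
  also have "\<dots> = (\<integral>\<^sup>+y. \<integral>\<^sup>+x. ennreal \<bar>k (x - y)\<bar> * ennreal (norm (f y)) \<partial>lborel \<partial>lborel)"
    by (rule lborel_pair.Fubini') simp
  also have "\<dots> = (\<integral>\<^sup>+y. (\<integral>\<^sup>+x. ennreal \<bar>k x\<bar> \<partial>lborel) * ennreal (norm (f y)) \<partial>lborel)"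
    using nn_integral_translate[of "\<lambda>x. ennreal \<bar>k x\<bar>"]
    by (simp add: nn_integral_multc)
  also have "\<dots> = (\<integral>\<^sup>+x. ennreal \<bar>k x\<bar> \<partial>lborel) * (\<integral>\<^sup>+x. ennreal (norm (f x)) \<partial>lborel)"
    by (simp add: nn_integral_cmult)
  finally show ?thesis .
qed

text \<open>Neither symmetry nor a special shape is required, so a bump shifted away from the origin
  qualifies, with \<open>d\<close> measuring the farthest point of its support.\<close>

definition mollifier :: "real \<Rightarrow> ('a::euclidean_space \<Rightarrow> real) \<Rightarrow> bool" where
  "mollifier d k \<longleftrightarrow> continuous_on UNIV k \<and> (\<forall>x. 0 \<le> k x) \<and> (\<integral>x. k x \<partial>lborel) = 1 \<and>
     (\<forall>x. k x \<noteq> 0 \<longrightarrow> norm x \<le> d)"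

lemma mollifierD:
  assumes "mollifier d k"
  shows "continuous_on UNIV k" "0 \<le> k x" "(\<integral>x. k x \<partial>lborel) = 1" "k x \<noteq> 0 \<Longrightarrow> norm x \<le> d"
    "bounded_support k" "integrable lborel k" "k \<in> borel_measurable borel"
    "(\<integral>\<^sup>+x. ennreal \<bar>k x\<bar> \<partial>lborel) = 1"
proof -
  show 1: "continuous_on UNIV k" "0 \<le> k x" "(\<integral>x. k x \<partial>lborel) = 1" "k x \<noteq> 0 \<Longrightarrow> norm x \<le> d"
    and 2: "bounded_support k" for x
    using assms by (auto simp: mollifier_def bounded_support_def)
  show 3: "integrable lborel k" by (rule continuous_bdd_supp_integrable[OF 1(1) 2])
  then show "k \<in> borel_measurable borel" by simp
  have "(\<integral>\<^sup>+x. ennreal \<bar>k x\<bar> \<partial>lborel) = ennreal (\<integral>x. k x \<partial>lborel)"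
    using 1(2) nn_integral_eq_integral[OF 3] by simp
  then show "(\<integral>\<^sup>+x. ennreal \<bar>k x\<bar> \<partial>lborel) = 1" using 1(3) by simp
qed

lemma mollifier_mono: "mollifier d k \<Longrightarrow> d \<le> d' \<Longrightarrow> mollifier d' k"
  unfolding mollifier_def by (meson order_trans)

lemma
  fixes f :: "'a::euclidean_space \<Rightarrow> 'b::euclidean_space"
  assumes k: "mollifier d k" and f: "integrable lborel f"
  shows conv_mollifier_integrable: "integrable lborel (conv k f)"
    and conv_mollifier_norm_le: "(\<integral>x. norm (conv k f x) \<partial>lborel) \<le> (\<integral>x. norm (f x) \<partial>lborel)"
proof -
  note kD = mollifierD[OF k]
  have [measurable]: "f \<in> borel_measurable borel" using f by simp
  have le: "(\<integral>\<^sup>+x. ennreal (norm (conv k f x)) \<partial>lborel) \<le> (\<integral>\<^sup>+x. ennreal (norm (f x)) \<partial>lborel)"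
    using nn_integral_conv_le[OF kD(7) _ integrable_kernel_mult[OF f kD(1,5)]] kD(8) by simp
  also have fin: "(\<integral>\<^sup>+x. ennreal (norm (f x)) \<partial>lborel) = ennreal (\<integral>x. norm (f x) \<partial>lborel)"
    using f by (intro nn_integral_eq_integral) auto
  finally have *: "(\<integral>\<^sup>+x. ennreal (norm (conv k f x)) \<partial>lborel) \<le> ennreal (\<integral>x. norm (f x) \<partial>lborel)" .
  show i: "integrable lborel (conv k f)"
    using * kD(7) by (intro integrableI_bounded) (auto simp: le_less_trans)
  then show "(\<integral>x. norm (conv k f x) \<partial>lborel) \<le> (\<integral>x. norm (f x) \<partial>lborel)"
    using * by (subst (asm) nn_integral_eq_integral) auto
qed

lemma conv_diff:
  assumes "integrable lborel f" "integrable lborel g" "continuous_on UNIV k" "bounded_support k"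
  shows "conv k (\<lambda>x. f x - g x) x = conv k f x - conv k g x"
  unfolding conv_def scaleR_diff_right
  by (intro Bochner_Integration.integral_diff integrable_kernel_mult assms)

text \<open>An argument with \<open>\<epsilon> / 3\<close>: convolution does not increase the
  \<open>L^1\<close> distance to a continuous \<open>g\<close>, and \<open>conv k g\<close> is
  uniformly close to \<open>g\<close>. The radius \<open>d\<close> works for all kernels at once,
  which later allows shifted bumps.\<close>

lemma mollify_L1_real:
  fixes f :: "'a::euclidean_space \<Rightarrow> real"
  assumes f: "integrable lborel f" and "\<epsilon> > 0"
  shows "\<exists>d>0. \<forall>k. mollifier d k \<longrightarrow> (\<integral>x. \<bar>conv k f x - f x\<bar> \<partial>lborel) < \<epsilon>"
proof -
  obtain g R where g: "continuous_on UNIV g" "R > 0" "\<And>x. norm x > R \<Longrightarrow> g x = 0"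
    "integrable lborel g" "(\<integral>x. \<bar>f x - g x\<bar> \<partial>lborel) < \<epsilon> / 3"
    using L1_dense_continuous[OF f, of "\<epsilon>/3"] \<open>\<epsilon> > 0\<close> by auto
  \<comment> \<open>The volume of the ball that contains the supports of \<open>g\<close> and
    \<open>conv k g\<close>; adding 1 makes positivity evident.\<close>
  define V where "V = (\<integral>x. indicator (cball (0::'a) (R + 1)) x \<partial>lborel) + (1::real)"
  have "V > 0" unfolding V_def by (simp add: add_nonneg_pos)
  define \<eta> where "\<eta> = \<epsilon> / (3 * V)"
  have "\<eta> > 0" using \<open>V > 0\<close> \<open>\<epsilon> > 0\<close> by (simp add: \<eta>_def)
  have "uniformly_continuous_on (cball 0 (R + 2)) g"
    by (intro compact_uniformly_continuous continuous_on_subset[OF g(1)]) auto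
  then obtain d0 where d0: "d0 > 0" "\<And>x y. x \<in> cball 0 (R+2) \<Longrightarrow> y \<in> cball 0 (R+2) \<Longrightarrow> dist y x < d0 \<Longrightarrow> dist (g y) (g x) < \<eta>"
    using \<open>\<eta> > 0\<close> unfolding uniformly_continuous_on_def by metis
  \<comment> \<open>The bound 1 keeps \<open>conv k g\<close> supported in the ball of radius
    \<open>R + 1\<close>; the half turns the non-strict support condition into the strict distance
    needed for uniform continuity.\<close>
  define d where "d = min 1 (d0 / 2)"
  have d: "d > 0" "d \<le> 1" "d < d0" using d0 by (auto simp: d_def)
  have "(\<integral>x. \<bar>conv k f x - f x\<bar> \<partial>lborel) < \<epsilon>" if k: "mollifier d k" for k
  proof -
    note kD = mollifierD[OF k]
    have pt: "\<bar>conv k g x - g x\<bar> \<le> \<eta> * indicator (cball 0 (R + 1)) x" for x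
    proof -
      have ik: "integrable lborel (\<lambda>y. k (x - y))" "(\<integral>y. k (x - y) \<partial>lborel) = 1"
        using integrable_reflect[OF kD(7), of x] integral_reflect[OF kD(7), of x] kD(3,6) by auto
      have "conv k g x - g x = (\<integral>y. k (x - y) * g y \<partial>lborel) - (\<integral>y. k (x - y) * g x \<partial>lborel)"
        using ik by (simp add: conv_def)
      also have "\<dots> = (\<integral>y. k (x - y) * g y - k (x - y) * g x \<partial>lborel)"
        using integrable_kernel_mult[OF g(4) kD(1,5)] ik
        by (intro Bochner_Integration.integral_diff[symmetric]) auto
      finally have eq: "conv k g x - g x = (\<integral>y. k (x - y) * g y - k (x - y) * g x \<partial>lborel)" .
      have int: "integrable lborel (\<lambda>y. k (x - y) * g y - k (x - y) * g x)"
        using integrable_kernel_mult[OF g(4) kD(1,5), of x] ik by (intro Bochner_Integration.integrable_diff) auto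
      have bd: "\<bar>k (x - y) * g y - k (x - y) * g x\<bar> \<le> (\<eta> * indicator (cball 0 (R + 1)) x) * k (x - y)" for y
      proof (cases "k (x - y) = 0")
        case False
        then have xy: "norm (x - y) \<le> d" using kD(4) by blast
        have "\<bar>g y - g x\<bar> \<le> \<eta> * indicator (cball 0 (R + 1)) x"
        proof (cases "norm x \<le> R + 1")
          case True
          have "norm y \<le> norm x + norm (x - y)" by norm
          then have "y \<in> cball 0 (R + 2)" using True xy d by auto
          moreover have "x \<in> cball 0 (R + 2)" using True by auto
          moreover have "dist y x < d0" using xy d by (simp add: dist_norm norm_minus_commute)
          ultimately have "dist (g y) (g x) < \<eta>" using d0 by blast
          then show ?thesis using True by (simp add: dist_real_def)
        next
          case False
          have "norm x \<le> norm y + norm (x - y)" by norm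
          then have "norm y > R" using False xy d by linarith
          then show ?thesis using g(3)[of x] g(3)[of y] False by simp
        qed
        then have "\<bar>k (x - y)\<bar> * \<bar>g y - g x\<bar> \<le> \<bar>k (x - y)\<bar> * (\<eta> * indicator (cball 0 (R + 1)) x)"
          by (intro mult_left_mono) auto
        moreover have "\<bar>k (x - y)\<bar> * \<bar>g y - g x\<bar> = \<bar>k (x - y) * g y - k (x - y) * g x\<bar>"
          by (simp add: abs_mult[symmetric] right_diff_distrib)
        ultimately show ?thesis using kD(2)[of "x - y"] by (simp add: mult.commute)
      qed simp
      have "\<bar>conv k g x - g x\<bar> \<le> (\<integral>y. \<bar>k (x - y) * g y - k (x - y) * g x\<bar> \<partial>lborel)"
        unfolding eq by (rule integral_abs_bound)
      also have "\<dots> \<le> (\<integral>y. (\<eta> * indicator (cball 0 (R + 1)) x) * k (x - y) \<partial>lborel)"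
        using int ik bd by (intro integral_mono) auto
      also have "\<dots> = \<eta> * indicator (cball 0 (R + 1)) x" using ik by simp
      finally show ?thesis .
    qed
    have ig: "integrable lborel (conv k g)" "integrable lborel (conv k f)" "integrable lborel (conv k (\<lambda>x. f x - g x))"
      by (intro conv_mollifier_integrable[OF k] g f Bochner_Integration.integrable_diff)+
    have "(\<integral>x. \<bar>conv k g x - g x\<bar> \<partial>lborel) \<le> (\<integral>x. \<eta> * indicator (cball (0::'a) (R + 1)) x \<partial>lborel)"
      using ig g pt by (intro integral_mono integrable_mult_right integrable_indicator_cball) auto
    also have "\<dots> = \<eta> * (V - 1)"
      by (simp add: V_def)
    also have "\<dots> \<le> \<eta> * V" using \<open>\<eta> > 0\<close> by (intro mult_left_mono) auto
    also have "\<dots> = \<epsilon> / 3" using \<open>V > 0\<close> by (simp add: \<eta>_def)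
    finally have A: "(\<integral>x. \<bar>conv k g x - g x\<bar> \<partial>lborel) \<le> \<epsilon> / 3" .
    have B: "(\<integral>x. \<bar>conv k (\<lambda>x. f x - g x) x\<bar> \<partial>lborel) \<le> (\<integral>x. \<bar>f x - g x\<bar> \<partial>lborel)"
      using conv_mollifier_norm_le[OF k, of "\<lambda>x. f x - g x"] f g by simp
    have "(\<integral>x. \<bar>conv k f x - f x\<bar> \<partial>lborel) \<le>
      (\<integral>x. \<bar>conv k (\<lambda>x. f x - g x) x\<bar> + \<bar>conv k g x - g x\<bar> + \<bar>f x - g x\<bar> \<partial>lborel)"
    proof (rule integral_mono)
      fix x
      show "\<bar>conv k f x - f x\<bar> \<le> \<bar>conv k (\<lambda>x. f x - g x) x\<bar> + \<bar>conv k g x - g x\<bar> + \<bar>f x - g x\<bar>"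
        using conv_diff[OF f g(4) kD(1,5), of x] by simp
    qed (use ig f g in \<open>auto simp del: real_norm_def\<close>)
    also have "\<dots> = (\<integral>x. \<bar>conv k (\<lambda>x. f x - g x) x\<bar> \<partial>lborel) + (\<integral>x. \<bar>conv k g x - g x\<bar> \<partial>lborel) + (\<integral>x. \<bar>f x - g x\<bar> \<partial>lborel)"
      using ig f g by (simp add: Bochner_Integration.integral_add)
    also have "\<dots> < \<epsilon>" using A B g(5) by linarith
    finally show ?thesis .
  qed
  then show ?thesis using d by blast
qed

lemma conv_inner:
  assumes "integrable lborel f" "continuous_on UNIV k" "bounded_support k"
  shows "conv k f x \<bullet> b = conv k (\<lambda>x. f x \<bullet> b) x"
  unfolding conv_def
  by (subst integral_inner_left[symmetric]) (auto intro: integrable_kernel_mult assms)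

lemma mollify_L1:
  fixes f :: "'a::euclidean_space \<Rightarrow> 'b::euclidean_space"
  assumes f: "integrable lborel f" and "\<epsilon> > 0"
  shows "\<exists>d>0. \<forall>k. mollifier d k \<longrightarrow> (\<integral>x. norm (conv k f x - f x) \<partial>lborel) < \<epsilon>"
proof -
  have "\<forall>b\<in>Basis. \<exists>d>0. \<forall>k. mollifier d k \<longrightarrow> (\<integral>x. \<bar>conv k (\<lambda>x. f x \<bullet> b) x - f x \<bullet> b\<bar> \<partial>lborel) < \<epsilon> / DIM('b)"
    using f \<open>\<epsilon> > 0\<close> by (intro ballI mollify_L1_real) auto
  then obtain D where D: "\<And>b. b \<in> Basis \<Longrightarrow> D b > 0"
    "\<And>b k. b \<in> Basis \<Longrightarrow> mollifier (D b) k \<Longrightarrow> (\<integral>x. \<bar>conv k (\<lambda>x. f x \<bullet> b) x - f x \<bullet> b\<bar> \<partial>lborel) < \<epsilon> / DIM('b)"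
    by metis
  define d where "d = Min (D ` (Basis::'b set))"
  have d: "d > 0" "\<And>b. b \<in> Basis \<Longrightarrow> d \<le> D b"
    using D(1) by (auto simp: d_def)
  have "(\<integral>x. norm (conv k f x - f x) \<partial>lborel) < \<epsilon>" if k: "mollifier d k" for k
  proof -
    note kD = mollifierD[OF k]
    have i: "integrable lborel (conv k f)" by (rule conv_mollifier_integrable[OF k f])
    have ib: "integrable lborel (conv k (\<lambda>x. f x \<bullet> b))" for b
      using f by (intro conv_mollifier_integrable[OF k]) auto
    have "(\<integral>x. norm (conv k f x - f x) \<partial>lborel) \<le> (\<integral>x. (\<Sum>b\<in>Basis. \<bar>conv k (\<lambda>x. f x \<bullet> b) x - f x \<bullet> b\<bar>) \<partial>lborel)"
    proof (rule integral_mono)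
      fix x
      show "norm (conv k f x - f x) \<le> (\<Sum>b\<in>Basis. \<bar>conv k (\<lambda>x. f x \<bullet> b) x - f x \<bullet> b\<bar>)"
        using norm_le_l1[of "conv k f x - f x"] conv_inner[OF f kD(1,5), of x]
        by (simp add: inner_diff_left)
    qed (use i ib f in auto)
    also have "\<dots> = (\<Sum>b\<in>Basis. \<integral>x. \<bar>conv k (\<lambda>x. f x \<bullet> b) x - f x \<bullet> b\<bar> \<partial>lborel)"
      using ib f by (intro Bochner_Integration.integral_sum) auto
    also have "\<dots> < (\<Sum>b\<in>(Basis::'b set). \<epsilon> / DIM('b))"
      by (intro sum_strict_mono D(2) mollifier_mono[OF k] d) auto
    also have "\<dots> = \<epsilon>" by simp
    finally show ?thesis .
  qed
  then show ?thesis using d by blast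
qed

subsection \<open>Convolution with smooth kernels\<close>

text \<open>Two points at distance less than 1 either both lie in the slightly larger compact ball,
  or both lie where \<open>k\<close> vanishes.\<close>

lemma continuous_bdd_supp_uniform:
  fixes k :: "'a::euclidean_space \<Rightarrow> 'b::real_normed_vector"
  assumes k: "continuous_on UNIV k" "bounded_support k"
  shows "uniformly_continuous_on UNIV k"
proof -
  obtain R where R: "\<And>x. k x \<noteq> 0 \<Longrightarrow> norm x \<le> R" using k by (auto simp: bounded_support_def)
  have "uniformly_continuous_on (cball 0 (R + 1)) k"
    by (intro compact_uniformly_continuous continuous_on_subset[OF k(1)]) auto
  then have uc: "\<exists>d>0. \<forall>x\<in>cball 0 (R+1). \<forall>y\<in>cball 0 (R+1). dist y x < d \<longrightarrow> dist (k y) (k x) < e" if "e > 0" for e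
    using that unfolding uniformly_continuous_on_def by metis
  show ?thesis
    unfolding uniformly_continuous_on_def
  proof (intro allI impI)
    fix e :: real assume "e > 0"
    then obtain d where d: "d > 0" "\<And>x y. x \<in> cball 0 (R+1) \<Longrightarrow> y \<in> cball 0 (R+1) \<Longrightarrow> dist y x < d \<Longrightarrow> dist (k y) (k x) < e"
      using uc by metis
    have "dist (k y) (k x) < e" if "dist y x < min 1 d" for x y
    proof (cases "norm x \<le> R \<or> norm y \<le> R")
      case True
      have "dist y x < 1" using that by simp
      then have "norm x \<le> norm y + 1" "norm y \<le> norm x + 1" by norm+
      then show ?thesis using True that d(2)[of x y] by auto
    next
      case False
      then have "k x = 0" "k y = 0" using R by blast+
      then show ?thesis using \<open>e > 0\<close> by simp
    qed
    then show "\<exists>d>0. \<forall>x\<in>UNIV. \<forall>y\<in>UNIV. dist y x < d \<longrightarrow> dist (k y) (k x) < e"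
      using d(1) by (intro exI[of _ "min 1 d"]) auto
  qed
qed

section \<open>\<open>C^1\<close> functions and the derivative of a convolution\<close>

definition has_grad :: "('a::euclidean_space \<Rightarrow> real) \<Rightarrow> ('a \<Rightarrow> 'a) \<Rightarrow> bool" where
  "has_grad \<psi> D \<longleftrightarrow> (\<forall>x. (\<psi> has_derivative (\<lambda>h. D x \<bullet> h)) (at x)) \<and> continuous_on UNIV D"

lemma has_gradD:
  assumes "has_grad \<psi> D"
  shows "(\<psi> has_derivative (\<lambda>h. D x \<bullet> h)) (at x)" "continuous_on A D" "continuous_on A \<psi>"
    "D \<in> borel_measurable borel" "\<psi> \<in> borel_measurable borel"
proof -
  show *: "(\<psi> has_derivative (\<lambda>h. D x \<bullet> h)) (at x)" "continuous_on A D" for x A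
    using assms continuous_on_subset[of UNIV D A] by (auto simp: has_grad_def)
  show **: "continuous_on A \<psi>" for A
    by (rule has_derivative_continuous_on, rule has_derivative_at_withinI, rule *(1))
  show "D \<in> borel_measurable borel" "\<psi> \<in> borel_measurable borel"
    by (rule borel_measurable_continuous_onI, rule * **)+
qed

lemma has_grad_zero_outside:
  assumes "has_grad \<psi> D" "x \<notin> closure {x. \<psi> x \<noteq> 0}"
  shows "D x = 0"
proof -
  have "((\<lambda>_. 0) has_derivative (\<lambda>h. D x \<bullet> h)) (at x)"
  proof (rule has_derivative_transform_within_open[OF has_gradD(1)[OF assms(1)]])
    show "open (- closure {x. \<psi> x \<noteq> 0})" by (rule open_Compl[OF closed_closure])
    show "x \<in> - closure {x. \<psi> x \<noteq> 0}" using assms(2) by simp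
    show "\<psi> y = 0" if "y \<in> - closure {x. \<psi> x \<noteq> 0}" for y
      using that closure_subset[of "{x. \<psi> x \<noteq> 0}"] by auto
  qed
  then have "(\<lambda>h. D x \<bullet> h) = (\<lambda>h. 0)"
    by (rule has_derivative_unique) (rule has_derivative_const)
  then have "D x \<bullet> D x = 0" by (rule fun_cong)
  then show ?thesis by simp
qed

lemma bdd_supp_closure:
  assumes "bounded_support \<psi>"
  obtains R where "R > 0" "closure {x. \<psi> x \<noteq> 0} \<subseteq> cball 0 R"
proof -
  obtain R where R: "\<And>x. \<psi> x \<noteq> 0 \<Longrightarrow> norm x \<le> R" using assms by (auto simp: bounded_support_def)
  have "closure {x. \<psi> x \<noteq> 0} \<subseteq> cball 0 (max R 1)"
    by (rule closure_minimal) (use R in force)+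
  then show thesis using that[of "max R 1"] by simp
qed

lemma has_grad_bdd_supp:
  assumes "has_grad \<psi> D" "bounded_support \<psi>"
  shows "bounded_support D"
proof -
  obtain R where "closure {x. \<psi> x \<noteq> 0} \<subseteq> cball 0 R" using bdd_supp_closure[OF assms(2)] by metis
  then show ?thesis
    using has_grad_zero_outside[OF assms(1)] unfolding bounded_support_def
    by (intro exI[of _ R]) (metis mem_cball_0 subsetD)
qed

text \<open>The first-order remainder is small uniformly in the base point, because the gradient is
  uniformly continuous. This is what permits integrating the expansion against an \<open>L^1\<close>
  function.\<close>

lemma has_grad_uniform:
  assumes g: "has_grad \<psi> D" "bounded_support \<psi>" and "e > 0"
  obtains d where "d > 0" "\<And>z h. norm h < d \<Longrightarrow> \<bar>\<psi> (z + h) - \<psi> z - D z \<bullet> h\<bar> \<le> e * norm h"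
proof -
  have "uniformly_continuous_on UNIV D"
    by (intro continuous_bdd_supp_uniform has_gradD(2)[OF g(1)] has_grad_bdd_supp[OF g])
  then obtain d where d: "d > 0" "\<And>x y. dist y x < d \<Longrightarrow> dist (D y) (D x) < e"
    using \<open>e > 0\<close> unfolding uniformly_continuous_on_def by (metis UNIV_I)
  have "\<bar>\<psi> (z + h) - \<psi> z - D z \<bullet> h\<bar> \<le> e * norm h" if "norm h < d" for z h
  proof -
    have "norm (\<psi> (z + h) - \<psi> z - D z \<bullet> (z + h - z)) \<le> norm (z + h - z) * e"
    proof (rule differentiable_bound_linearization[where S="ball z d" and f'="\<lambda>x h. D x \<bullet> h"])
      show "z + t *\<^sub>R (z + h - z) \<in> ball z d" if "t \<in> {0..1}" for t
      proof -
        have "t * norm h \<le> 1 * norm h" using that by (intro mult_right_mono) auto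
        then have "norm (t *\<^sub>R h) \<le> norm h" using that by simp
        then show ?thesis using \<open>norm h < d\<close> by (simp add: dist_norm)
      qed
      show "(\<psi> has_derivative (\<lambda>h. D x \<bullet> h)) (at x within ball z d)" for x
        using has_gradD(1)[OF g(1)] by (rule has_derivative_at_withinI)
      show "onorm ((\<lambda>h. D x \<bullet> h) - (\<lambda>h. D z \<bullet> h)) \<le> e" if "x \<in> ball z d" for x
      proof (rule onorm_le)
        fix i
        have "norm (D x \<bullet> i - D z \<bullet> i) = \<bar>(D x - D z) \<bullet> i\<bar>" by (simp add: inner_diff_left)
        also have "\<dots> \<le> norm (D x - D z) * norm i" by (rule Cauchy_Schwarz_ineq2)
        also have "\<dots> \<le> e * norm i"
          using d(2)[of x z] that by (intro mult_right_mono) (auto simp: dist_norm norm_minus_commute)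
        finally show "norm (((\<lambda>h. D x \<bullet> h) - (\<lambda>h. D z \<bullet> h)) i) \<le> e * norm i"
          by (simp add: fun_diff_def)
      qed
      show "z \<in> ball z d" using d by simp
    qed
    then show ?thesis by (simp add: mult.commute)
  qed
  with d(1) show thesis using that by blast
qed

lemma integrable_mult_kernel:
  fixes f :: "'a::euclidean_space \<Rightarrow> real" and D :: "'a \<Rightarrow> 'b::{banach,second_countable_topology}"
  assumes f: "integrable lborel f" and k: "continuous_on UNIV D" "bounded_support D"
  shows "integrable lborel (\<lambda>y. f y *\<^sub>R D (x - y))"
proof -
  obtain B where B: "\<And>x. norm (D x) \<le> B" using continuous_bdd_supp_bounded[OF k] by metis
  have [measurable]: "D \<in> borel_measurable borel" using k by (simp add: borel_measurable_continuous_onI)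
  have [measurable]: "f \<in> borel_measurable borel" using f by simp
  have "integrable lborel (\<lambda>y. f y * B)" using f by simp
  then show ?thesis
  proof (rule Bochner_Integration.integrable_bound)
    show "AE y in lborel. norm (f y *\<^sub>R D (x - y)) \<le> norm (f y * B)"
    proof (rule AE_I2)
      fix y
      have "norm (D (x - y)) \<le> \<bar>B\<bar>" using B[of "x - y"] by simp
      then show "norm (f y *\<^sub>R D (x - y)) \<le> norm (f y * B)"
        by (simp add: abs_mult mult_left_mono)
    qed
  qed simp
qed

lemma conv_grad_eq:
  fixes f :: "'a::euclidean_space \<Rightarrow> real"
  assumes f: "integrable lborel f" and g: "has_grad k D" "bounded_support k"
  shows "conv (\<lambda>x. D x \<bullet> h) f x = (\<integral>y. f y *\<^sub>R D (x - y) \<partial>lborel) \<bullet> h"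
  unfolding conv_def
  by (subst integral_inner_left[symmetric])
     (auto intro!: integrable_mult_kernel f has_gradD(2)[OF g(1)] has_grad_bdd_supp[OF g] simp: mult.commute)

text \<open>Expanding \<open>k\<close> at \<open>x - y\<close> leaves a remainder of at most a small
  multiple of \<open>norm h\<close>, uniformly in \<open>y\<close>; integrated against
  \<open>\<bar>f y\<bar>\<close> it stays of that order.\<close>

lemma conv_has_derivative:
  fixes f :: "'a::euclidean_space \<Rightarrow> real"
  assumes f: "integrable lborel f" and g: "has_grad k D" "bounded_support k"
  shows "(conv k f has_derivative (\<lambda>h. conv (\<lambda>x. D x \<bullet> h) f x)) (at x)"
proof -
  have ik: "integrable lborel (\<lambda>y. k (x - y) * f y)" for x
    using integrable_kernel_mult[OF f has_gradD(3)[OF g(1)] g(2), of x] by simp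
  have iD: "integrable lborel (\<lambda>y. (D (x - y) \<bullet> h) * f y)" for h x
    using integrable_inner_left[of h, OF integrable_mult_kernel[OF f has_gradD(2)[OF g(1)] has_grad_bdd_supp[OF g], of x]]
    by (simp add: mult.commute)
  have "bounded_linear (\<lambda>h. conv (\<lambda>x. D x \<bullet> h) f x)"
    unfolding conv_grad_eq[OF f g] by (rule bounded_linear_inner_right)
  moreover have "\<exists>d>0. \<forall>y. norm (y - x) < d \<longrightarrow>
      norm (conv k f y - conv k f x - conv (\<lambda>z. D z \<bullet> (y - x)) f x) \<le> e * norm (y - x)" if "e > 0" for e
  proof -
    define I where "I = (\<integral>y. \<bar>f y\<bar> \<partial>lborel)"
    have "I \<ge> 0" unfolding I_def by (rule integral_nonneg_AE) simp
    \<comment> \<open>The summand 1 covers the case that \<open>f\<close> vanishes almost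
      everywhere.\<close>
    then have "e / (I + 1) > 0" using that by simp
    then obtain d where d: "d > 0" "\<And>z h. norm h < d \<Longrightarrow> \<bar>k (z + h) - k z - D z \<bullet> h\<bar> \<le> (e / (I + 1)) * norm h"
      using has_grad_uniform[OF g] by metis
    have "norm (conv k f x' - conv k f x - conv (\<lambda>z. D z \<bullet> (x' - x)) f x) \<le> e * norm (x' - x)"
      if "norm (x' - x) < d" for x'
    proof -
      define h where "h = x' - x"
      have eq: "conv k f x' - conv k f x - conv (\<lambda>z. D z \<bullet> h) f x =
        (\<integral>y. (k (x' - y) * f y - k (x - y) * f y) - (D (x - y) \<bullet> h) * f y \<partial>lborel)"
        unfolding conv_def real_scaleR_def
        by (simp only: Bochner_Integration.integral_diff[OF Bochner_Integration.integrable_diff[OF ik ik] iD]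
            Bochner_Integration.integral_diff[OF ik ik])
      have "\<bar>conv k f x' - conv k f x - conv (\<lambda>z. D z \<bullet> h) f x\<bar> \<le>
          (\<integral>y. \<bar>(k (x' - y) * f y - k (x - y) * f y) - (D (x - y) \<bullet> h) * f y\<bar> \<partial>lborel)"
        unfolding eq by (rule integral_abs_bound)
      also have "\<dots> \<le> (\<integral>y. (e / (I + 1)) * norm h * \<bar>f y\<bar> \<partial>lborel)"
      proof (rule integral_mono)
        fix y
        have "\<bar>k ((x - y) + h) - k (x - y) - D (x - y) \<bullet> h\<bar> \<le> (e / (I + 1)) * norm h"
          using that by (intro d(2)) (simp only: h_def)
        then have "\<bar>k (x' - y) - k (x - y) - D (x - y) \<bullet> h\<bar> * \<bar>f y\<bar> \<le> (e / (I + 1)) * norm h * \<bar>f y\<bar>"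
          by (intro mult_right_mono) (simp_all add: h_def)
        then show "\<bar>(k (x' - y) * f y - k (x - y) * f y) - (D (x - y) \<bullet> h) * f y\<bar> \<le> (e / (I + 1)) * norm h * \<bar>f y\<bar>"
          by (simp add: abs_mult[symmetric] left_diff_distrib)
      next
        show "integrable lborel (\<lambda>y. \<bar>(k (x' - y) * f y - k (x - y) * f y) - (D (x - y) \<bullet> h) * f y\<bar>)"
          by (intro integrable_abs Bochner_Integration.integrable_diff ik iD)
        show "integrable lborel (\<lambda>y. (e / (I + 1)) * norm h * \<bar>f y\<bar>)"
          by (intro integrable_mult_right integrable_abs f)
      qed
      also have "\<dots> = (e / (I + 1)) * norm h * I" by (simp add: I_def)
      also have "\<dots> \<le> e * norm h"
      proof -
        have "e * norm h * I \<le> e * norm h * (I + 1)"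
          using \<open>e > 0\<close> by (intro mult_left_mono) auto
        then show ?thesis using \<open>I \<ge> 0\<close> by (simp add: divide_le_eq)
      qed
      finally show ?thesis by (simp add: h_def)
    qed
    then show ?thesis using d(1) by blast
  qed
  ultimately show ?thesis unfolding has_derivative_at_alt by blast
qed

definition grad :: "('a::euclidean_space \<Rightarrow> real) \<Rightarrow> 'a \<Rightarrow> 'a" where
  "grad \<psi> x = (\<Sum>b\<in>Basis. frechet_derivative \<psi> (at x) b *\<^sub>R b)"

lemma grad_inner:
  assumes "\<psi> differentiable (at x)"
  shows "grad \<psi> x \<bullet> h = frechet_derivative \<psi> (at x) h"
proof -
  have "linear (frechet_derivative \<psi> (at x))"
    using assms frechet_derivative_works has_derivative_linear by blast
  then have "frechet_derivative \<psi> (at x) (\<Sum>b\<in>Basis. (h \<bullet> b) *\<^sub>R b) =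
      (\<Sum>b\<in>Basis. (h \<bullet> b) * frechet_derivative \<psi> (at x) b)"
    by (simp add: linear_sum linear_scale)
  also have "\<dots> = grad \<psi> x \<bullet> h"
    by (simp add: grad_def inner_sum_left inner_commute[of h] mult.commute)
  finally show ?thesis by (simp add: euclidean_representation)
qed

lemma smooth_differentiable: "smooth f \<Longrightarrow> f differentiable (at x)"
  using smooth_has_derivative differentiable_def by blast

lemma smooth_has_grad:
  assumes "smooth \<psi>"
  shows "has_grad \<psi> (grad \<psi>)"
  unfolding has_grad_def
proof (intro conjI allI)
  fix x
  show "(\<psi> has_derivative (\<lambda>h. grad \<psi> x \<bullet> h)) (at x)"
    using smooth_has_derivative[OF assms, of x] by (simp add: grad_inner smooth_differentiable[OF assms])
  show "continuous_on UNIV (grad \<psi>)"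
    unfolding grad_def[abs_def]
    by (intro continuous_intros smooth_continuous smooth_derivative assms)
qed

lemma smooth_derivative_bdd_supp:
  assumes "smooth \<psi>" "bounded_support \<psi>"
  shows "bounded_support (\<lambda>x. frechet_derivative \<psi> (at x) v)"
proof -
  obtain R where R: "\<And>x. grad \<psi> x \<noteq> 0 \<Longrightarrow> norm x \<le> R"
    using has_grad_bdd_supp[OF smooth_has_grad assms(2)] assms by (auto simp: bounded_support_def)
  have "norm x \<le> R" if "frechet_derivative \<psi> (at x) v \<noteq> 0" for x
    using that R[of x]
    by (cases "grad \<psi> x = 0") (auto simp: grad_inner[OF smooth_differentiable[OF assms(1)], symmetric])
  then show ?thesis by (auto simp: bounded_support_def)
qed

text \<open>Every derivative falls on the kernel, whose directional derivatives are again smooth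
  with bounded support. The induction therefore runs over all kernels with \<open>f\<close>
  fixed.\<close>

lemma conv_smooth:
  fixes f :: "'a::euclidean_space \<Rightarrow> real"
  assumes f: "integrable lborel f" and k: "smooth k" "bounded_support k"
  shows "smooth (conv k f)"
proof -
  have der: "(conv k f has_derivative (\<lambda>h. conv (\<lambda>x. frechet_derivative k (at x) h) f x)) (at x)"
    if "smooth k" "bounded_support k" for k x
    using conv_has_derivative[OF f smooth_has_grad[OF that(1)] that(2), of x]
    by (simp add: grad_inner[OF smooth_differentiable[OF that(1)]])
  have "C_k m (conv k f)" for m
    using k
  proof (induction m arbitrary: k)
    case 0
    then have "conv k f differentiable_on UNIV"
      using der[OF 0] by (meson differentiable_at_imp_differentiable_on differentiable_def)
    then show ?case by (simp add: differentiable_imp_continuous_on)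
  next
    case (Suc m)
    show ?case
      by (rule C_k_derivI[OF der[OF Suc.prems]])
         (intro Suc.IH smooth_derivative smooth_derivative_bdd_supp Suc.prems)
  qed
  then show ?thesis by (simp add: smooth_def)
qed

text \<open>By translation invariance the difference quotients have integral zero, and they converge
  uniformly with common bounded support.\<close>

lemma integral_grad_zero:
  assumes g: "has_grad \<psi> D" "bounded_support \<psi>"
  shows "(\<integral>x. D x \<bullet> b \<partial>lborel) = 0"
proof (rule ccontr)
  assume ne: "(\<integral>x. D x \<bullet> b \<partial>lborel) \<noteq> 0"
  then have "b \<noteq> 0" by auto
  obtain R where R: "R > 0" "closure {x. \<psi> x \<noteq> 0} \<subseteq> cball 0 R" using bdd_supp_closure[OF g(2)] by metis
  define V where "V = (\<integral>x. indicator (cball (0::'a) (R + 1)) x \<partial>lborel) + (1::real)"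
  have "V > 0" unfolding V_def by (simp add: add_nonneg_pos)
  \<comment> \<open>Chosen so that the estimate below bounds \<open>t\<close> times the absolute
    value of the integral by half of itself.\<close>
  define e where "e = \<bar>\<integral>x. D x \<bullet> b \<partial>lborel\<bar> / (2 * norm b * V)"
  have "e > 0" using ne \<open>b \<noteq> 0\<close> \<open>V > 0\<close> by (simp add: e_def)
  then obtain d where d: "d > 0" "\<And>z h. norm h < d \<Longrightarrow> \<bar>\<psi> (z + h) - \<psi> z - D z \<bullet> h\<bar> \<le> e * norm h"
    using has_grad_uniform[OF g] by metis
  \<comment> \<open>The step \<open>t *\<^sub>R b\<close> is shorter than \<open>d\<close>, so the
    expansion applies, and has length at most 1, so the difference quotient lives in the ball of
    radius \<open>R + 1\<close>.\<close>
  define t where "t = min 1 (d / 2) / norm b"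
  have t: "t > 0" "norm (t *\<^sub>R b) < d" "norm (t *\<^sub>R b) \<le> 1" using d \<open>b \<noteq> 0\<close> by (auto simp: t_def)
  have i\<psi>: "integrable lborel \<psi>" by (intro continuous_bdd_supp_integrable has_gradD(3)[OF g(1)] g)
  have iD: "integrable lborel (\<lambda>x. D x \<bullet> b)"
    by (intro integrable_inner_left continuous_bdd_supp_integrable has_gradD(2)[OF g(1)] has_grad_bdd_supp[OF g])
  have m: "\<psi> \<in> borel_measurable borel" using i\<psi> by simp
  have sh: "integrable lborel (\<lambda>x. \<psi> (x + t *\<^sub>R b))" "(\<integral>x. \<psi> (x + t *\<^sub>R b) \<partial>lborel) = (\<integral>x. \<psi> x \<partial>lborel)"
    using lborel_integral_affine[OF m, of 1 "t *\<^sub>R b"] lborel_integrable_affine_iff[OF m, of 1 "t *\<^sub>R b"] i\<psi>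
    by (auto simp: add.commute)
  have "t * (\<integral>x. D x \<bullet> b \<partial>lborel) = - (\<integral>x. (\<psi> (x + t *\<^sub>R b) - \<psi> x) - t * (D x \<bullet> b) \<partial>lborel)"
    using sh i\<psi> iD by simp
  then have "\<bar>t * (\<integral>x. D x \<bullet> b \<partial>lborel)\<bar> = \<bar>\<integral>x. (\<psi> (x + t *\<^sub>R b) - \<psi> x) - t * (D x \<bullet> b) \<partial>lborel\<bar>"
    by (simp only: abs_minus_cancel)
  also have "\<dots> \<le> (\<integral>x. \<bar>(\<psi> (x + t *\<^sub>R b) - \<psi> x) - t * (D x \<bullet> b)\<bar> \<partial>lborel)"
    by (rule integral_abs_bound)
  also have "\<dots> \<le> (\<integral>x. (e * norm (t *\<^sub>R b)) * indicator (cball (0::'a) (R + 1)) x \<partial>lborel)"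
  proof (rule integral_mono)
    fix x
    show "\<bar>(\<psi> (x + t *\<^sub>R b) - \<psi> x) - t * (D x \<bullet> b)\<bar> \<le> (e * norm (t *\<^sub>R b)) * indicator (cball (0::'a) (R + 1)) x"
    proof (cases "x \<in> cball 0 (R + 1)")
      case True
      then show ?thesis using d(2)[OF t(2), of x] by simp
    next
      case False
      then have "norm x > R + 1" by simp
      moreover have "norm x \<le> norm (x + t *\<^sub>R b) + norm (t *\<^sub>R b)"
        using norm_triangle_sub[of x "x + t *\<^sub>R b"] by simp
      ultimately have "norm (x + t *\<^sub>R b) > R" "norm x > R" using t(3) by linarith+
      then have *: "x \<notin> closure {x. \<psi> x \<noteq> 0}" "x + t *\<^sub>R b \<notin> closure {x. \<psi> x \<noteq> 0}"
        using R(2) by (auto simp: subset_iff)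
      then have "\<psi> x = 0" "\<psi> (x + t *\<^sub>R b) = 0" using closure_subset[of "{x. \<psi> x \<noteq> 0}"] by auto
      then show ?thesis using has_grad_zero_outside[OF g(1) *(1)] False by simp
    qed
  next
    show "integrable lborel (\<lambda>x. \<bar>(\<psi> (x + t *\<^sub>R b) - \<psi> x) - t * (D x \<bullet> b)\<bar>)"
      by (intro integrable_abs Bochner_Integration.integrable_diff integrable_mult_right sh i\<psi> iD)
    show "integrable lborel (\<lambda>x. (e * norm (t *\<^sub>R b)) * indicator (cball (0::'a) (R + 1)) x)"
      by (intro integrable_mult_right integrable_indicator_cball)
  qed
  also have "\<dots> = e * norm (t *\<^sub>R b) * (V - 1)" by (simp add: V_def)
  also have "\<dots> < e * norm (t *\<^sub>R b) * V" using \<open>e > 0\<close> t(1) \<open>b \<noteq> 0\<close> by simp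
  also have "\<dots> = t * (\<bar>\<integral>x. D x \<bullet> b \<partial>lborel\<bar> / 2)"
    using t(1) \<open>b \<noteq> 0\<close> \<open>V > 0\<close> by (simp add: e_def)
  finally show False using t(1) ne by (simp add: abs_mult)
qed

lemma has_grad_mult:
  assumes "has_grad \<psi> D" "has_grad \<eta> E"
  shows "has_grad (\<lambda>x. \<eta> x * \<psi> x) (\<lambda>x. \<eta> x *\<^sub>R D x + \<psi> x *\<^sub>R E x)"
  unfolding has_grad_def
proof (intro conjI allI)
  fix x
  have "((\<lambda>x. \<eta> x * \<psi> x) has_derivative (\<lambda>h. \<eta> x * (D x \<bullet> h) + (E x \<bullet> h) * \<psi> x)) (at x)"
    by (rule has_derivative_mult[OF has_gradD(1)[OF assms(2)] has_gradD(1)[OF assms(1)]])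
  then show "((\<lambda>x. \<eta> x * \<psi> x) has_derivative (\<lambda>h. (\<eta> x *\<^sub>R D x + \<psi> x *\<^sub>R E x) \<bullet> h)) (at x)"
    by (simp add: inner_add_left mult.commute)
  show "continuous_on UNIV (\<lambda>x. \<eta> x *\<^sub>R D x + \<psi> x *\<^sub>R E x)"
    by (intro continuous_intros has_gradD[OF assms(1)] has_gradD[OF assms(2)])
qed

text \<open>This is \<open>integral_grad_zero\<close> for the product. Only \<open>\<psi>\<close>
  carries the support condition, and both functions are merely \<open>C^1\<close>.\<close>

lemma integration_by_parts:
  assumes g: "has_grad \<psi> D" "bounded_support \<psi>" and e: "has_grad \<eta> E"
  shows "(\<integral>x. \<psi> x * (E x \<bullet> b) \<partial>lborel) = - (\<integral>x. (D x \<bullet> b) * \<eta> x \<partial>lborel)"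
proof -
  have supp: "bounded_support (\<lambda>x. \<eta> x * \<psi> x)" "bounded_support (\<lambda>x. \<psi> x * (E x \<bullet> b))"
    using g(2) by (auto simp: bounded_support_def)
  have "bounded_support (\<lambda>x. \<eta> x * (D x \<bullet> b))"
    using has_grad_bdd_supp[OF g] unfolding bounded_support_def by (metis inner_zero_left mult_zero_right)
  then have i: "integrable lborel (\<lambda>x. \<psi> x * (E x \<bullet> b))" "integrable lborel (\<lambda>x. \<eta> x * (D x \<bullet> b))"
    using supp by (auto intro!: continuous_bdd_supp_integrable continuous_intros has_gradD[OF g(1)] has_gradD[OF e])
  have "0 = (\<integral>x. (\<eta> x *\<^sub>R D x + \<psi> x *\<^sub>R E x) \<bullet> b \<partial>lborel)"
    using integral_grad_zero[OF has_grad_mult[OF g(1) e] supp(1)] by simp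
  also have "\<dots> = (\<integral>x. \<eta> x * (D x \<bullet> b) + \<psi> x * (E x \<bullet> b) \<partial>lborel)"
    by (simp add: inner_add_left)
  also have "\<dots> = (\<integral>x. \<eta> x * (D x \<bullet> b) \<partial>lborel) + (\<integral>x. \<psi> x * (E x \<bullet> b) \<partial>lborel)"
    using i by (intro Bochner_Integration.integral_add)
  finally show ?thesis by (simp add: mult.commute)
qed

text \<open>Integration by parts against \<open>k (x - y)\<close> as a function of \<open>y\<close>;
  the minus sign of its gradient cancels the one from integrating by parts.\<close>

lemma conv_grad_swap:
  assumes g: "has_grad \<psi> D" "bounded_support \<psi>" and k: "has_grad k K"
  shows "conv (\<lambda>x. K x \<bullet> b) \<psi> x = conv k (\<lambda>y. D y \<bullet> b) x"
proof -
  have e: "has_grad (\<lambda>y. k (x - y)) (\<lambda>y. - K (x - y))"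
    unfolding has_grad_def
  proof (intro conjI allI)
    fix y
    have "((\<lambda>y. x - y) has_derivative (\<lambda>h. - h)) (at y)" by (auto intro!: derivative_eq_intros)
    from has_derivative_compose[OF this has_gradD(1)[OF k]]
    show "((\<lambda>y. k (x - y)) has_derivative (\<lambda>h. - K (x - y) \<bullet> h)) (at y)" by simp
    show "continuous_on UNIV (\<lambda>y. - K (x - y))"
      by (intro continuous_intros continuous_on_compose2[OF has_gradD(2)[OF k, of UNIV]]) auto
  qed
  show ?thesis
    using integration_by_parts[OF g e, of b] by (simp add: conv_def mult.commute)
qed

lemma conv_nonzero: "conv k f x \<noteq> 0 \<Longrightarrow> \<exists>y. k (x - y) \<noteq> 0 \<and> f y \<noteq> 0"
proof (rule ccontr)
  assume "conv k f x \<noteq> 0" and "\<not> (\<exists>y. k (x - y) \<noteq> 0 \<and> f y \<noteq> 0)"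
  then have "(\<lambda>y. k (x - y) *\<^sub>R f y) = (\<lambda>y. 0)" by auto
  then have "conv k f x = 0" by (simp add: conv_def)
  with \<open>conv k f x \<noteq> 0\<close> show False by simp
qed

subsection \<open>Weak gradients\<close>

text \<open>Representatives extended by zero live on \<open>lborel\<close>, where Fubini is available.\<close>

definition borel_version :: "'a::euclidean_space set \<Rightarrow> ('a \<Rightarrow> 'b::euclidean_space) \<Rightarrow> ('a \<Rightarrow> 'b) \<Rightarrow> bool" where
  "borel_version S f f' \<longleftrightarrow> f' \<in> borel_measurable borel \<and> (\<forall>x. x \<notin> S \<longrightarrow> f' x = 0) \<and>
     (AE x in lborel. x \<in> S \<longrightarrow> f x = f' x)"

lemma borel_versionD:
  assumes "borel_version S f f'"
  shows "f' \<in> borel_measurable borel" "x \<notin> S \<Longrightarrow> f' x = 0" "AE x in lborel. x \<in> S \<longrightarrow> f x = f' x"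
  using assms by (auto simp: borel_version_def)

text \<open>Each coordinate of the extension by zero agrees almost everywhere with a Borel function,
  and the finitely many exceptional sets have a null union.\<close>

lemma borel_version_ex:
  assumes S: "S \<in> sets borel" and f: "f \<in> borel_measurable (lebesgue_on S)"
  obtains f' where "borel_version S f f'"
proof -
  have "(\<lambda>x. if x \<in> S then f x else 0) \<in> borel_measurable (lebesgue_on UNIV)"
    using borel_measurable_if_lebesgue_on[of S UNIV f] S f by simp
  then have m: "(\<lambda>x. if x \<in> S then f x else 0) \<in> borel_measurable lebesgue"
    by (simp only: lebesgue_on_UNIV_eq)
  have "\<forall>b\<in>Basis. \<exists>h\<in>borel_measurable lborel. AE x in lborel. (if x \<in> S then f x else 0) \<bullet> b = h x"
    by (intro ballI completion_ex_borel_measurable_real borel_measurable_inner m) simp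
  then obtain h where h: "\<And>b. b \<in> Basis \<Longrightarrow> h b \<in> borel_measurable lborel"
    "\<And>b. b \<in> Basis \<Longrightarrow> AE x in lborel. (if x \<in> S then f x else 0) \<bullet> b = h b x"
    by metis
  have [measurable]: "\<And>b. b \<in> Basis \<Longrightarrow> h b \<in> borel_measurable borel" using h(1) by simp
  note [measurable] = S
  have "AE x in lborel. \<forall>b\<in>Basis. (if x \<in> S then f x else 0) \<bullet> b = h b x"
    using h(2) by (subst AE_finite_all[OF finite_Basis]) auto
  then have "AE x in lborel. x \<in> S \<longrightarrow> f x = (if x \<in> S then \<Sum>b\<in>Basis. h b x *\<^sub>R b else 0)"
  proof eventually_elim
    case (elim x)
    then have "x \<in> S \<Longrightarrow> (\<Sum>b\<in>Basis. h b x *\<^sub>R b) = (\<Sum>b\<in>Basis. (f x \<bullet> b) *\<^sub>R b)"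
      by (intro sum.cong) auto
    then show ?case by (simp add: euclidean_representation)
  qed
  moreover have "(\<lambda>x. if x \<in> S then \<Sum>b\<in>Basis. h b x *\<^sub>R b else 0) \<in> borel_measurable borel"
    by measurable
  ultimately have "borel_version S f (\<lambda>x. if x \<in> S then \<Sum>b\<in>Basis. h b x *\<^sub>R b else 0)"
    by (simp add: borel_version_def)
  then show thesis by (rule that)
qed

lemma
  fixes f :: "'a::euclidean_space \<Rightarrow> 'b::euclidean_space"
  assumes S: "S \<in> sets borel" and r: "borel_version S f f'"
  shows borel_version_integral: "integral\<^sup>L (lebesgue_on S) f = integral\<^sup>L lborel f'"
    and borel_version_integrable: "integrable (lebesgue_on S) f \<longleftrightarrow> integrable lborel f'"
proof -
  have SL: "S \<inter> space lebesgue \<in> sets lebesgue" using S by simp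
  have m: "f' \<in> borel_measurable lborel" using borel_versionD(1)[OF r] by simp
  then have mL: "f' \<in> borel_measurable lebesgue" by (rule measurable_completion)
  have ae: "AE x in lebesgue. f' x = indicator S x *\<^sub>R f x"
  proof (rule AE_completion)
    show "AE x in lborel. f' x = indicator S x *\<^sub>R f x"
      using borel_versionD(3)[OF r]
    proof eventually_elim
      case (elim x)
      then show ?case using borel_versionD(2)[OF r, of x] by (cases "x \<in> S") auto
    qed
  qed
  have mf: "(\<lambda>x. indicator S x *\<^sub>R f x) \<in> borel_measurable lebesgue"
    using borel_measurable_AE[OF mL ae] .
  have "integral\<^sup>L (lebesgue_on S) f = (\<integral>x. indicator S x *\<^sub>R f x \<partial>lebesgue)"
    by (rule integral_restrict_space[OF SL])
  also have "\<dots> = integral\<^sup>L lebesgue f'"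
    using ae by (intro integral_cong_AE mf mL) (auto simp: eq_commute)
  also have "\<dots> = integral\<^sup>L lborel f'" by (rule integral_completion[OF m])
  finally show "integral\<^sup>L (lebesgue_on S) f = integral\<^sup>L lborel f'" .
  have "integrable (lebesgue_on S) f \<longleftrightarrow> integrable lebesgue (\<lambda>x. indicator S x *\<^sub>R f x)"
    by (rule integrable_restrict_space[OF SL])
  also have "\<dots> \<longleftrightarrow> integrable lebesgue f'"
    using ae by (intro integrable_cong_AE mf mL) (auto simp: eq_commute)
  also have "\<dots> \<longleftrightarrow> integrable lborel f'" by (rule integrable_completion[OF m])
  finally show "integrable (lebesgue_on S) f \<longleftrightarrow> integrable lborel f'" .
qed

lemma borel_version_self: "f \<in> borel_measurable borel \<Longrightarrow> (\<And>x. x \<notin> S \<Longrightarrow> f x = 0) \<Longrightarrow> borel_version S f f"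
  by (simp add: borel_version_def)

lemma borel_version_borel:
  assumes [measurable]: "f \<in> borel_measurable borel" "S \<in> sets borel"
  shows "borel_version S f (\<lambda>x. indicator S x *\<^sub>R f x)"
  unfolding borel_version_def by (auto simp: indicator_def)

section \<open>Test functions, scaled bumps and the fundamental lemma\<close>

lemma test_functions_iff:
  "\<phi> \<in> test_functions \<Omega> \<longleftrightarrow> smooth \<phi> \<and> compact (closure {x. \<phi> x \<noteq> 0}) \<and> closure {x. \<phi> x \<noteq> 0} \<subseteq> \<Omega>"
  by (simp add: test_functions_def smooth_def)

lemma compact_closure_bdd_supp: "compact (closure {x. \<phi> x \<noteq> 0}) \<Longrightarrow> bounded_support \<phi>"
proof -
  assume "compact (closure {x. \<phi> x \<noteq> 0})"
  then have "bounded {x. \<phi> x \<noteq> 0}" using bounded_subset[OF compact_imp_bounded closure_subset] by blast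
  then show ?thesis by (auto simp: bounded_support_def bounded_iff)
qed

lemma support_subset_compact:
  fixes \<phi> :: "'a::t2_space \<Rightarrow> 'b::zero"
  assumes "compact K" "\<And>x. \<phi> x \<noteq> 0 \<Longrightarrow> x \<in> K"
  shows "compact (closure {x. \<phi> x \<noteq> 0})" "closure {x. \<phi> x \<noteq> 0} \<subseteq> K"
proof -
  show sub: "closure {x. \<phi> x \<noteq> 0} \<subseteq> K"
    by (rule closure_minimal) (use assms compact_imp_closed in auto)
  have "closed (closure {x. \<phi> x \<noteq> 0})" by simp
  then have "compact (K \<inter> closure {x. \<phi> x \<noteq> 0})" by (rule compact_Int_closed[OF assms(1)])
  then show "compact (closure {x. \<phi> x \<noteq> 0})" using sub by (simp add: Int_absorb1)
qed

lemma test_functionI: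
  assumes "smooth \<phi>" "compact K" "K \<subseteq> \<Omega>" "\<And>x. \<phi> x \<noteq> 0 \<Longrightarrow> x \<in> K"
  shows "\<phi> \<in> test_functions \<Omega>"
  using support_subset_compact[of K \<phi>] assms unfolding test_functions_iff by blast

lemma test_functionD:
  assumes "\<phi> \<in> test_functions \<Omega>"
  shows "smooth \<phi>" "bounded_support \<phi>" "has_grad \<phi> (grad \<phi>)" "x \<notin> \<Omega> \<Longrightarrow> \<phi> x = 0" "x \<notin> \<Omega> \<Longrightarrow> grad \<phi> x = 0"
    "integrable lborel \<phi>" "integrable lborel (grad \<phi>)"
    "frechet_derivative \<phi> (at x) h = grad \<phi> x \<bullet> h"
proof -
  show 1: "smooth \<phi>" and 2: "bounded_support \<phi>"
    using assms compact_closure_bdd_supp[of \<phi>] unfolding test_functions_iff by blast+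
  show 3: "has_grad \<phi> (grad \<phi>)" by (rule smooth_has_grad[OF 1])
  have cl: "closure {x. \<phi> x \<noteq> 0} \<subseteq> \<Omega>" using assms unfolding test_functions_iff by auto
  then show "\<phi> x = 0" if "x \<notin> \<Omega>" for x
    using that closure_subset[of "{x. \<phi> x \<noteq> 0}"] by auto
  show "grad \<phi> x = 0" if "x \<notin> \<Omega>" for x
    using has_grad_zero_outside[OF 3, of x] that cl by auto
  show "integrable lborel \<phi>" "integrable lborel (grad \<phi>)"
    using has_gradD[OF 3] has_grad_bdd_supp[OF 3 2] 2 by (auto intro: continuous_bdd_supp_integrable)
  show "frechet_derivative \<phi> (at x) h = grad \<phi> x \<bullet> h"
    by (simp add: grad_inner smooth_differentiable[OF 1])
qed

definition is_bump :: "('a::euclidean_space \<Rightarrow> real) \<Rightarrow> bool" where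
  "is_bump \<rho> \<longleftrightarrow> smooth \<rho> \<and> (\<forall>x. 0 \<le> \<rho> x) \<and> (\<forall>x. \<rho> x \<noteq> 0 \<longrightarrow> norm x < 1) \<and> (\<integral>x. \<rho> x \<partial>lborel) = 1"

lemma is_bump_ex: "\<exists>\<rho>::'a::euclidean_space \<Rightarrow> real. is_bump \<rho>"
  unfolding is_bump_def by (rule ex_bump) blast

text \<open>The shift \<open>v\<close> is measured in rescaled coordinates, so the support is the
  ball of radius \<open>\<delta>\<close> around \<open>\<delta> *\<^sub>R v\<close>: translation and
  smoothing happen at the same scale, with one \<open>v\<close> for all
  \<open>\<delta>\<close>.\<close>

definition scaled_bump :: "('a::euclidean_space \<Rightarrow> real) \<Rightarrow> real \<Rightarrow> 'a \<Rightarrow> 'a \<Rightarrow> real" where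
  "scaled_bump \<rho> \<delta> v x = inverse (\<delta> ^ DIM('a)) * \<rho> (inverse \<delta> *\<^sub>R x + - v)"

lemma scaled_bump_smooth: "smooth \<rho> \<Longrightarrow> smooth (scaled_bump \<rho> \<delta> v)"
  unfolding scaled_bump_def[abs_def] smooth_def by (intro allI C_k_cmult C_k_affine) auto

lemma scaled_bump_support:
  assumes "is_bump \<rho>" "\<delta> > 0" "scaled_bump \<rho> \<delta> v x \<noteq> 0"
  shows "norm (x - \<delta> *\<^sub>R v) < \<delta>"
proof -
  have "norm (inverse \<delta> *\<^sub>R x + - v) < 1" using assms by (auto simp: scaled_bump_def is_bump_def)
  moreover have "x - \<delta> *\<^sub>R v = \<delta> *\<^sub>R (inverse \<delta> *\<^sub>R x + - v)" using assms by (simp add: scaleR_diff_right)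
  ultimately show ?thesis using assms by simp
qed

lemma scaled_bump_mollifier:
  assumes b: "is_bump \<rho>" and "\<delta> > 0"
  shows "mollifier (\<delta> * (norm v + 1)) (scaled_bump \<rho> \<delta> v)"
  unfolding mollifier_def
proof (intro conjI allI impI)
  have s: "smooth \<rho>" using b by (simp add: is_bump_def)
  show "continuous_on UNIV (scaled_bump \<rho> \<delta> v)" by (intro smooth_continuous scaled_bump_smooth s)
  show "0 \<le> scaled_bump \<rho> \<delta> v x" for x using b \<open>\<delta> > 0\<close> by (simp add: scaled_bump_def is_bump_def)
  have [measurable]: "\<rho> \<in> borel_measurable borel"
    by (rule borel_measurable_continuous_onI[OF smooth_continuous[OF s]])
  show "(\<integral>x. scaled_bump \<rho> \<delta> v x \<partial>lborel) = 1"
    using lborel_integral_affine[of \<rho> "inverse \<delta>" "- v"] b \<open>\<delta> > 0\<close>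
    by (simp add: scaled_bump_def is_bump_def add.commute power_inverse)
  show "norm x \<le> \<delta> * (norm v + 1)" if "scaled_bump \<rho> \<delta> v x \<noteq> 0" for x
  proof -
    have "norm x \<le> norm (\<delta> *\<^sub>R v) + norm (x - \<delta> *\<^sub>R v)" by (rule norm_triangle_sub)
    then show ?thesis using scaled_bump_support[OF b \<open>\<delta> > 0\<close> that] \<open>\<delta> > 0\<close> by (simp add: algebra_simps)
  qed
qed

text \<open>For \<open>x\<close> in a compact \<open>K\<close> and small \<open>\<delta>\<close>,
  the bump reflected and moved to \<open>x\<close> is a test function, so the mollification of
  \<open>f\<close> vanishes on \<open>K\<close>. Since it converges to \<open>f\<close> in
  \<open>L^1\<close>, so does \<open>f\<close>; compact sets exhaust
  \<open>\<Omega>\<close>.\<close>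

lemma fundamental_lemma:
  fixes f :: "'a::euclidean_space \<Rightarrow> real"
  assumes \<Omega>: "open \<Omega>" and f: "locally_integrable \<Omega> f"
    and zero: "\<And>\<phi>. \<phi> \<in> test_functions \<Omega> \<Longrightarrow> (\<integral>x. f x * \<phi> x \<partial>lebesgue_on \<Omega>) = 0"
  shows "AE x in lborel. x \<in> \<Omega> \<longrightarrow> f x = 0"
proof -
  obtain \<rho> :: "'a \<Rightarrow> real" where \<rho>: "is_bump \<rho>" using is_bump_ex by blast
  then have \<rho>s: "smooth \<rho>" by (simp add: is_bump_def)
  have local: "AE x in lborel. x \<in> K \<longrightarrow> f x = 0" if K: "compact K" "K \<subseteq> \<Omega>" for K
  proof -
    obtain e where e: "e > 0" "(\<Union>x\<in>K. cball x e) \<subseteq> \<Omega>"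
      using compact_subset_open_imp_cball_epsilon_subset[OF K(1) \<Omega> K(2)] by metis
    \<comment> \<open>For \<open>x\<close> in \<open>K\<close> the convolution sees \<open>f\<close>
      only on this larger compact set, where \<open>f\<close> is integrable and can be extended by
      zero.\<close>
    define K' where "K' = {x + y | x y. x \<in> K \<and> y \<in> cball 0 e}"
    have K': "compact K'" unfolding K'_def by (intro compact_sums K compact_cball)
    have K'\<Omega>: "K' \<subseteq> \<Omega>" using e(2) by (force simp: K'_def dist_norm)
    have KK': "K \<subseteq> K'" using e(1) by (force simp: K'_def)
    have [measurable]: "K \<in> sets borel" "K' \<in> sets borel" "\<Omega> \<in> sets borel"
      using K K' \<Omega> by (auto intro: borel_compact)
    have fK': "integrable (lebesgue_on K') f" using f K' K'\<Omega> by (simp add: locally_integrable_def)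
    obtain f' where r: "borel_version K' f f'" using borel_version_ex[of K' f] fK' by auto
    have f'i: "integrable lborel f'" using borel_version_integrable[OF _ r] fK' by simp
    have conv0: "conv (scaled_bump \<rho> \<delta> 0) f' x = 0" if "x \<in> K" "0 < \<delta>" "\<delta> \<le> e" for x \<delta>
    proof -
      define \<phi> where "\<phi> y = scaled_bump \<rho> \<delta> 0 (x - y)" for y
      have inK': "y \<in> K'" if "\<phi> y \<noteq> 0" for y
      proof -
        have "norm (x - y) < \<delta>" using scaled_bump_support[OF \<rho> \<open>0 < \<delta>\<close>] that by (fastforce simp: \<phi>_def)
        then have "y = x + (y - x)" "y - x \<in> cball 0 e" using \<open>\<delta> \<le> e\<close> by (auto simp: norm_minus_commute)
        then show ?thesis using \<open>x \<in> K\<close> unfolding K'_def by blast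
      qed
      have "smooth \<phi>"
        using smooth_affine[OF scaled_bump_smooth[OF \<rho>s], of \<delta> 0 "-1" x] by (simp add: \<phi>_def[abs_def])
      then have "\<phi> \<in> test_functions \<Omega>" by (rule test_functionI[OF _ K' K'\<Omega> inK'])
      have [measurable]: "\<phi> \<in> borel_measurable borel" "f' \<in> borel_measurable borel"
        using smooth_continuous[OF \<open>smooth \<phi>\<close>] f'i by (auto intro: borel_measurable_continuous_onI)
      have "borel_version \<Omega> (\<lambda>y. f y * \<phi> y) (\<lambda>y. f' y * \<phi> y)"
        unfolding borel_version_def
      proof (intro conjI allI impI)
        show "AE y in lborel. y \<in> \<Omega> \<longrightarrow> f y * \<phi> y = f' y * \<phi> y"
          using borel_versionD(3)[OF r]
        proof eventually_elim
          case (elim y)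
          then show ?case using inK'[of y] by (cases "\<phi> y = 0") auto
        qed
      qed (use borel_versionD(2)[OF r] K'\<Omega> in auto)
      from borel_version_integral[OF _ this] have "(\<integral>y. f' y * \<phi> y \<partial>lborel) = 0"
        using zero[OF \<open>\<phi> \<in> test_functions \<Omega>\<close>] by simp
      then show ?thesis by (simp add: conv_def \<phi>_def mult.commute)
    qed
    have small: "(\<integral>x. indicator K x * \<bar>f' x\<bar> \<partial>lborel) \<le> \<epsilon>" if "\<epsilon> > 0" for \<epsilon>
    proof -
      obtain d where d: "d > 0" "\<And>k. mollifier d k \<Longrightarrow> (\<integral>x. norm (conv k f' x - f' x) \<partial>lborel) < \<epsilon>"
        using mollify_L1[OF f'i \<open>\<epsilon> > 0\<close>] by blast
      define \<delta> where "\<delta> = min d e"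
      have \<delta>: "0 < \<delta>" "\<delta> \<le> e" "\<delta> \<le> d" using d e by (auto simp: \<delta>_def)
      have mo: "mollifier \<delta> (scaled_bump \<rho> \<delta> 0)" using scaled_bump_mollifier[OF \<rho> \<delta>(1), of 0] by simp
      have "(\<integral>x. indicator K x * \<bar>f' x\<bar> \<partial>lborel) \<le> (\<integral>x. norm (conv (scaled_bump \<rho> \<delta> 0) f' x - f' x) \<partial>lborel)"
      proof (rule integral_mono)
        have "integrable lborel (\<lambda>x. indicator K x *\<^sub>R \<bar>f' x\<bar>)"
          using f'i by (intro integrable_mult_indicator) auto
        then show "integrable lborel (\<lambda>x. indicator K x * \<bar>f' x\<bar>)" by simp
        show "integrable lborel (\<lambda>x. norm (conv (scaled_bump \<rho> \<delta> 0) f' x - f' x))"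
          using conv_mollifier_integrable[OF mo f'i] f'i by auto
        show "indicator K x * \<bar>f' x\<bar> \<le> norm (conv (scaled_bump \<rho> \<delta> 0) f' x - f' x)" for x
          using conv0[of x \<delta>] \<delta> by (auto simp: indicator_def)
      qed
      also have "\<dots> < \<epsilon>" by (intro d mollifier_mono[OF mo] \<delta>)
      finally show ?thesis by simp
    qed
    have i: "integrable lborel (\<lambda>x. indicator K x * \<bar>f' x\<bar>)"
      using integrable_mult_indicator[of K lborel "\<lambda>x. \<bar>f' x\<bar>"] f'i by simp
    have "(\<integral>x. indicator K x * \<bar>f' x\<bar> \<partial>lborel) = 0"
      using field_le_epsilon[of "(\<integral>x. indicator K x * \<bar>f' x\<bar> \<partial>lborel)" 0] small
      by (intro antisym integral_nonneg_AE) auto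
    then have "AE x in lborel. indicator K x * \<bar>f' x\<bar> = 0"
      using integral_nonneg_eq_0_iff_AE[OF i] by auto
    then show ?thesis using borel_versionD(3)[OF r]
      by eventually_elim (use KK' in \<open>auto simp: indicator_def\<close>)
  qed
  obtain C where C: "\<And>n::nat. compact (C n)" "\<And>n. C n \<subseteq> \<Omega>" "\<Union> (range C) = \<Omega>"
    using open_Union_compact_subsets[OF \<Omega>] by metis
  have "AE x in lborel. \<forall>n. x \<in> C n \<longrightarrow> f x = 0"
    unfolding AE_all_countable using local C by blast
  then show ?thesis
    by eventually_elim (use C(3) in blast)
qed

section \<open>Calculus of weak gradients\<close>

lemma has_weak_gradientD:
  assumes "has_weak_gradient \<Omega> u G" "\<phi> \<in> test_functions \<Omega>" "b \<in> Basis"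
  shows "(\<integral>x. u x * (grad \<phi> x \<bullet> b) \<partial>lebesgue_on \<Omega>) = - (\<integral>x. (G x \<bullet> b) * \<phi> x \<partial>lebesgue_on \<Omega>)"
  using assms unfolding has_weak_gradient_def test_functionD(8)[OF assms(2), symmetric] by blast

lemma has_weak_gradientI:
  assumes "locally_integrable \<Omega> u" "locally_integrable \<Omega> G"
    "\<And>\<phi> b. \<phi> \<in> test_functions \<Omega> \<Longrightarrow> b \<in> Basis \<Longrightarrow>
      (\<integral>x. u x * (grad \<phi> x \<bullet> b) \<partial>lebesgue_on \<Omega>) = - (\<integral>x. (G x \<bullet> b) * \<phi> x \<partial>lebesgue_on \<Omega>)"
  shows "has_weak_gradient \<Omega> u G"
  unfolding has_weak_gradient_def
  by (intro conjI ballI assms(1,2)) (simp only: test_functionD(8) assms(3))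

lemma locally_integrable_mult:
  fixes f :: "'a::euclidean_space \<Rightarrow> real"
  assumes f: "locally_integrable \<Omega> f" and \<Omega>: "open \<Omega>"
    and \<phi>: "continuous_on UNIV \<phi>" and K: "compact K" "K \<subseteq> \<Omega>" "\<And>x. \<phi> x \<noteq> 0 \<Longrightarrow> x \<in> K"
  shows "integrable (lebesgue_on \<Omega>) (\<lambda>x. f x * \<phi> x)"
proof -
  have [measurable]: "K \<in> sets borel" "\<Omega> \<in> sets borel"
    using K \<Omega> by (auto intro: borel_compact)
  have fK: "integrable (lebesgue_on K) f" using f K by (simp add: locally_integrable_def)
  obtain f' where r: "borel_version K f f'" using borel_version_ex[of K f] fK by auto
  have f'i: "integrable lborel f'" using borel_version_integrable[OF _ r] fK by simp
  have [measurable]: "\<phi> \<in> borel_measurable borel" "f' \<in> borel_measurable borel"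
    using \<phi> f'i by (auto intro: borel_measurable_continuous_onI)
  have "borel_version \<Omega> (\<lambda>y. f y * \<phi> y) (\<lambda>y. f' y * \<phi> y)"
    unfolding borel_version_def
  proof (intro conjI allI impI)
    show "AE y in lborel. y \<in> \<Omega> \<longrightarrow> f y * \<phi> y = f' y * \<phi> y"
      using borel_versionD(3)[OF r]
    proof eventually_elim
      case (elim y)
      then show ?case using K(3)[of y] by (cases "\<phi> y = 0") auto
    qed
  qed (use borel_versionD(2)[OF r] K in auto)
  moreover have "integrable lborel (\<lambda>y. f' y * \<phi> y)"
  proof -
    have "bounded_support \<phi>"
      by (rule compact_closure_bdd_supp[OF support_subset_compact(1)[OF K(1,3)]])
    then obtain B where B: "B > 0" "\<And>x. norm (\<phi> x) \<le> B"
      using continuous_bdd_supp_bounded[OF \<phi>] by metis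
    have "integrable lborel (\<lambda>y. f' y * B)" using f'i by simp
    then show ?thesis
      by (rule Bochner_Integration.integrable_bound) (use B in \<open>auto simp: abs_mult intro!: mult_left_mono\<close>)
  qed
  ultimately show ?thesis using borel_version_integrable[of \<Omega>] by auto
qed

lemma test_mult_integrable:
  fixes f :: "'a::euclidean_space \<Rightarrow> real"
  assumes f: "locally_integrable \<Omega> f" and \<Omega>: "open \<Omega>" and \<phi>: "\<phi> \<in> test_functions \<Omega>"
  shows "integrable (lebesgue_on \<Omega>) (\<lambda>x. f x * \<phi> x)" "integrable (lebesgue_on \<Omega>) (\<lambda>x. f x * (grad \<phi> x \<bullet> b))"
proof -
  have K: "compact (closure {x. \<phi> x \<noteq> 0})" "closure {x. \<phi> x \<noteq> 0} \<subseteq> \<Omega>"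
    using \<phi> unfolding test_functions_iff by auto
  note g = test_functionD(3)[OF \<phi>]
  show "integrable (lebesgue_on \<Omega>) (\<lambda>x. f x * \<phi> x)"
    using closure_subset[of "{x. \<phi> x \<noteq> 0}"]
    by (intro locally_integrable_mult[OF f \<Omega> has_gradD(3)[OF g] K]) auto
  show "integrable (lebesgue_on \<Omega>) (\<lambda>x. f x * (grad \<phi> x \<bullet> b))"
  proof (rule locally_integrable_mult[OF f \<Omega> _ K])
    show "continuous_on UNIV (\<lambda>x. grad \<phi> x \<bullet> b)" by (intro continuous_intros has_gradD(2)[OF g])
    show "x \<in> closure {x. \<phi> x \<noteq> 0}" if "grad \<phi> x \<bullet> b \<noteq> 0" for x
      using has_grad_zero_outside[OF g, of x] that by fastforce
  qed
qed

lemma locally_integrable_inner: "locally_integrable \<Omega> G \<Longrightarrow> locally_integrable \<Omega> (\<lambda>x. G x \<bullet> b)"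
  by (auto simp: locally_integrable_def)

lemma weak_gradient_unique:
  assumes \<Omega>: "open \<Omega>" and G: "has_weak_gradient \<Omega> u G" "has_weak_gradient \<Omega> u H"
  shows "AE x in lborel. x \<in> \<Omega> \<longrightarrow> G x = H x"
proof -
  have l: "locally_integrable \<Omega> G" "locally_integrable \<Omega> H" using G by (auto simp: has_weak_gradient_def)
  have "AE x in lborel. x \<in> \<Omega> \<longrightarrow> (G x \<bullet> b) - (H x \<bullet> b) = 0" if b: "b \<in> Basis" for b
  proof (rule fundamental_lemma[OF \<Omega>])
    show "locally_integrable \<Omega> (\<lambda>x. (G x \<bullet> b) - (H x \<bullet> b))"
      using l by (auto simp: locally_integrable_def)
    fix \<phi> assume \<phi>: "\<phi> \<in> test_functions \<Omega>"
    have "(\<integral>x. ((G x \<bullet> b) - (H x \<bullet> b)) * \<phi> x \<partial>lebesgue_on \<Omega>) =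
        (\<integral>x. (G x \<bullet> b) * \<phi> x \<partial>lebesgue_on \<Omega>) - (\<integral>x. (H x \<bullet> b) * \<phi> x \<partial>lebesgue_on \<Omega>)"
      unfolding left_diff_distrib
      by (intro Bochner_Integration.integral_diff test_mult_integrable(1)[OF locally_integrable_inner \<Omega> \<phi>] l)
    then show "(\<integral>x. ((G x \<bullet> b) - (H x \<bullet> b)) * \<phi> x \<partial>lebesgue_on \<Omega>) = 0"
      using has_weak_gradientD[OF G(1) \<phi> b] has_weak_gradientD[OF G(2) \<phi> b] by simp
  qed
  then have "AE x in lborel. \<forall>b\<in>Basis. x \<in> \<Omega> \<longrightarrow> (G x \<bullet> b) - (H x \<bullet> b) = 0"
    by (subst AE_finite_all[OF finite_Basis]) auto
  then show ?thesis
  proof (eventually_elim, intro impI)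
    fix x assume *: "\<forall>b\<in>Basis. x \<in> \<Omega> \<longrightarrow> G x \<bullet> b - H x \<bullet> b = 0" "x \<in> \<Omega>"
    show "G x = H x" by (rule euclidean_eqI) (use * in simp)
  qed
qed

text \<open>As soon as one weak gradient exists, the chosen one is a weak gradient too, and
  uniqueness identifies the two.\<close>

lemma weak_gradient_AE:
  assumes "open \<Omega>" "has_weak_gradient \<Omega> u G"
  shows "AE x in lborel. x \<in> \<Omega> \<longrightarrow> weak_gradient \<Omega> u x = G x"
  unfolding weak_gradient_def
  by (rule weak_gradient_unique[OF assms(1) someI[of "has_weak_gradient \<Omega> u", OF assms(2)] assms(2)])

text \<open>The factor \<open>c\<close> covers sums (\<open>c = 1\<close>) and differences
  (\<open>c = -1\<close>) at once.\<close>

lemma has_weak_gradient_add: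
  assumes \<Omega>: "open \<Omega>" and G: "has_weak_gradient \<Omega> u G" "has_weak_gradient \<Omega> v H"
  shows "has_weak_gradient \<Omega> (\<lambda>x. u x + c * v x) (\<lambda>x. G x + c *\<^sub>R H x)"
proof (rule has_weak_gradientI)
  have l: "locally_integrable \<Omega> G" "locally_integrable \<Omega> H" "locally_integrable \<Omega> u" "locally_integrable \<Omega> v"
    using G by (auto simp: has_weak_gradient_def)
  then show "locally_integrable \<Omega> (\<lambda>x. u x + c * v x)" "locally_integrable \<Omega> (\<lambda>x. G x + c *\<^sub>R H x)"
    by (auto simp: locally_integrable_def)
  fix \<phi> and b :: 'a assume \<phi>: "\<phi> \<in> test_functions \<Omega>" and b: "b \<in> Basis"
  note t = test_mult_integrable[OF _ \<Omega> \<phi>]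
  have "(\<integral>x. (u x + c * v x) * (grad \<phi> x \<bullet> b) \<partial>lebesgue_on \<Omega>) =
      (\<integral>x. u x * (grad \<phi> x \<bullet> b) + c * (v x * (grad \<phi> x \<bullet> b)) \<partial>lebesgue_on \<Omega>)"
    by (simp add: algebra_simps)
  also have "\<dots> = (\<integral>x. u x * (grad \<phi> x \<bullet> b) \<partial>lebesgue_on \<Omega>) + c * (\<integral>x. v x * (grad \<phi> x \<bullet> b) \<partial>lebesgue_on \<Omega>)"
    using t(2)[OF l(3), of b] t(2)[OF l(4), of b] by simp
  also have "\<dots> = - ((\<integral>x. (G x \<bullet> b) * \<phi> x \<partial>lebesgue_on \<Omega>) + c * (\<integral>x. (H x \<bullet> b) * \<phi> x \<partial>lebesgue_on \<Omega>))"
    using has_weak_gradientD[OF G(1) \<phi> b] has_weak_gradientD[OF G(2) \<phi> b] by simp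
  also have "\<dots> = - (\<integral>x. (G x \<bullet> b) * \<phi> x + c * ((H x \<bullet> b) * \<phi> x) \<partial>lebesgue_on \<Omega>)"
    using t(1)[OF locally_integrable_inner[OF l(1)], of b] t(1)[OF locally_integrable_inner[OF l(2)], of b] by simp
  also have "\<dots> = - (\<integral>x. ((G x + c *\<^sub>R H x) \<bullet> b) * \<phi> x \<partial>lebesgue_on \<Omega>)"
    by (simp add: inner_add_left algebra_simps)
  finally show "(\<integral>x. (u x + c * v x) * (grad \<phi> x \<bullet> b) \<partial>lebesgue_on \<Omega>) =
    - (\<integral>x. ((G x + c *\<^sub>R H x) \<bullet> b) * \<phi> x \<partial>lebesgue_on \<Omega>)" .
qed

lemma integrable_lebesgue_on:
  fixes f :: "'a::euclidean_space \<Rightarrow> 'b::euclidean_space"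
  assumes f: "integrable lborel f" and S: "S \<in> sets borel"
  shows "integrable (lebesgue_on S) f"
proof -
  have "integrable lborel (\<lambda>x. indicator S x *\<^sub>R f x)"
    using S f by (intro integrable_mult_indicator) auto
  moreover have "borel_version S f (\<lambda>x. indicator S x *\<^sub>R f x)"
    by (rule borel_version_borel[OF _ S]) (use f in simp)
  ultimately show ?thesis using borel_version_integrable[OF S] by blast
qed

lemma test_has_weak_gradient:
  assumes \<Omega>: "open \<Omega>" and \<phi>: "\<phi> \<in> test_functions \<Omega>"
  shows "has_weak_gradient \<Omega> \<phi> (grad \<phi>)"
proof (rule has_weak_gradientI)
  note D = test_functionD[OF \<phi>]
  have [measurable]: "\<Omega> \<in> sets borel" using \<Omega> by simp
  show "locally_integrable \<Omega> \<phi>" "locally_integrable \<Omega> (grad \<phi>)"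
    using D(6,7) by (auto simp: locally_integrable_def borel_compact intro!: integrable_lebesgue_on)
  fix \<eta> and b :: 'a assume \<eta>: "\<eta> \<in> test_functions \<Omega>"
  note D' = test_functionD[OF \<eta>]
  note [measurable] = has_gradD(4,5)[OF D(3)] has_gradD(4,5)[OF D'(3)]
  have 1: "borel_version \<Omega> (\<lambda>x. \<phi> x * (grad \<eta> x \<bullet> b)) (\<lambda>x. \<phi> x * (grad \<eta> x \<bullet> b))"
    by (rule borel_version_self) (use D(4) in auto)
  have 2: "borel_version \<Omega> (\<lambda>x. (grad \<phi> x \<bullet> b) * \<eta> x) (\<lambda>x. (grad \<phi> x \<bullet> b) * \<eta> x)"
    by (rule borel_version_self) (use D'(4) in auto)
  show "(\<integral>x. \<phi> x * (grad \<eta> x \<bullet> b) \<partial>lebesgue_on \<Omega>) = - (\<integral>x. (grad \<phi> x \<bullet> b) * \<eta> x \<partial>lebesgue_on \<Omega>)"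
    using integration_by_parts[OF D(3,2) D'(3), of b] borel_version_integral[OF _ 1] borel_version_integral[OF _ 2] by simp
qed

definition C1c :: "'a::euclidean_space set \<Rightarrow> ('a \<Rightarrow> real) \<Rightarrow> ('a \<Rightarrow> 'a) \<Rightarrow> bool" where
  "C1c \<Omega> \<psi> D \<longleftrightarrow> has_grad \<psi> D \<and> compact (closure {x. \<psi> x \<noteq> 0}) \<and> closure {x. \<psi> x \<noteq> 0} \<subseteq> \<Omega>"

text \<open>A replacement for \<open>W11_0\<close> on the whole space, with the gradient as explicit second argument. Since only \<open>C\<^sup>1\<close>
  approximants are required, it is closed under composition with \<open>C\<^sup>1\<close> truncations and multiplication by cut-offs.\<close>

definition sobolev_zero :: "'a::euclidean_space set \<Rightarrow> ('a \<Rightarrow> real) \<Rightarrow> ('a \<Rightarrow> 'a) \<Rightarrow> bool" where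
  "sobolev_zero \<Omega> \<phi> g \<longleftrightarrow> integrable lborel \<phi> \<and> integrable lborel g \<and>
     (\<forall>\<epsilon>>0. \<exists>\<psi> D. C1c \<Omega> \<psi> D \<and> (\<integral>x. \<bar>\<phi> x - \<psi> x\<bar> \<partial>lborel) < \<epsilon> \<and> (\<integral>x. norm (g x - D x) \<partial>lborel) < \<epsilon>)"

text \<open>The difference \<open>\<phi> - \<psi>\<close> has weak gradient
  \<open>G - grad \<psi>\<close>, which is almost everywhere what \<open>W11_norm\<close>
  integrates. Extension by zero leaves both integrals unchanged because \<open>\<psi>\<close> and
  \<open>grad \<psi>\<close> vanish off \<open>\<Omega>\<close>.\<close>

lemma W11_0_sobolev_zero:
  assumes \<Omega>: "open \<Omega>" and \<phi>: "\<phi> \<in> W11_0 \<Omega>"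
  obtains \<phi>' g G where "has_weak_gradient \<Omega> \<phi> G" "borel_version \<Omega> \<phi> \<phi>'" "borel_version \<Omega> G g" "sobolev_zero \<Omega> \<phi>' g"
proof -
  have [measurable]: "\<Omega> \<in> sets borel" using \<Omega> by simp
  obtain G where G: "has_weak_gradient \<Omega> \<phi> G" "integrable (lebesgue_on \<Omega>) G" "integrable (lebesgue_on \<Omega>) \<phi>"
    using \<phi> by (auto simp: W11_0_def W11_def)
  obtain \<phi>' where r\<phi>: "borel_version \<Omega> \<phi> \<phi>'" using borel_version_ex[of \<Omega> \<phi>] G by auto
  obtain g where rg: "borel_version \<Omega> G g" using borel_version_ex[of \<Omega> G] G by auto
  have i: "integrable lborel \<phi>'" "integrable lborel g"
    using borel_version_integrable[OF _ r\<phi>] borel_version_integrable[OF _ rg] G by auto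
  have "\<exists>\<psi> D. C1c \<Omega> \<psi> D \<and> (\<integral>x. \<bar>\<phi>' x - \<psi> x\<bar> \<partial>lborel) < \<epsilon> \<and> (\<integral>x. norm (g x - D x) \<partial>lborel) < \<epsilon>" if "\<epsilon> > 0" for \<epsilon>
  proof -
    obtain \<psi> where \<psi>: "\<psi> \<in> test_functions \<Omega>" "W11_norm \<Omega> (\<lambda>x. \<phi> x - \<psi> x) < \<epsilon>"
      using \<phi> \<open>\<epsilon> > 0\<close> by (auto simp: W11_0_def)
    note D = test_functionD[OF \<psi>(1)]
    note [measurable] = has_gradD(4,5)[OF D(3)] borel_versionD(1)[OF r\<phi>] borel_versionD(1)[OF rg]
    have "has_weak_gradient \<Omega> (\<lambda>x. \<phi> x + (-1) * \<psi> x) (\<lambda>x. G x + (-1) *\<^sub>R grad \<psi> x)"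
      by (rule has_weak_gradient_add[OF \<Omega> G(1) test_has_weak_gradient[OF \<Omega> \<psi>(1)]])
    then have "has_weak_gradient \<Omega> (\<lambda>x. \<phi> x - \<psi> x) (\<lambda>x. G x - grad \<psi> x)" by simp
    from weak_gradient_AE[OF \<Omega> this] borel_versionD(3)[OF rg]
    have "AE x in lborel. x \<in> \<Omega> \<longrightarrow> norm (weak_gradient \<Omega> (\<lambda>x. \<phi> x - \<psi> x) x) = norm (g x - grad \<psi> x)"
      by eventually_elim auto
    then have 1: "borel_version \<Omega> (\<lambda>x. norm (weak_gradient \<Omega> (\<lambda>x. \<phi> x - \<psi> x) x)) (\<lambda>x. norm (g x - grad \<psi> x))"
      using D(5) borel_versionD(2)[OF rg] by (auto simp: borel_version_def)
    have "AE x in lborel. x \<in> \<Omega> \<longrightarrow> \<bar>\<phi> x - \<psi> x\<bar> = \<bar>\<phi>' x - \<psi> x\<bar>"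
      using borel_versionD(3)[OF r\<phi>] by eventually_elim auto
    then have 2: "borel_version \<Omega> (\<lambda>x. \<bar>\<phi> x - \<psi> x\<bar>) (\<lambda>x. \<bar>\<phi>' x - \<psi> x\<bar>)"
      using D(4) borel_versionD(2)[OF r\<phi>] by (auto simp: borel_version_def)
    have "(\<integral>x. \<bar>\<phi>' x - \<psi> x\<bar> \<partial>lborel) + (\<integral>x. norm (g x - grad \<psi> x) \<partial>lborel) < \<epsilon>"
      using \<psi>(2) borel_version_integral[OF _ 1] borel_version_integral[OF _ 2] by (simp add: W11_norm_def)
    moreover have "(\<integral>x. \<bar>\<phi>' x - \<psi> x\<bar> \<partial>lborel) \<ge> 0" "(\<integral>x. norm (g x - grad \<psi> x) \<partial>lborel) \<ge> 0"
      by (auto intro: integral_nonneg_AE)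
    ultimately have "(\<integral>x. \<bar>\<phi>' x - \<psi> x\<bar> \<partial>lborel) < \<epsilon>" "(\<integral>x. norm (g x - grad \<psi> x) \<partial>lborel) < \<epsilon>"
      by linarith+
    moreover have "C1c \<Omega> \<psi> (grad \<psi>)"
      using \<psi>(1) D(3) by (simp add: C1c_def test_functions_iff)
    ultimately show ?thesis by blast
  qed
  then have "sobolev_zero \<Omega> \<phi>' g" using i by (simp add: sobolev_zero_def)
  with G(1) r\<phi> rg show thesis by (rule that)
qed

text \<open>The function approximates itself. What has to be checked is that the chosen weak
  gradient of the zero function vanishes almost everywhere, so that its \<open>W11_norm\<close> is
  0.\<close>

lemma test_in_W11_0:
  assumes \<Omega>: "open \<Omega>" and \<phi>: "\<phi> \<in> test_functions \<Omega>"
  shows "\<phi> \<in> W11_0 \<Omega>"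
proof -
  note D = test_functionD[OF \<phi>]
  have [measurable]: "\<Omega> \<in> sets borel" using \<Omega> by simp
  have wg: "has_weak_gradient \<Omega> \<phi> (grad \<phi>)" by (rule test_has_weak_gradient[OF \<Omega> \<phi>])
  have "\<phi> \<in> W11 \<Omega>"
    using wg integrable_lebesgue_on[OF D(6), of \<Omega>] integrable_lebesgue_on[OF D(7), of \<Omega>] by (auto simp: W11_def)
  moreover have "W11_norm \<Omega> (\<lambda>x. \<phi> x - \<phi> x) = 0"
  proof -
    have "has_weak_gradient \<Omega> (\<lambda>x. \<phi> x + (-1) * \<phi> x) (\<lambda>x. grad \<phi> x + (-1) *\<^sub>R grad \<phi> x)"
      by (rule has_weak_gradient_add[OF \<Omega> wg wg])
    then have "has_weak_gradient \<Omega> (\<lambda>x. 0) (\<lambda>x. 0)" by simp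
    from weak_gradient_AE[OF \<Omega> this]
    have "borel_version \<Omega> (\<lambda>x. norm (weak_gradient \<Omega> (\<lambda>x. 0) x)) (\<lambda>x. 0)" by (auto simp: borel_version_def)
    from borel_version_integral[OF _ this] show ?thesis by (simp add: W11_norm_def)
  qed
  ultimately show ?thesis using \<phi> by (auto simp: W11_0_def intro!: bexI[of _ \<phi>])
qed

subsection \<open>The double phase integrand under mollification\<close>

text \<open>The tangent to the convex power at \<open>s\<close>. By homogeneity it reduces to
  Bernoulli's inequality for \<open>t / s\<close>, which is Young's inequality with weights
  \<open>1 / r\<close> and \<open>1 - 1 / r\<close>. If \<open>s = 0\<close>, the left side is 0
  because \<open>0 powr r = 0\<close> for every exponent.\<close>

lemma powr_tangent:
  fixes s t r :: real
  assumes "s \<ge> 0" "t \<ge> 0" "r \<ge> 1"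
  shows "s powr r + r * s powr (r - 1) * (t - s) \<le> t powr r"
proof (cases "s = 0 \<or> t = 0")
  case True
  then show ?thesis
  proof
    assume "t = 0"
    have "s powr r = s * s powr (r - 1)" using assms by (cases "s = 0") (simp_all add: powr_diff)
    moreover have "1 * (s * s powr (r - 1)) \<le> r * (s * s powr (r - 1))"
      by (rule mult_right_mono) (use assms in auto)
    ultimately show ?thesis using \<open>t = 0\<close> by (simp add: algebra_simps)
  qed simp
next
  case False
  then have pos: "s > 0" "t > 0" using assms by auto
  have "((t / s) powr r) powr (1 / r) * 1 powr (1 - 1 / r) \<le> (1 / r) * (t / s) powr r + (1 - 1 / r) * 1"
    by (rule Youngs_inequality_0) (use assms pos in \<open>auto simp: field_simps\<close>)
  moreover have "((t / s) powr r) powr (1 / r) = t / s"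
    using pos assms by (simp add: powr_powr)
  ultimately have "t / s \<le> (1 / r) * (t / s) powr r + (1 - 1 / r)" by simp
  then have "r * (t / s) \<le> r * ((1 / r) * (t / s) powr r + (1 - 1 / r))"
    using assms by (intro mult_left_mono) auto
  also have "\<dots> = (t / s) powr r + r - 1" using assms by (simp add: algebra_simps)
  finally have "1 + r * (t / s - 1) \<le> (t / s) powr r" by (simp add: algebra_simps)
  then have "s powr r * (1 + r * (t / s - 1)) \<le> s powr r * (t / s) powr r"
    by (intro mult_left_mono) auto
  also have "\<dots> = t powr r" using pos by (simp add: powr_divide)
  also have "s powr r * (1 + r * (t / s - 1)) = s powr r + r * (s powr r / s) * (t - s)"
    using pos by (simp add: field_simps)
  also have "s powr r / s = s powr (r - 1)" using pos by (simp add: powr_diff)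
  finally show ?thesis .
qed

text \<open>Integrate the tangent inequality at the mean value \<open>s\<close>: the linear term
  drops out because \<open>w\<close> has total mass 1.\<close>

lemma powr_jensen:
  fixes w f :: "'a \<Rightarrow> real"
  assumes r: "r \<ge> 1" and w: "\<And>x. 0 \<le> w x" "integrable M w" "(\<integral>x. w x \<partial>M) = 1"
    and f: "\<And>x. 0 \<le> f x" "integrable M (\<lambda>x. w x * f x)" "integrable M (\<lambda>x. w x * f x powr r)"
  shows "(\<integral>x. w x * f x \<partial>M) powr r \<le> (\<integral>x. w x * f x powr r \<partial>M)"
proof -
  define s where "s = (\<integral>x. w x * f x \<partial>M)"
  have "s \<ge> 0" unfolding s_def using w f by (intro integral_nonneg_AE) auto
  have "s powr r = (\<integral>x. s powr r * w x + r * s powr (r - 1) * (w x * f x - s * w x) \<partial>M)"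
    using w f by (simp add: s_def[symmetric])
  also have "\<dots> \<le> (\<integral>x. w x * f x powr r \<partial>M)"
  proof (rule integral_mono)
    fix x
    have "w x * (s powr r + r * s powr (r - 1) * (f x - s)) \<le> w x * f x powr r"
      using powr_tangent[OF \<open>s \<ge> 0\<close> f(1) r] w(1) by (intro mult_left_mono) auto
    then show "s powr r * w x + r * s powr (r - 1) * (w x * f x - s * w x) \<le> w x * f x powr r"
      by (simp add: algebra_simps)
  qed (use w f in auto)
  finally show ?thesis by (simp add: s_def)
qed

text \<open>The sum is read as the convex combination of \<open>u / (1 - t)\<close> and
  \<open>v / t\<close> with weights \<open>1 - t\<close> and \<open>t\<close>. Since the factor of
  \<open>u\<close> tends to 1 as \<open>t\<close> tends to 0, a small perturbation \<open>v\<close>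
  can be added at arbitrarily little cost.\<close>

lemma norm_add_powr_le:
  fixes u v :: "'a::real_normed_vector"
  assumes "r \<ge> 1" "0 < t" "t < 1"
  shows "norm (u + v) powr r \<le> (1 - t) powr (1 - r) * norm u powr r + t powr (1 - r) * norm v powr r"
proof -
  define A where "A = norm u / (1 - t)"
  define B where "B = norm v / t"
  define s where "s = norm u + norm v"
  have AB: "A \<ge> 0" "B \<ge> 0" "s \<ge> 0" "(1 - t) * A + t * B = s" using assms by (auto simp: A_def B_def s_def)
  have "(1 - t) * (s powr r + r * s powr (r - 1) * (A - s)) \<le> (1 - t) * A powr r"
    using powr_tangent[of s A r] AB assms by (intro mult_left_mono) auto
  moreover have "t * (s powr r + r * s powr (r - 1) * (B - s)) \<le> t * B powr r"
    using powr_tangent[of s B r] AB assms by (intro mult_left_mono) auto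
  moreover have "(1 - t) * (s powr r + r * s powr (r - 1) * (A - s)) + t * (s powr r + r * s powr (r - 1) * (B - s))
      = s powr r + r * s powr (r - 1) * ((1 - t) * A + t * B - s)"
    by (simp add: algebra_simps)
  ultimately have "s powr r \<le> (1 - t) * A powr r + t * B powr r" using AB(4) by simp
  moreover have "norm (u + v) powr r \<le> s powr r"
    using assms norm_triangle_ineq[of u v] by (intro powr_mono2) (auto simp: s_def)
  moreover have "(1 - t) * A powr r = (1 - t) powr (1 - r) * norm u powr r"
    using assms by (simp add: A_def powr_divide powr_diff)
  moreover have "t * B powr r = t powr (1 - r) * norm v powr r"
    using assms by (simp add: B_def powr_divide powr_diff)
  ultimately show ?thesis by linarith
qed

section \<open>Convexity and convolution bounds for the double phase integrand\<close>

definition integrand :: "real \<Rightarrow> real \<Rightarrow> ('a \<Rightarrow> real) \<Rightarrow> ('a \<Rightarrow> 'b::real_normed_vector) \<Rightarrow> 'a \<Rightarrow> real" where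
  "integrand p q a g x = norm (g x) powr p + a x * norm (g x) powr q"

lemma integrand_nonneg: "0 \<le> a x \<Longrightarrow> 0 \<le> integrand p q a g x"
  by (simp add: integrand_def)

text \<open>As \<open>t\<close> and \<open>1 - t\<close> are below 1, the exponent
  \<open>1 - q\<close> gives larger factors than \<open>1 - p\<close>, so one pair of constants
  serves both powers.\<close>

lemma integrand_add_le:
  assumes pq: "1 \<le> p" "p \<le> q" and a: "0 \<le> a x" and t: "0 < t" "t < 1"
  shows "integrand p q a (\<lambda>x. u x + v x) x \<le> (1 - t) powr (1 - q) * integrand p q a u x + t powr (1 - q) * integrand p q a v x"
proof -
  have le: "(1 - t) powr (1 - p) \<le> (1 - t) powr (1 - q)" "t powr (1 - p) \<le> t powr (1 - q)"
    using pq t by (auto intro!: powr_mono')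
  have "norm (u x + v x) powr p \<le> (1 - t) powr (1 - p) * norm (u x) powr p + t powr (1 - p) * norm (v x) powr p"
    by (rule norm_add_powr_le) (use pq t in auto)
  also have "\<dots> \<le> (1 - t) powr (1 - q) * norm (u x) powr p + t powr (1 - q) * norm (v x) powr p"
    using le by (intro add_mono mult_right_mono) auto
  finally have 1: "norm (u x + v x) powr p \<le> \<dots>" .
  have "norm (u x + v x) powr q \<le> (1 - t) powr (1 - q) * norm (u x) powr q + t powr (1 - q) * norm (v x) powr q"
    by (rule norm_add_powr_le) (use pq t in auto)
  then have "a x * norm (u x + v x) powr q \<le>
      a x * ((1 - t) powr (1 - q) * norm (u x) powr q + t powr (1 - q) * norm (v x) powr q)"
    using a by (rule mult_left_mono)
  with 1 show ?thesis by (simp add: integrand_def algebra_simps)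
qed

lemma integrand_uminus: "integrand p q a (\<lambda>x. - g x) = integrand p q a g"
  by (simp add: integrand_def fun_eq_iff)

text \<open>The case \<open>t = 1 / 2\<close>: a triangle inequality up to a constant, with the
  difference obtained from the symmetry of the integrand.\<close>

lemma integrand_half_le:
  assumes pq: "1 \<le> p" "p \<le> q" and a: "0 \<le> a x"
  shows "integrand p q a (\<lambda>x. u x + v x) x \<le> 2 powr (q - 1) * (integrand p q a u x + integrand p q a v x)"
    "integrand p q a (\<lambda>x. u x - v x) x \<le> 2 powr (q - 1) * (integrand p q a u x + integrand p q a v x)"
proof -
  have *: "((1::real) - 1/2) powr (1 - q) = 2 powr (q - 1)" "(1/2::real) powr (1 - q) = 2 powr (q - 1)"
    using powr_minus[of "1/2::real" "q - 1"] powr_divide[of 1 "2::real" "q-1"] by simp_all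
  show "integrand p q a (\<lambda>x. u x + v x) x \<le> 2 powr (q - 1) * (integrand p q a u x + integrand p q a v x)" for v
    using integrand_add_le[where a=a and x=x, OF pq a, of "1/2" u v] * by (simp add: distrib_left)
  from this[of "\<lambda>x. - v x"]
  show "integrand p q a (\<lambda>x. u x - v x) x \<le> 2 powr (q - 1) * (integrand p q a u x + integrand p q a v x)"
    by (simp add: integrand_uminus)
qed

lemma integrand_mono:
  assumes "0 < p" "p \<le> q" "0 \<le> a x" "norm (u x) \<le> norm (v x)"
  shows "integrand p q a u x \<le> integrand p q a v x"
  unfolding integrand_def using assms by (intro add_mono mult_left_mono powr_mono2) auto

lemma borel_measurable_dens[measurable]:
  assumes [measurable]: "a \<in> borel_measurable M" "g \<in> borel_measurable M"
  shows "integrand p q a g \<in> borel_measurable M"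
  unfolding integrand_def[abs_def] by measurable

definition energy :: "real \<Rightarrow> real \<Rightarrow> ('a::euclidean_space \<Rightarrow> real) \<Rightarrow> ('a \<Rightarrow> 'b::real_normed_vector) \<Rightarrow> ennreal" where
  "energy p q a g = (\<integral>\<^sup>+x. ennreal (integrand p q a g x) \<partial>lborel)"

text \<open>The three summands of the constant have three sources: 1 from Jensen for the power
  \<open>p\<close>, \<open>C\<close> from Jensen for the power \<open>q\<close> where the weight has
  a positive lower bound, and \<open>C * K\<close> from the excess of \<open>a x\<close> over its
  neighbours, paid for by the sup bound \<open>B\<close>.\<close>

lemma integrand_conv_bound:
  fixes g :: "'a::euclidean_space \<Rightarrow> 'b::euclidean_space"
  assumes pq: "1 \<le> p" "p \<le> q" and C: "C > 0" and k: "mollifier R k" and "R > 0"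
    and g: "integrable lborel g" and a: "a \<in> borel_measurable borel" "\<And>x. 0 \<le> a x"
    and h: "integrable lborel (integrand p q a g)"
    and gS: "AE y in lborel. y \<notin> S \<longrightarrow> g y = 0"
    and aS: "\<And>y. x \<in> S \<Longrightarrow> y \<in> S \<Longrightarrow> a x \<le> C * (a y + norm (x - y) powr \<kappa>)" "x \<notin> S \<Longrightarrow> a x = 0"
    and \<kappa>: "\<kappa> > 0"
    and B: "norm (conv k g x) \<le> B" "B powr (q - p) * R powr \<kappa> \<le> K"
  shows "integrand p q a (conv k g) x \<le> (1 + C + C * K) * conv k (integrand p q a g) x"
proof -
  note kD = mollifierD[OF k]
  have [measurable]: "k \<in> borel_measurable borel" "g \<in> borel_measurable borel" using kD g by auto
  note [measurable] = a(1)
  define I where "I = conv k (integrand p q a g) x"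
  define G where "G = norm (conv k g x)"
  define s where "s = (\<integral>y. k (x - y) * norm (g y) \<partial>lborel)"
  have w: "integrable lborel (\<lambda>y. k (x - y))" "(\<integral>y. k (x - y) \<partial>lborel) = 1"
    using integrable_reflect[OF kD(7), of x] integral_reflect[OF kD(7), of x] kD(3,6) by auto
  have ik: "integrable lborel (\<lambda>y. k (x - y) * f y)" if "integrable lborel f" for f :: "'a \<Rightarrow> real"
    using integrable_kernel_mult[OF that kD(1,5), of x] by simp
  have ig: "integrable lborel (\<lambda>y. k (x - y) * norm (g y))" by (intro ik integrable_norm g)
  have I: "I = (\<integral>y. k (x - y) * integrand p q a g y \<partial>lborel)" by (simp add: I_def conv_def)
  have ih: "integrable lborel (\<lambda>y. k (x - y) * integrand p q a g y)" by (rule ik[OF h])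
  have K: "K \<ge> 0" using order_trans[OF _ B(2)] by simp
  have Gs: "0 \<le> G" "G \<le> s"
    using integral_norm_bound[of lborel "\<lambda>y. k (x - y) *\<^sub>R g y"] kD(2) by (auto simp: G_def s_def conv_def)
  have s0: "s \<ge> 0" using Gs by simp
  have "G powr p \<le> s powr p" using Gs pq by (intro powr_mono2) auto
  also have "\<dots> \<le> (\<integral>y. k (x - y) * norm (g y) powr p \<partial>lborel)"
    unfolding s_def
  proof (rule powr_jensen[OF pq(1)])
    show "integrable lborel (\<lambda>y. k (x - y) * norm (g y) powr p)"
      by (rule Bochner_Integration.integrable_bound[OF ih])
         (use a kD in \<open>auto simp: integrand_def abs_mult intro!: mult_left_mono\<close>)
  qed (use kD w ig in auto)
  also have "\<dots> \<le> I"
    unfolding I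
  proof (rule integral_mono')
    show "k (x - y) * norm (g y) powr p \<le> k (x - y) * integrand p q a g y" for y
      using kD(2) a by (intro mult_left_mono) (auto simp: integrand_def)
    show "0 \<le> k (x - y) * integrand p q a g y" for y using kD(2) a by (simp add: integrand_nonneg)
  qed (rule ih)
  finally have Gp: "G powr p \<le> I" .
  have I0: "I \<ge> 0" using Gp order_trans[OF powr_ge_zero] by blast
  \<comment> \<open>The factor \<open>G powr (q - p)\<close> is estimated by the sup bound, and what
    remains is the power \<open>p\<close>, already controlled by \<open>I\<close>.\<close>
  have RG: "R powr \<kappa> * G powr q \<le> K * I"
  proof -
    have "R powr \<kappa> * G powr q = (G powr (q - p) * R powr \<kappa>) * G powr p"
      using powr_add[of G "q - p" p] by simp
    also have "\<dots> \<le> K * I"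
    proof (intro mult_mono Gp)
      have "G powr (q - p) * R powr \<kappa> \<le> B powr (q - p) * R powr \<kappa>"
        using B(1) Gs pq by (intro mult_right_mono powr_mono2) (auto simp: G_def)
      then show "G powr (q - p) * R powr \<kappa> \<le> K" using B(2) by simp
    qed (use K in auto)
    finally show ?thesis .
  qed
  \<comment> \<open>\<open>a\<close> is at least \<open>m\<close> where the kernel lives, so Jensen absorbs \<open>m |g|^q\<close>; the remaining
    \<open>R powr \<kappa>\<close> is compensated by the sup bound on the mollified gradient.\<close>
  define m where "m = a x / C - R powr \<kappa>"
  have ax: "a x = C * m + C * R powr \<kappa>" using C by (simp add: m_def field_simps)
  have CKI: "C * (K * I) \<le> (C + C * K) * I" "0 \<le> (C + C * K) * I" using C K I0 by (auto simp: algebra_simps)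
  have "a x * G powr q \<le> (C + C * K) * I"
  proof (cases "x \<in> S \<and> m > 0")
    case False
    show ?thesis
    proof (cases "x \<in> S")
      case True
      then have "m \<le> 0" using False by simp
      then have "a x \<le> C * R powr \<kappa>" using C by (simp add: ax mult_nonneg_nonpos)
      then have "a x * G powr q \<le> C * R powr \<kappa> * G powr q" by (intro mult_right_mono) auto
      also have "\<dots> = C * (R powr \<kappa> * G powr q)" by simp
      also have "\<dots> \<le> C * (K * I)" using RG C by (intro mult_left_mono) auto
      finally show ?thesis using CKI by simp
    qed (use aS(2) CKI in simp)
  next
    case True
    then have x: "x \<in> S" and m: "m > 0" by auto
    \<comment> \<open>Points \<open>y\<close> outside \<open>S\<close> need no comparison of
      weights, because \<open>g\<close> vanishes there almost everywhere.\<close>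
    have ae: "AE y in lborel. k (x - y) * (m * norm (g y) powr q) \<le> k (x - y) * integrand p q a g y"
      using gS
    proof eventually_elim
      case (elim y)
      show ?case
      proof (cases "k (x - y) = 0 \<or> g y = 0")
        case False
        then have y: "y \<in> S" "norm (x - y) \<le> R" using elim kD(4) by auto
        have "a x \<le> C * (a y + R powr \<kappa>)"
          using aS(1)[OF x y(1)] powr_mono2[OF less_imp_le[OF \<kappa>] norm_ge_zero y(2)] C
          by (meson add_left_mono less_imp_le mult_left_mono order_trans)
        then have "m \<le> a y" using C unfolding m_def by (simp add: field_simps)
        then have "m * norm (g y) powr q \<le> integrand p q a g y"
          by (auto simp: integrand_def intro!: add_increasing mult_right_mono)
        then show ?thesis using kD(2) by (intro mult_left_mono)
      qed (use pq a kD in \<open>auto simp: integrand_def\<close>)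
    qed
    \<comment> \<open>The energy controls \<open>|g| powr q\<close> only together with the weight.
      Under the kernel the weight is at least \<open>m > 0\<close> wherever \<open>g\<close> is
      nonzero, up to a null set, so dividing by \<open>m\<close> yields the integrability that
      Jensen requires.\<close>
    have "integrable lborel (\<lambda>y. k (x - y) * (m * norm (g y) powr q))"
    proof (rule Bochner_Integration.integrable_bound[OF ih])
      show "AE y in lborel. norm (k (x - y) * (m * norm (g y) powr q)) \<le> norm (k (x - y) * integrand p q a g y)"
        using ae
      proof eventually_elim
        case (elim y)
        have "0 \<le> k (x - y) * (m * norm (g y) powr q)" using kD(2) m by simp
        then show ?case using elim by simp
      qed
    qed measurable
    from integrable_mult_right[OF this, of "inverse m"]
    have iq: "integrable lborel (\<lambda>y. k (x - y) * norm (g y) powr q)"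
      using m by (simp add: field_simps)
    have "m * G powr q \<le> m * (\<integral>y. k (x - y) * norm (g y) powr q \<partial>lborel)"
    proof (intro mult_left_mono)
      have "G powr q \<le> s powr q" using Gs pq by (intro powr_mono2) auto
      also have "\<dots> \<le> (\<integral>y. k (x - y) * norm (g y) powr q \<partial>lborel)"
        unfolding s_def by (rule powr_jensen) (use kD w ig iq pq in auto)
      finally show "G powr q \<le> (\<integral>y. k (x - y) * norm (g y) powr q \<partial>lborel)" .
    qed (use m in simp)
    also have "\<dots> = (\<integral>y. k (x - y) * (m * norm (g y) powr q) \<partial>lborel)"
      by (simp add: mult.left_commute[of _ m])
    also have "\<dots> \<le> I"
      unfolding I using iq ih ae
      by (intro integral_mono_AE) (auto simp: mult.left_commute[of _ m])
    finally have "m * G powr q \<le> I" .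
    then have "C * (m * G powr q) \<le> C * I" "C * (R powr \<kappa> * G powr q) \<le> C * (K * I)"
      using RG C by (auto intro!: mult_left_mono)
    then have "C * (m * G powr q) + C * (R powr \<kappa> * G powr q) \<le> (C + C * K) * I" by (simp add: algebra_simps)
    then show ?thesis unfolding ax by (simp add: algebra_simps)
  qed
  then have "integrand p q a (conv k g) x \<le> I + (C + C * K) * I"
    using Gp by (simp add: integrand_def G_def)
  then show ?thesis by (simp add: I_def algebra_simps)
qed

text \<open>The powers of \<open>\<delta>\<close> combine to the exponent
  \<open>\<kappa> - s * (q - p)\<close>, which is nonnegative, so for
  \<open>\<delta> \<le> 1\<close> the bound no longer depends on \<open>\<delta>\<close>. The factor
  \<open>c\<close> accounts for the radius of a shifted bump.\<close>

lemma powr_scaling_bound: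
  fixes \<delta> M c s p q \<kappa> :: real
  assumes "0 < \<delta>" "\<delta> \<le> 1" "M \<ge> 0" "c > 0" "s * (q - p) \<le> \<kappa>"
  shows "(M * \<delta> powr (- s)) powr (q - p) * (\<delta> * c) powr \<kappa> \<le> M powr (q - p) * c powr \<kappa>"
proof -
  have "\<delta> powr (- s * (q - p)) * \<delta> powr \<kappa> = \<delta> powr (\<kappa> - s * (q - p))"
    using assms by (simp add: powr_add[symmetric])
  also have "\<dots> \<le> 1" using assms by (intro powr_le1) auto
  finally have "(M powr (q - p) * c powr \<kappa>) * (\<delta> powr (- s * (q - p)) * \<delta> powr \<kappa>) \<le> (M powr (q - p) * c powr \<kappa>) * 1"
    by (intro mult_left_mono) auto
  moreover have "(M * \<delta> powr (- s)) powr (q - p) * (\<delta> * c) powr \<kappa> =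
      (M powr (q - p) * c powr \<kappa>) * (\<delta> powr (- s * (q - p)) * \<delta> powr \<kappa>)"
    by (simp only: powr_mult powr_powr mult_ac)
  ultimately show ?thesis by simp
qed

text \<open>The sup bound enters in the abstract form \<open>M * \<delta> powr (- s)\<close>, so
  that both of its sources are covered by one argument. The shift \<open>v\<close> is
  arbitrary.\<close>

lemma mollify_energy:
  fixes g :: "'a::euclidean_space \<Rightarrow> 'a"
  assumes pq: "1 \<le> p" "p \<le> q" and C: "C > 0" and \<rho>: "is_bump \<rho>"
    and g: "integrable lborel g" and a: "a \<in> borel_measurable borel" "\<And>x. 0 \<le> a x"
    and h: "integrable lborel (integrand p q a g)"
    and gS: "AE y in lborel. y \<notin> S \<longrightarrow> g y = 0"
    and aS: "\<And>x y. x \<in> S \<Longrightarrow> y \<in> S \<Longrightarrow> a x \<le> C * (a y + norm (x - y) powr \<kappa>)" "\<And>x. x \<notin> S \<Longrightarrow> a x = 0"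
    and \<kappa>: "\<kappa> > 0" and s: "s * (q - p) \<le> \<kappa>"
    and B: "M \<ge> 0" "\<And>\<delta> x. 0 < \<delta> \<Longrightarrow> \<delta> \<le> 1 \<Longrightarrow> norm (conv (scaled_bump \<rho> \<delta> v) g x) \<le> M * \<delta> powr (- s)"
    and "\<epsilon> > 0" "\<delta>\<^sub>0 > 0"
  obtains \<delta> where "0 < \<delta>" "\<delta> < \<delta>\<^sub>0" "energy p q a (\<lambda>x. conv (scaled_bump \<rho> \<delta> v) g x - g x) < \<epsilon>"
proof -
  define c where "c = norm v + 1"
  have c: "c > 0" by (simp add: c_def add_nonneg_pos)
  \<comment> \<open>Halving gives scales strictly below the prescribed one; the cap 1 is required by
    the sup bound and by \<open>powr_scaling_bound\<close>.\<close>
  define \<delta> where "\<delta> j = min (\<delta>\<^sub>0 / 2) 1 / real (Suc j)" for j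
  have \<delta>: "0 < \<delta> j" "\<delta> j \<le> 1" "\<delta> j < \<delta>\<^sub>0" for j
  proof -
    have "\<delta> j \<le> min (\<delta>\<^sub>0 / 2) 1 / 1" unfolding \<delta>_def using \<open>\<delta>\<^sub>0 > 0\<close> by (intro divide_left_mono) auto
    then show "\<delta> j \<le> 1" "\<delta> j < \<delta>\<^sub>0" using \<open>\<delta>\<^sub>0 > 0\<close> by auto
  qed (use \<open>\<delta>\<^sub>0 > 0\<close> in \<open>simp add: \<delta>_def\<close>)
  have \<delta>lim: "\<delta> \<longlonglongrightarrow> 0"
    unfolding \<delta>_def by (intro real_tendsto_divide_at_top[OF tendsto_const] filterlim_compose[OF filterlim_real_sequentially filterlim_Suc])
  define k where "k j = scaled_bump \<rho> (\<delta> j) v" for j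
  have k: "mollifier (\<delta> j * c) (k j)" for j
    unfolding k_def c_def by (rule scaled_bump_mollifier[OF \<rho> \<delta>(1)])
  note kD = mollifierD[OF k]
  have conv_lim: "(\<lambda>j. \<integral>x. norm (conv (k j) f x - f x) \<partial>lborel) \<longlonglongrightarrow> 0"
    if f: "integrable lborel f" for f :: "'a \<Rightarrow> 'b::euclidean_space"
  proof (rule LIMSEQ_I)
    fix e :: real assume "e > 0"
    then obtain d where d: "d > 0" "\<And>k. mollifier d k \<Longrightarrow> (\<integral>x. norm (conv k f x - f x) \<partial>lborel) < e"
      using mollify_L1[OF f] by blast
    have "\<forall>\<^sub>F j in sequentially. \<delta> j < d / c"
      using order_tendstoD(2)[OF \<delta>lim, of "d / c"] d c by simp
    then obtain n where n: "\<And>j. j \<ge> n \<Longrightarrow> \<delta> j < d / c" by (auto simp: eventually_sequentially)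
    have "norm ((\<integral>x. norm (conv (k j) f x - f x) \<partial>lborel) - 0) < e" if "j \<ge> n" for j
    proof -
      have "\<delta> j * c \<le> d" using n[OF that] c by (simp add: field_simps)
      then have "(\<integral>x. norm (conv (k j) f x - f x) \<partial>lborel) < e" by (intro d mollifier_mono[OF k])
      moreover have "0 \<le> (\<integral>x. norm (conv (k j) f x - f x) \<partial>lborel)" by (intro integral_nonneg_AE) auto
      ultimately show ?thesis by simp
    qed
    then show "\<exists>n. \<forall>j\<ge>n. norm ((\<integral>x. norm (conv (k j) f x - f x) \<partial>lborel) - 0) < e" by blast
  qed
  have ic: "integrable lborel (\<lambda>x. conv (k j) g x - g x)" for j
    by (intro Bochner_Integration.integrable_diff conv_mollifier_integrable[OF k] g)
  \<comment> \<open>Convergence in \<open>L^1\<close> gives almost everywhere convergence along a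
    subsequence only, which suffices since a single good scale is sought.\<close>
  obtain r :: "nat \<Rightarrow> nat" where r: "strict_mono r" "AE x in lborel. (\<lambda>j. conv (k (r j)) g x - g x) \<longlonglongrightarrow> 0"
    using tendsto_L1_AE_subseq[OF ic conv_lim[OF g]] by blast
  define h where "h = integrand p q a g"
  have hi: "integrable lborel h" using h by (simp add: h_def)
  have [measurable]: "k j \<in> borel_measurable borel" "g \<in> borel_measurable borel" "h \<in> borel_measurable borel" for j
    using kD g hi by auto
  note [measurable] = a(1)
  \<comment> \<open>The factor of \<open>integrand_conv_bound\<close> for radius
    \<open>\<delta> j * c\<close>, made independent of \<open>j\<close> by
    \<open>powr_scaling_bound\<close>. Subtracting \<open>g\<close> then costs the factor of
    \<open>integrand_half_le\<close> and one more copy of \<open>h\<close>, hence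
    \<open>A\<close>.\<close>
  define K where "K = 1 + C + C * (M powr (q - p) * c powr \<kappa>)"
  define A where "A = 2 powr (q - 1) * (K + 1)"
  have K0: "K \<ge> 1" using C by (simp add: K_def)
  have A0: "A > 0" using K0 by (simp add: A_def)
  define F where "F j = integrand p q a (\<lambda>x. conv (k j) g x - g x)" for j
  have F0: "0 \<le> F j x" for j x using a by (simp add: F_def integrand_nonneg)
  have h0: "0 \<le> h x" for x using a by (simp add: h_def integrand_nonneg)
  have [measurable]: "F j \<in> borel_measurable borel" for j unfolding F_def by measurable
  have F_le: "F j x \<le> A * (conv (k j) h x + h x)" for j x
  proof -
    have "integrand p q a (conv (k j) g) x \<le> K * conv (k j) h x"
      unfolding K_def h_def
    proof (rule integrand_conv_bound[OF pq C k _ g a h gS _ aS(2) \<kappa>])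
      show "norm (conv (k j) g x) \<le> M * \<delta> j powr (- s)" unfolding k_def by (rule B(2)[OF \<delta>(1,2)])
      show "(M * \<delta> j powr - s) powr (q - p) * (\<delta> j * c) powr \<kappa> \<le> M powr (q - p) * c powr \<kappa>"
        by (rule powr_scaling_bound[OF \<delta>(1,2) B(1) c s])
    qed (use aS \<delta> c in auto)
    moreover have "conv (k j) h x \<ge> 0"
      unfolding conv_def using kD(2) h0 by (intro integral_nonneg_AE) auto
    moreover have "F j x \<le> 2 powr (q - 1) * (integrand p q a (conv (k j) g) x + h x)"
      unfolding F_def h_def by (rule integrand_half_le(2)[where a=a and x=x, OF pq a(2)])
    ultimately have "F j x \<le> 2 powr (q - 1) * (K * conv (k j) h x + h x)"
      by (meson add_right_mono mult_left_mono order_trans powr_ge_zero)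
    also have "\<dots> \<le> 2 powr (q - 1) * ((K + 1) * (conv (k j) h x + h x))"
      using \<open>conv (k j) h x \<ge> 0\<close> h0[of x] K0 by (intro mult_left_mono) (auto simp: algebra_simps)
    finally show ?thesis by (simp add: A_def mult.assoc)
  qed
  \<comment> \<open>The minimum is handled by dominated convergence and the last term by mollification in \<open>L\<^sup>1\<close>,
    which replaces a generalised dominated convergence theorem.\<close>
  have F_le2: "F j x \<le> min (F j x) (2 * A * h x) + A * \<bar>conv (k j) h x - h x\<bar>" for j x
  proof -
    have "A * (conv (k j) h x + h x) \<le> A * (2 * h x + \<bar>conv (k j) h x - h x\<bar>)"
      using A0 by (intro mult_left_mono) auto
    then have "F j x \<le> 2 * A * h x + A * \<bar>conv (k j) h x - h x\<bar>"
      using F_le[of j x] by (simp add: algebra_simps)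
    moreover have "0 \<le> A * \<bar>conv (k j) h x - h x\<bar>" using A0 by simp
    ultimately show ?thesis by linarith
  qed
  have hc: "integrable lborel (conv (k j) h)" for j by (rule conv_mollifier_integrable[OF k hi])
  have lim1: "(\<lambda>j. \<integral>x. min (F (r j) x) (2 * A * h x) \<partial>lborel) \<longlonglongrightarrow> (\<integral>x. 0 \<partial>(lborel :: 'a measure))"
  proof (rule integral_dominated_convergence[where w="\<lambda>x. 2 * A * h x"])
    show "AE x in lborel. (\<lambda>j. min (F (r j) x) (2 * A * h x)) \<longlonglongrightarrow> 0"
      using r(2)
    proof eventually_elim
      case (elim x)
      have "(\<lambda>j. norm (conv (k (r j)) g x - g x) powr p) \<longlonglongrightarrow> norm (0::'a) powr p"
        using elim pq by (intro tendsto_powr' tendsto_norm tendsto_const) auto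
      moreover have "(\<lambda>j. norm (conv (k (r j)) g x - g x) powr q) \<longlonglongrightarrow> norm (0::'a) powr q"
        using elim pq by (intro tendsto_powr' tendsto_norm tendsto_const) auto
      ultimately have "(\<lambda>j. norm (conv (k (r j)) g x - g x) powr p + a x * norm (conv (k (r j)) g x - g x) powr q)
          \<longlonglongrightarrow> norm (0::'a) powr p + a x * norm (0::'a) powr q"
        by (rule tendsto_add[OF _ tendsto_mult_left])
      then have "(\<lambda>j. F (r j) x) \<longlonglongrightarrow> norm (0::'a) powr p + a x * norm (0::'a) powr q"
        unfolding F_def integrand_def .
      then have "(\<lambda>j. min (F (r j) x) (2 * A * h x)) \<longlonglongrightarrow> min (norm (0::'a) powr p + a x * norm (0::'a) powr q) (2 * A * h x)"
        by (intro tendsto_intros)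
      then show ?case using A0 h0[of x] by simp
    qed
    show "AE x in lborel. norm (min (F (r j) x) (2 * A * h x)) \<le> 2 * A * h x" for j
      using F0 h0 A0 by auto
  qed (use hi in auto)
  have "(\<lambda>j. A * (\<integral>x. norm (conv (k (r j)) h x - h x) \<partial>lborel)) \<longlonglongrightarrow> A * 0"
    by (intro tendsto_mult_left LIMSEQ_subseq_LIMSEQ[OF conv_lim[OF hi] r(1), unfolded o_def])
  from tendsto_add[OF lim1 this]
  have lim: "(\<lambda>j. (\<integral>x. min (F (r j) x) (2 * A * h x) \<partial>lborel) + A * (\<integral>x. norm (conv (k (r j)) h x - h x) \<partial>lborel)) \<longlonglongrightarrow> 0"
    by simp
  \<comment> \<open>The bound \<open>\<epsilon>\<close> may be infinite; the limit above is compared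
    with a real number below it.\<close>
  obtain e where e: "e > 0" "ennreal e \<le> \<epsilon>"
  proof (cases \<epsilon>)
    case (real e)
    then show thesis using \<open>\<epsilon> > 0\<close> that[of e] by auto
  next
    case top
    then show thesis using that[of 1] by simp
  qed
  from order_tendstoD(2)[OF lim e(1)] obtain j where
    j: "(\<integral>x. min (F (r j) x) (2 * A * h x) \<partial>lborel) + A * (\<integral>x. norm (conv (k (r j)) h x - h x) \<partial>lborel) < e"
    by (auto simp: eventually_sequentially)
  have im: "integrable lborel (\<lambda>x. min (F (r j) x) (2 * A * h x))"
    by (rule Bochner_Integration.integrable_bound[of _ "\<lambda>x. 2 * A * h x"]) (use hi F0 h0 A0 in auto)
  have iA: "integrable lborel (\<lambda>x. A * \<bar>conv (k (r j)) h x - h x\<bar>)" using hc hi by auto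
  have "energy p q a (\<lambda>x. conv (k (r j)) g x - g x) = (\<integral>\<^sup>+x. ennreal (F (r j) x) \<partial>lborel)"
    by (simp add: energy_def F_def)
  also have "\<dots> \<le> (\<integral>\<^sup>+x. ennreal (min (F (r j) x) (2 * A * h x) + A * \<bar>conv (k (r j)) h x - h x\<bar>) \<partial>lborel)"
    by (intro nn_integral_mono ennreal_leI F_le2)
  also have "\<dots> = ennreal (\<integral>x. min (F (r j) x) (2 * A * h x) + A * \<bar>conv (k (r j)) h x - h x\<bar> \<partial>lborel)"
    using F0 h0 A0 im iA
    by (intro nn_integral_eq_integral Bochner_Integration.integrable_add) auto
  also have "(\<integral>x. min (F (r j) x) (2 * A * h x) + A * \<bar>conv (k (r j)) h x - h x\<bar> \<partial>lborel) =
      (\<integral>x. min (F (r j) x) (2 * A * h x) \<partial>lborel) + A * (\<integral>x. norm (conv (k (r j)) h x - h x) \<partial>lborel)"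
    using im iA by (subst Bochner_Integration.integral_add) auto
  also have "ennreal \<dots> < ennreal e" using j e(1) by (simp add: ennreal_less_iff ennreal_lessI)
  also have "\<dots> \<le> \<epsilon>" by (rule e(2))
  finally show thesis using that[OF \<delta>(1,3), of "r j"] unfolding k_def by blast
qed

subsection \<open>Functions vanishing on the boundary\<close>

lemma C1cD:
  assumes "C1c \<Omega> \<psi> D"
  shows "has_grad \<psi> D" "bounded_support \<psi>" "integrable lborel \<psi>" "integrable lborel D"
proof -
  show 1: "has_grad \<psi> D" using assms by (simp add: C1c_def)
  show 2: "bounded_support \<psi>" using assms compact_closure_bdd_supp[of \<psi>] unfolding C1c_def by blast
  show "integrable lborel \<psi>" by (rule continuous_bdd_supp_integrable[OF has_gradD(3)[OF 1] 2])
  show "integrable lborel D" by (rule continuous_bdd_supp_integrable[OF has_gradD(2)[OF 1] has_grad_bdd_supp[OF 1 2]])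
qed

lemma C1c_shrink:
  assumes "C1c \<Omega> \<psi> D" "has_grad \<psi>' D'" "\<And>x. \<psi>' x \<noteq> 0 \<Longrightarrow> \<psi> x \<noteq> 0"
  shows "C1c \<Omega> \<psi>' D'"
proof -
  have K: "compact (closure {x. \<psi> x \<noteq> 0})" "closure {x. \<psi> x \<noteq> 0} \<subseteq> \<Omega>" using assms by (auto simp: C1c_def)
  have "x \<in> closure {x. \<psi> x \<noteq> 0}" if "\<psi>' x \<noteq> 0" for x
    using assms(3)[OF that] closure_subset[of "{x. \<psi> x \<noteq> 0}"] by auto
  from support_subset_compact[of "closure {x. \<psi> x \<noteq> 0}" \<psi>', OF K(1) this] K(2) assms(2)
  show ?thesis unfolding C1c_def by blast
qed

lemma sobolev_zeroD:
  assumes "sobolev_zero \<Omega> \<phi> g"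
  shows "integrable lborel \<phi>" "integrable lborel g"
    "\<epsilon> > 0 \<Longrightarrow> \<exists>\<psi> D. C1c \<Omega> \<psi> D \<and> (\<integral>x. \<bar>\<phi> x - \<psi> x\<bar> \<partial>lborel) < \<epsilon> \<and> (\<integral>x. norm (g x - D x) \<partial>lborel) < \<epsilon>"
  using assms by (auto simp: sobolev_zero_def)

section \<open>Truncation, cut-off and mollification of functions with zero boundary values\<close>

lemma has_grad_compose:
  assumes "has_grad \<psi> D" and T: "\<And>t. (T has_real_derivative T' t) (at t)" "continuous_on UNIV T'"
  shows "has_grad (\<lambda>x. T (\<psi> x)) (\<lambda>x. T' (\<psi> x) *\<^sub>R D x)"
  unfolding has_grad_def
proof (intro conjI allI)
  fix x
  show "((\<lambda>x. T (\<psi> x)) has_derivative (\<lambda>h. T' (\<psi> x) *\<^sub>R D x \<bullet> h)) (at x)"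
    using has_derivative_compose[OF has_gradD(1)[OF assms(1)] T(1)[unfolded has_field_derivative_def]]
    by simp
  show "continuous_on UNIV (\<lambda>x. T' (\<psi> x) *\<^sub>R D x)"
    by (intro continuous_intros continuous_on_compose2[OF T(2)] has_gradD[OF assms(1)]) auto
qed

text \<open>The chain rule. The gradient error splits into \<open>(T' \<phi> - T' \<psi>) g\<close>,
  which tends to 0 by dominated convergence since \<open>T'\<close> is continuous, and
  \<open>T' \<psi> (g - D)\<close>, which is controlled by \<open>\<bar>T'\<bar> \<le> 1\<close>.
  The condition \<open>T 0 = 0\<close> keeps the approximants compactly supported.\<close>

lemma sobolev_zero_compose:
  fixes T T' :: "real \<Rightarrow> real"
  assumes s: "sobolev_zero \<Omega> \<phi> g" and T: "\<And>t. (T has_real_derivative T' t) (at t)" "continuous_on UNIV T'"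
    "T 0 = 0" "\<And>t. \<bar>T' t\<bar> \<le> 1"
  shows "sobolev_zero \<Omega> (\<lambda>x. T (\<phi> x)) (\<lambda>x. T' (\<phi> x) *\<^sub>R g x)"
proof -
  have Tlip: "\<bar>T x - T y\<bar> \<le> \<bar>x - y\<bar>" for x y
    using field_differentiable_bound[of UNIV T T' 1 x y] T(1,4) by (simp add: has_field_derivative_at_within)
  note i = sobolev_zeroD(1,2)[OF s]
  have Tc: "continuous_on UNIV T" using T(1) by (meson DERIV_continuous_on has_field_derivative_at_within)
  have [measurable]: "T \<in> borel_measurable borel" "T' \<in> borel_measurable borel"
    "\<phi> \<in> borel_measurable borel" "g \<in> borel_measurable borel"
    using T(2) Tc i by (auto intro: borel_measurable_continuous_onI)
  have iT: "integrable lborel (\<lambda>x. T (f x))" if f: "integrable lborel f" for f :: "'a \<Rightarrow> real"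
  proof (rule Bochner_Integration.integrable_bound[OF f])
    have [measurable]: "f \<in> borel_measurable borel" using f by simp
    show "(\<lambda>x. T (f x)) \<in> borel_measurable lborel" by measurable
    show "AE x in lborel. norm (T (f x)) \<le> norm (f x)" using Tlip[of _ 0] T(3) by simp
  qed
  have T'le: "\<bar>T' t\<bar> * r \<le> r" if "r \<ge> 0" for t r using mult_right_mono[OF T(4) that, of t] by simp
  have iT': "integrable lborel (\<lambda>x. T' (f x) *\<^sub>R G x)"
    if f[measurable]: "f \<in> borel_measurable borel" and G: "integrable lborel G" for f and G :: "'a \<Rightarrow> 'a"
  proof (rule Bochner_Integration.integrable_bound[OF G])
    have [measurable]: "G \<in> borel_measurable borel" using G by simp
    show "(\<lambda>x. T' (f x) *\<^sub>R G x) \<in> borel_measurable lborel" by measurable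
    show "AE x in lborel. norm (T' (f x) *\<^sub>R G x) \<le> norm (G x)" using T'le by simp
  qed
  have "\<exists>\<psi> D. C1c \<Omega> \<psi> D \<and> (\<integral>x. \<bar>\<phi> x - \<psi> x\<bar> \<partial>lborel) < 1 / real (Suc n) \<and> (\<integral>x. norm (g x - D x) \<partial>lborel) < 1 / real (Suc n)" for n
    by (rule sobolev_zeroD(3)[OF s]) simp
  then obtain \<psi> D where \<psi>: "\<And>n. C1c \<Omega> (\<psi> n) (D n)" "\<And>n. (\<integral>x. \<bar>\<phi> x - \<psi> n x\<bar> \<partial>lborel) < 1 / real (Suc n)"
     "\<And>n. (\<integral>x. norm (g x - D n x) \<partial>lborel) < 1 / real (Suc n)"
    by metis
  note C = C1cD[OF \<psi>(1)]
  have [measurable]: "\<psi> n \<in> borel_measurable borel" "D n \<in> borel_measurable borel" for n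
    using has_gradD[OF C(1)] by auto
  have i1: "integrable lborel (\<lambda>x. \<psi> n x - \<phi> x)" "integrable lborel (\<lambda>x. g x - D n x)" for n
    by (intro Bochner_Integration.integrable_diff C i)+
  have inv: "(\<lambda>n. 1 / real (Suc n)) \<longlonglongrightarrow> 0" using LIMSEQ_inverse_real_of_nat by (simp add: inverse_eq_divide)
  have "(\<lambda>n. \<integral>x. norm (\<psi> n x - \<phi> x) \<partial>lborel) \<longlonglongrightarrow> 0"
  proof (rule tendsto_sandwich[OF _ _ tendsto_const inv])
    show "\<forall>\<^sub>F n in sequentially. (\<integral>x. norm (\<psi> n x - \<phi> x) \<partial>lborel) \<le> 1 / real (Suc n)"
      using \<psi>(2) by (auto simp: abs_minus_commute less_imp_le simp del: of_nat_Suc)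
  qed (auto intro!: integral_nonneg_AE)
  from tendsto_L1_AE_subseq[OF i1(1) this] obtain r :: "nat \<Rightarrow> nat"
    where r: "strict_mono r" "AE x in lborel. (\<lambda>n. \<psi> (r n) x - \<phi> x) \<longlonglongrightarrow> 0" by blast
  \<comment> \<open>Pointwise convergence of the approximants is available along the subsequence
    \<open>r\<close>, and the constant 2 comes from \<open>\<bar>T'\<bar> \<le> 1\<close> at both
    arguments.\<close>
  have lim: "(\<lambda>n. \<integral>x. \<bar>T' (\<phi> x) - T' (\<psi> (r n) x)\<bar> * norm (g x) \<partial>lborel) \<longlonglongrightarrow> (\<integral>x. 0 \<partial>(lborel :: 'a measure))"
  proof (rule integral_dominated_convergence[where w="\<lambda>x. 2 * norm (g x)"])
    show "AE x in lborel. (\<lambda>n. \<bar>T' (\<phi> x) - T' (\<psi> (r n) x)\<bar> * norm (g x)) \<longlonglongrightarrow> 0"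
      using r(2)
    proof eventually_elim
      case (elim x)
      have "(\<lambda>n. (\<psi> (r n) x - \<phi> x) + \<phi> x) \<longlonglongrightarrow> 0 + \<phi> x" by (intro tendsto_intros elim)
      then have "(\<lambda>n. \<psi> (r n) x) \<longlonglongrightarrow> \<phi> x" by simp
      moreover have "isCont T' (\<phi> x)" using T(2) by (simp add: continuous_on_eq_continuous_at)
      ultimately have "(\<lambda>n. T' (\<psi> (r n) x)) \<longlonglongrightarrow> T' (\<phi> x)" by (rule isCont_tendsto_compose[rotated])
      then have "(\<lambda>n. \<bar>T' (\<phi> x) - T' (\<psi> (r n) x)\<bar> * norm (g x)) \<longlonglongrightarrow> \<bar>T' (\<phi> x) - T' (\<phi> x)\<bar> * norm (g x)"
        by (intro tendsto_intros)
      then show ?case by simp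
    qed
    show "AE x in lborel. norm (\<bar>T' (\<phi> x) - T' (\<psi> (r n) x)\<bar> * norm (g x)) \<le> 2 * norm (g x)" for n
    proof (rule AE_I2)
      fix x
      have "\<bar>T' (\<phi> x) - T' (\<psi> (r n) x)\<bar> \<le> 2" using T(4)[of "\<phi> x"] T(4)[of "\<psi> (r n) x"] by linarith
      then show "norm (\<bar>T' (\<phi> x) - T' (\<psi> (r n) x)\<bar> * norm (g x)) \<le> 2 * norm (g x)"
        by (simp add: abs_mult mult_right_mono)
    qed
  qed (use i in auto)
  have iTg: "integrable lborel (\<lambda>x. \<bar>T' (\<phi> x) - T' (\<psi> n x)\<bar> * norm (g x))" for n
  proof (rule Bochner_Integration.integrable_bound)
    show "integrable lborel (\<lambda>x. 2 * norm (g x))" using i by simp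
    show "AE x in lborel. norm (\<bar>T' (\<phi> x) - T' (\<psi> n x)\<bar> * norm (g x)) \<le> norm (2 * norm (g x))"
    proof (rule AE_I2)
      fix x
      have "\<bar>T' (\<phi> x) - T' (\<psi> n x)\<bar> \<le> 2" using T(4)[of "\<phi> x"] T(4)[of "\<psi> n x"] by linarith
      then show "norm (\<bar>T' (\<phi> x) - T' (\<psi> n x)\<bar> * norm (g x)) \<le> norm (2 * norm (g x))"
        by (simp add: abs_mult mult_right_mono)
    qed
  qed measurable
  show ?thesis
    unfolding sobolev_zero_def
  proof (intro conjI allI impI)
    show "integrable lborel (\<lambda>x. T (\<phi> x))" "integrable lborel (\<lambda>x. T' (\<phi> x) *\<^sub>R g x)"
      using i by (auto intro: iT iT')
    fix \<epsilon> :: real assume "\<epsilon> > 0"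
    then have "\<forall>\<^sub>F n in sequentially. (\<integral>x. \<bar>T' (\<phi> x) - T' (\<psi> (r n) x)\<bar> * norm (g x) \<partial>lborel) < \<epsilon> / 2"
      using order_tendstoD(2)[OF lim, of "\<epsilon>/2"] by simp
    moreover have "\<forall>\<^sub>F n in sequentially. 1 / real (Suc (r n)) < \<epsilon> / 2"
      using order_tendstoD(2)[OF LIMSEQ_subseq_LIMSEQ[OF inv r(1)], of "\<epsilon>/2"] \<open>\<epsilon> > 0\<close> by (simp add: o_def)
    ultimately have "\<forall>\<^sub>F n in sequentially. (\<integral>x. \<bar>T' (\<phi> x) - T' (\<psi> (r n) x)\<bar> * norm (g x) \<partial>lborel) < \<epsilon> / 2 \<and> 1 / real (Suc (r n)) < \<epsilon> / 2"
      by (rule eventually_conj)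
    then obtain n where n: "(\<integral>x. \<bar>T' (\<phi> x) - T' (\<psi> (r n) x)\<bar> * norm (g x) \<partial>lborel) < \<epsilon> / 2" "1 / real (Suc (r n)) < \<epsilon> / 2"
      unfolding eventually_sequentially by blast
    define m where "m = r n"
    have "C1c \<Omega> (\<lambda>x. T (\<psi> m x)) (\<lambda>x. T' (\<psi> m x) *\<^sub>R D m x)"
      by (rule C1c_shrink[OF \<psi>(1)[of m] has_grad_compose[OF C(1) T(1,2)]]) (use T(3) in auto)
    moreover have "(\<integral>x. \<bar>T (\<phi> x) - T (\<psi> m x)\<bar> \<partial>lborel) < \<epsilon>"
    proof -
      have "(\<integral>x. \<bar>T (\<phi> x) - T (\<psi> m x)\<bar> \<partial>lborel) \<le> (\<integral>x. \<bar>\<phi> x - \<psi> m x\<bar> \<partial>lborel)"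
        using i C(3)[of m] by (intro integral_mono integrable_abs Bochner_Integration.integrable_diff iT Tlip) auto
      also have "\<dots> < 1 / real (Suc m)" by (rule \<psi>(2))
      also have "\<dots> < \<epsilon>" using n(2) \<open>\<epsilon> > 0\<close> unfolding m_def by linarith
      finally show ?thesis .
    qed
    moreover have "(\<integral>x. norm (T' (\<phi> x) *\<^sub>R g x - T' (\<psi> m x) *\<^sub>R D m x) \<partial>lborel) < \<epsilon>"
    proof -
      have "(\<integral>x. norm (T' (\<phi> x) *\<^sub>R g x - T' (\<psi> m x) *\<^sub>R D m x) \<partial>lborel) \<le>
          (\<integral>x. \<bar>T' (\<phi> x) - T' (\<psi> m x)\<bar> * norm (g x) + norm (g x - D m x) \<partial>lborel)"
      proof (rule integral_mono)
        fix x
        have "T' (\<phi> x) *\<^sub>R g x - T' (\<psi> m x) *\<^sub>R D m x =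
            (T' (\<phi> x) - T' (\<psi> m x)) *\<^sub>R g x + T' (\<psi> m x) *\<^sub>R (g x - D m x)"
          by (simp add: algebra_simps)
        also have "norm \<dots> \<le> norm ((T' (\<phi> x) - T' (\<psi> m x)) *\<^sub>R g x) + norm (T' (\<psi> m x) *\<^sub>R (g x - D m x))"
          by (rule norm_triangle_ineq)
        also have "\<dots> \<le> \<bar>T' (\<phi> x) - T' (\<psi> m x)\<bar> * norm (g x) + norm (g x - D m x)"
          using T'le by simp
        finally show "norm (T' (\<phi> x) *\<^sub>R g x - T' (\<psi> m x) *\<^sub>R D m x) \<le>
            \<bar>T' (\<phi> x) - T' (\<psi> m x)\<bar> * norm (g x) + norm (g x - D m x)" .
      next
        show "integrable lborel (\<lambda>x. norm (T' (\<phi> x) *\<^sub>R g x - T' (\<psi> m x) *\<^sub>R D m x))"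
          by (intro integrable_norm Bochner_Integration.integrable_diff iT' i C) auto
        show "integrable lborel (\<lambda>x. \<bar>T' (\<phi> x) - T' (\<psi> m x)\<bar> * norm (g x) + norm (g x - D m x))"
          by (intro Bochner_Integration.integrable_add iTg integrable_norm i1)
      qed
      also have "\<dots> = (\<integral>x. \<bar>T' (\<phi> x) - T' (\<psi> m x)\<bar> * norm (g x) \<partial>lborel) + (\<integral>x. norm (g x - D m x) \<partial>lborel)"
        by (intro Bochner_Integration.integral_add iTg integrable_norm i1)
      also have "\<dots> < \<epsilon>" using n \<psi>(3)[of m] by (simp add: m_def)
      finally show ?thesis .
    qed
    ultimately show "\<exists>\<psi> D. C1c \<Omega> \<psi> D \<and> (\<integral>x. \<bar>T (\<phi> x) - \<psi> x\<bar> \<partial>lborel) < \<epsilon> \<and> (\<integral>x. norm (T' (\<phi> x) *\<^sub>R g x - D x) \<partial>lborel) < \<epsilon>"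
      by blast
  qed
qed

lemma bounded_mult_integrable:
  fixes f :: "'a::euclidean_space \<Rightarrow> 'b::euclidean_space"
  assumes f: "integrable lborel f" and [measurable]: "\<eta> \<in> borel_measurable borel" and B: "\<And>x. \<bar>\<eta> x\<bar> \<le> B"
  shows "integrable lborel (\<lambda>x. \<eta> x *\<^sub>R f x)" "(\<integral>x. norm (\<eta> x *\<^sub>R f x) \<partial>lborel) \<le> B * (\<integral>x. norm (f x) \<partial>lborel)"
proof -
  have [measurable]: "f \<in> borel_measurable borel" using f by simp
  have le: "norm (\<eta> x *\<^sub>R f x) \<le> B * norm (f x)" for x using B[of x] by (simp add: mult_right_mono)
  show 1: "integrable lborel (\<lambda>x. \<eta> x *\<^sub>R f x)"
  proof (rule Bochner_Integration.integrable_bound)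
    show "integrable lborel (\<lambda>x. B * norm (f x))" using f by simp
    show "AE x in lborel. norm (\<eta> x *\<^sub>R f x) \<le> norm (B * norm (f x))"
      using le by (intro AE_I2) (metis abs_ge_self order_trans real_norm_def)
  qed measurable
  have "(\<integral>x. norm (\<eta> x *\<^sub>R f x) \<partial>lborel) \<le> (\<integral>x. B * norm (f x) \<partial>lborel)"
    by (intro integral_mono integrable_norm[OF 1] integrable_mult_right integrable_norm[OF f] le)
  then show "(\<integral>x. norm (\<eta> x *\<^sub>R f x) \<partial>lborel) \<le> B * (\<integral>x. norm (f x) \<partial>lborel)" by simp
qed

lemma bounded_scale_integrable:
  fixes f :: "'a::euclidean_space \<Rightarrow> real" and E :: "'a \<Rightarrow> 'b::euclidean_space"
  assumes f: "integrable lborel f" and [measurable]: "E \<in> borel_measurable borel" and B: "\<And>x. norm (E x) \<le> B"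
  shows "integrable lborel (\<lambda>x. f x *\<^sub>R E x)" "(\<integral>x. norm (f x *\<^sub>R E x) \<partial>lborel) \<le> B * (\<integral>x. norm (f x) \<partial>lborel)"
proof -
  have [measurable]: "f \<in> borel_measurable borel" using f by simp
  have le: "norm (f x *\<^sub>R E x) \<le> B * norm (f x)" for x
    using mult_left_mono[OF B[of x], of "\<bar>f x\<bar>"] by (simp add: mult.commute)
  show 1: "integrable lborel (\<lambda>x. f x *\<^sub>R E x)"
  proof (rule Bochner_Integration.integrable_bound)
    show "integrable lborel (\<lambda>x. B * norm (f x))" using f by simp
    show "AE x in lborel. norm (f x *\<^sub>R E x) \<le> norm (B * norm (f x))"
      using le by (intro AE_I2) (metis abs_ge_self order_trans real_norm_def)
  qed measurable
  have "(\<integral>x. norm (f x *\<^sub>R E x) \<partial>lborel) \<le> (\<integral>x. B * norm (f x) \<partial>lborel)"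
    by (intro integral_mono integrable_norm[OF 1] integrable_mult_right integrable_norm[OF f] le)
  then show "(\<integral>x. norm (f x *\<^sub>R E x) \<partial>lborel) \<le> B * (\<integral>x. norm (f x) \<partial>lborel)" by simp
qed

text \<open>The product rule passes to the limit because multiplication by the bounded
  \<open>\<eta>\<close> and \<open>E\<close> is continuous in \<open>L^1\<close>.\<close>

lemma sobolev_zero_mult:
  assumes s: "sobolev_zero \<Omega> \<phi> g" and \<eta>: "has_grad \<eta> E" and B: "\<And>x. \<bar>\<eta> x\<bar> \<le> B" "\<And>x. norm (E x) \<le> B"
  shows "sobolev_zero \<Omega> (\<lambda>x. \<eta> x * \<phi> x) (\<lambda>x. \<eta> x *\<^sub>R g x + \<phi> x *\<^sub>R E x)"
  unfolding sobolev_zero_def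
proof (intro conjI allI impI)
  note i = sobolev_zeroD(1,2)[OF s]
  note [measurable] = has_gradD(4,5)[OF \<eta>]
  have B0: "B \<ge> 0" using B(2)[of undefined] norm_ge_zero order_trans by blast
  note b1 = bounded_mult_integrable[OF _ has_gradD(5)[OF \<eta>] B(1)]
  note b2 = bounded_scale_integrable[OF _ has_gradD(4)[OF \<eta>] B(2)]
  show "integrable lborel (\<lambda>x. \<eta> x * \<phi> x)" using b1(1)[OF i(1)] by simp
  show "integrable lborel (\<lambda>x. \<eta> x *\<^sub>R g x + \<phi> x *\<^sub>R E x)"
    by (intro Bochner_Integration.integrable_add b1 b2 i)
  fix \<epsilon> :: real assume "\<epsilon> > 0"
  \<comment> \<open>The gradient error is at most \<open>2 * B * e\<close>; the summand 1 makes this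
    strictly smaller than \<open>\<epsilon>\<close>, also when \<open>B = 0\<close>.\<close>
  define e where "e = \<epsilon> / (2 * B + 1)"
  have e: "e > 0" "B * e < \<epsilon>" "B * e + B * e < \<epsilon>"
  proof -
    show "e > 0" using \<open>\<epsilon> > 0\<close> B0 by (simp add: e_def)
    have "(2 * B + 1) * e = \<epsilon>" using B0 by (simp add: e_def)
    then show "B * e + B * e < \<epsilon>" using \<open>e > 0\<close> by (simp add: algebra_simps)
    then show "B * e < \<epsilon>" using mult_nonneg_nonneg[OF B0 less_imp_le[OF \<open>e > 0\<close>]] by linarith
  qed
  from sobolev_zeroD(3)[OF s e(1)] obtain \<psi> D where
    \<psi>: "C1c \<Omega> \<psi> D" "(\<integral>x. \<bar>\<phi> x - \<psi> x\<bar> \<partial>lborel) < e" "(\<integral>x. norm (g x - D x) \<partial>lborel) < e" by blast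
  note C = C1cD[OF \<psi>(1)]
  have d: "integrable lborel (\<lambda>x. \<phi> x - \<psi> x)" "integrable lborel (\<lambda>x. g x - D x)"
    by (intro Bochner_Integration.integrable_diff i C)+
  have "C1c \<Omega> (\<lambda>x. \<eta> x * \<psi> x) (\<lambda>x. \<eta> x *\<^sub>R D x + \<psi> x *\<^sub>R E x)"
    by (rule C1c_shrink[OF \<psi>(1) has_grad_mult[OF C(1) \<eta>]]) simp
  moreover have "(\<integral>x. \<bar>\<eta> x * \<phi> x - \<eta> x * \<psi> x\<bar> \<partial>lborel) < \<epsilon>"
  proof -
    have "(\<integral>x. \<bar>\<eta> x * \<phi> x - \<eta> x * \<psi> x\<bar> \<partial>lborel) = (\<integral>x. norm (\<eta> x *\<^sub>R (\<phi> x - \<psi> x)) \<partial>lborel)"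
      by (simp add: right_diff_distrib)
    also have "\<dots> \<le> B * (\<integral>x. norm (\<phi> x - \<psi> x) \<partial>lborel)" by (rule b1(2)[OF d(1)])
    also have "\<dots> \<le> B * e" using \<psi>(2) B0 by (intro mult_left_mono) auto
    finally show ?thesis using e by simp
  qed
  moreover have "(\<integral>x. norm ((\<eta> x *\<^sub>R g x + \<phi> x *\<^sub>R E x) - (\<eta> x *\<^sub>R D x + \<psi> x *\<^sub>R E x)) \<partial>lborel) < \<epsilon>"
  proof -
    have i': "integrable lborel (\<lambda>x. \<eta> x *\<^sub>R (g x - D x))" "integrable lborel (\<lambda>x. (\<phi> x - \<psi> x) *\<^sub>R E x)"
      by (rule b1(1)[OF d(2)], rule b2(1)[OF d(1)])
    have eq: "(\<eta> x *\<^sub>R g x + \<phi> x *\<^sub>R E x) - (\<eta> x *\<^sub>R D x + \<psi> x *\<^sub>R E x) = \<eta> x *\<^sub>R (g x - D x) + (\<phi> x - \<psi> x) *\<^sub>R E x" for x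
      by (simp add: algebra_simps)
    have "(\<integral>x. norm ((\<eta> x *\<^sub>R g x + \<phi> x *\<^sub>R E x) - (\<eta> x *\<^sub>R D x + \<psi> x *\<^sub>R E x)) \<partial>lborel) \<le>
       (\<integral>x. norm (\<eta> x *\<^sub>R (g x - D x)) + norm ((\<phi> x - \<psi> x) *\<^sub>R E x) \<partial>lborel)"
      unfolding eq
      by (intro integral_mono integrable_norm Bochner_Integration.integrable_add i' norm_triangle_ineq)
    also have "\<dots> = (\<integral>x. norm (\<eta> x *\<^sub>R (g x - D x)) \<partial>lborel) + (\<integral>x. norm ((\<phi> x - \<psi> x) *\<^sub>R E x) \<partial>lborel)"
      by (intro Bochner_Integration.integral_add integrable_norm i')
    also have "\<dots> \<le> B * (\<integral>x. norm (g x - D x) \<partial>lborel) + B * (\<integral>x. norm (\<phi> x - \<psi> x) \<partial>lborel)"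
      by (intro add_mono b1(2)[OF d(2)] b2(2)[OF d(1)])
    also have "\<dots> \<le> B * e + B * e" using \<psi> B0 by (intro add_mono mult_left_mono) auto
    finally show ?thesis using e by simp
  qed
  ultimately show "\<exists>\<psi> D. C1c \<Omega> \<psi> D \<and> (\<integral>x. \<bar>\<eta> x * \<phi> x - \<psi> x\<bar> \<partial>lborel) < \<epsilon> \<and>
      (\<integral>x. norm ((\<eta> x *\<^sub>R g x + \<phi> x *\<^sub>R E x) - D x) \<partial>lborel) < \<epsilon>"
    by blast
qed

lemma conv_norm_le:
  fixes f :: "'a::euclidean_space \<Rightarrow> 'b::euclidean_space"
  assumes f: "integrable lborel f" and k: "continuous_on UNIV k" and B: "\<And>x. \<bar>k x\<bar> \<le> B"
  shows "norm (conv k f x) \<le> B * (\<integral>y. norm (f y) \<partial>lborel)"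
proof -
  have [measurable]: "k \<in> borel_measurable borel" using k by (rule borel_measurable_continuous_onI)
  have "norm (conv k f x) \<le> (\<integral>y. norm (k (x - y) *\<^sub>R f y) \<partial>lborel)"
    unfolding conv_def by (rule integral_norm_bound)
  also have "\<dots> \<le> B * (\<integral>y. norm (f y) \<partial>lborel)"
    by (rule bounded_mult_integrable(2)[OF f]) (use B in auto)
  finally show ?thesis .
qed

text \<open>The identity holds for \<open>C^1\<close> approximants by \<open>conv_grad_swap\<close>.
  It passes to the limit pointwise, since convolution with a bounded kernel maps \<open>L^1\<close>
  continuously into bounded functions. Zero boundary values are what makes it true for the extension
  by zero, at points near the boundary as well.\<close>

lemma sobolev_zero_grad_conv:
  assumes s: "sobolev_zero \<Omega> \<phi> g" and k: "smooth k" "bounded_support k"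
  shows "conv (\<lambda>x. grad k x \<bullet> b) \<phi> x = conv k g x \<bullet> b" "grad (conv k \<phi>) x = conv k g x"
proof -
  note i = sobolev_zeroD(1,2)[OF s]
  note kg = smooth_has_grad[OF k(1)]
  have kc: "continuous_on UNIV k" by (rule has_gradD(3)[OF kg])
  have *: "conv (\<lambda>x. grad k x \<bullet> b) \<phi> x = conv k g x \<bullet> b" for b
  proof -
    have Kc: "continuous_on UNIV (\<lambda>x. grad k x \<bullet> b)" by (intro continuous_intros has_gradD(2)[OF kg])
    have Ks: "bounded_support (\<lambda>x. grad k x \<bullet> b)"
      using has_grad_bdd_supp[OF kg k(2)] unfolding bounded_support_def by (metis inner_zero_left)
    obtain B1 where B1: "B1 > 0" "\<And>x. norm (k x) \<le> B1" using continuous_bdd_supp_bounded[OF kc k(2)] by metis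
    obtain B2 where B2: "B2 > 0" "\<And>x. norm (grad k x \<bullet> b) \<le> B2" using continuous_bdd_supp_bounded[OF Kc Ks] by metis
    have gb: "conv k g x \<bullet> b = conv k (\<lambda>x. g x \<bullet> b) x" by (rule conv_inner[OF i(2) kc k(2)])
    have "\<bar>conv (\<lambda>x. grad k x \<bullet> b) \<phi> x - conv k g x \<bullet> b\<bar> \<le> e" if "e > 0" for e
    proof -
      \<comment> \<open>The approximation error enters once through the gradient of the kernel,
        bounded by \<open>B2\<close>, and once through the kernel, bounded by \<open>B1\<close>;
        with this \<open>d\<close> both together amount to \<open>e\<close>.\<close>
      define d where "d = e / (B2 + B1 * norm b)"
      have den: "B2 + B1 * norm b > 0" using B1 B2 by (simp add: add_pos_nonneg)
      have "(B2 + B1 * norm b) * d = e" using den by (simp add: d_def)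
      moreover have "d > 0" using den \<open>e > 0\<close> by (simp add: d_def)
      ultimately have d: "d > 0" "B2 * d + B1 * d * norm b = e" by (simp_all add: algebra_simps)
      from sobolev_zeroD(3)[OF s d(1)] obtain \<psi> D where
        \<psi>: "C1c \<Omega> \<psi> D" "(\<integral>x. \<bar>\<phi> x - \<psi> x\<bar> \<partial>lborel) < d" "(\<integral>x. norm (g x - D x) \<partial>lborel) < d" by blast
      note C = C1cD[OF \<psi>(1)]
      have "conv (\<lambda>x. grad k x \<bullet> b) \<psi> x = conv k (\<lambda>y. D y \<bullet> b) x"
        by (rule conv_grad_swap[OF C(1,2) kg])
      also have "\<dots> = conv k D x \<bullet> b" by (rule conv_inner[OF C(4) kc k(2), symmetric])
      finally have eq: "conv (\<lambda>x. grad k x \<bullet> b) \<psi> x = conv k D x \<bullet> b" .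
      have d': "integrable lborel (\<lambda>x. \<phi> x - \<psi> x)" "integrable lborel (\<lambda>x. g x - D x)"
        by (intro Bochner_Integration.integrable_diff i C)+
      have "\<bar>conv (\<lambda>x. grad k x \<bullet> b) \<phi> x - conv (\<lambda>x. grad k x \<bullet> b) \<psi> x\<bar> \<le> B2 * (\<integral>x. norm (\<phi> x - \<psi> x) \<partial>lborel)"
        using conv_norm_le[OF d'(1) Kc, of B2 x] B2 conv_diff[OF i(1) C(3) Kc Ks, of x] by simp
      also have "\<dots> \<le> B2 * d" using \<psi>(2) B2 by (intro mult_left_mono) auto
      finally have 1: "\<bar>conv (\<lambda>x. grad k x \<bullet> b) \<phi> x - conv (\<lambda>x. grad k x \<bullet> b) \<psi> x\<bar> \<le> B2 * d" .
      have "norm (conv k g x - conv k D x) \<le> B1 * (\<integral>x. norm (g x - D x) \<partial>lborel)"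
        using conv_norm_le[OF d'(2) kc, of B1 x] B1 conv_diff[OF i(2) C(4) kc k(2), of x] by simp
      also have "\<dots> \<le> B1 * d" using \<psi>(3) B1 by (intro mult_left_mono) auto
      finally have "norm (conv k g x - conv k D x) * norm b \<le> B1 * d * norm b" by (rule mult_right_mono) simp
      moreover have "\<bar>(conv k g x - conv k D x) \<bullet> b\<bar> \<le> norm (conv k g x - conv k D x) * norm b"
        by (rule Cauchy_Schwarz_ineq2)
      ultimately have 2: "\<bar>conv k g x \<bullet> b - conv k D x \<bullet> b\<bar> \<le> B1 * d * norm b"
        by (simp add: inner_diff_left)
      show ?thesis using 1 2 d(2) unfolding eq by linarith
    qed
    then have "\<bar>conv (\<lambda>x. grad k x \<bullet> b) \<phi> x - conv k g x \<bullet> b\<bar> \<le> 0"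
      by (rule field_le_epsilon) simp
    then show ?thesis by simp
  qed
  then show "conv (\<lambda>x. grad k x \<bullet> b) \<phi> x = conv k g x \<bullet> b" .
  have sm: "smooth (conv k \<phi>)" by (rule conv_smooth[OF i(1) k])
  have "(conv k \<phi> has_derivative (\<lambda>h. conv (\<lambda>x. grad k x \<bullet> h) \<phi> x)) (at x)"
    by (rule conv_has_derivative[OF i(1) kg k(2)])
  then have "frechet_derivative (conv k \<phi>) (at x) = (\<lambda>h. conv k g x \<bullet> h)"
    using frechet_derivative_at by (simp add: *) fastforce
  then show "grad (conv k \<phi>) x = conv k g x"
    by (simp add: grad_def euclidean_representation)
qed

section \<open>Sup bounds for mollified gradients\<close>

lemma scaled_bump_bdd_supp: "is_bump \<rho> \<Longrightarrow> \<delta> > 0 \<Longrightarrow> bounded_support (scaled_bump \<rho> \<delta> v)"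
  using mollifierD(5)[OF scaled_bump_mollifier] .

lemma has_grad_unique:
  assumes "has_grad f D" "has_grad f D'"
  shows "D = D'"
proof
  fix x
  have "(\<lambda>h. D x \<bullet> h) = (\<lambda>h. D' x \<bullet> h)"
    by (rule has_derivative_unique[OF has_gradD(1)[OF assms(1)] has_gradD(1)[OF assms(2)]])
  then show "D x = D' x" by (metis inner_commute vector_eq_ldot)
qed

lemma grad_scaled_bump:
  fixes \<rho> :: "'a::euclidean_space \<Rightarrow> real"
  assumes "smooth \<rho>"
  shows "grad (scaled_bump \<rho> \<delta> v) x = (inverse (\<delta> ^ DIM('a)) * inverse \<delta>) *\<^sub>R grad \<rho> (inverse \<delta> *\<^sub>R x + - v)"
proof -
  note g = smooth_has_grad[OF assms]
  have "has_grad (scaled_bump \<rho> \<delta> v) (\<lambda>x. (inverse (\<delta> ^ DIM('a)) * inverse \<delta>) *\<^sub>R grad \<rho> (inverse \<delta> *\<^sub>R x + - v))"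
    unfolding has_grad_def
  proof (intro conjI allI)
    fix x
    have "((\<lambda>x. inverse \<delta> *\<^sub>R x + - v) has_derivative (\<lambda>h. inverse \<delta> *\<^sub>R h)) (at x)"
      by (auto intro!: derivative_eq_intros)
    from has_derivative_mult_right[OF has_derivative_compose[OF this has_gradD(1)[OF g]], of "inverse (\<delta> ^ DIM('a))"]
    show "(scaled_bump \<rho> \<delta> v has_derivative (\<lambda>h. (inverse (\<delta> ^ DIM('a)) * inverse \<delta>) *\<^sub>R grad \<rho> (inverse \<delta> *\<^sub>R x + - v) \<bullet> h)) (at x)"
      unfolding scaled_bump_def[abs_def] by (simp add: mult.assoc)
    show "continuous_on UNIV (\<lambda>x. (inverse (\<delta> ^ DIM('a)) * inverse \<delta>) *\<^sub>R grad \<rho> (inverse \<delta> *\<^sub>R x + - v))"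
      by (intro continuous_intros continuous_on_compose2[OF has_gradD(2)[OF g, of UNIV]]) auto
  qed
  from has_grad_unique[OF smooth_has_grad[OF scaled_bump_smooth[OF assms]] this] show ?thesis by (rule fun_cong)
qed

text \<open>The derivative is moved to the kernel. The \<open>L^1\<close> norm of the kernel's
  gradient scales like \<open>1 / \<delta>\<close>: a factor \<open>\<delta> ^ (- n - 1)\<close>
  from differentiation and normalisation, and \<open>\<delta> ^ n\<close> from the change of
  variables.\<close>

lemma conv_scaled_bump_bound_bounded:
  fixes \<phi> :: "'a::euclidean_space \<Rightarrow> real"
  assumes s: "sobolev_zero \<Omega> \<phi> g" and \<rho>: "is_bump \<rho>" and M: "\<And>x. \<bar>\<phi> x\<bar> \<le> M"
  obtains M' where "M' \<ge> 0" "\<And>\<delta> x. 0 < \<delta> \<Longrightarrow> norm (conv (scaled_bump \<rho> \<delta> v) g x) \<le> M' * \<delta> powr (- 1)"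
proof -
  have \<rho>s: "smooth \<rho>" using \<rho> by (simp add: is_bump_def)
  note g = smooth_has_grad[OF \<rho>s]
  have M0: "M \<ge> 0" using M[of undefined] abs_ge_zero order_trans by blast
  define J where "J b = (\<integral>x. \<bar>grad \<rho> x \<bullet> b\<bar> \<partial>lborel)" for b
  have J0: "J b \<ge> 0" for b unfolding J_def by (intro integral_nonneg_AE) auto
  note [measurable] = has_gradD(4)[OF g] borel_measurable_integrable[OF sobolev_zeroD(1)[OF s], simplified]
  show thesis
  proof
    show "M * (\<Sum>b\<in>Basis. J b) \<ge> 0" using M0 J0 by (intro mult_nonneg_nonneg sum_nonneg) auto
    fix \<delta> :: real and x assume \<delta>: "0 < \<delta>"
    define k where "k = scaled_bump \<rho> \<delta> v"
    have k: "smooth k" "bounded_support k" unfolding k_def by (intro scaled_bump_smooth \<rho>s) (rule scaled_bump_bdd_supp[OF \<rho> \<delta>])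
    note kg = smooth_has_grad[OF k(1)]
    note [measurable] = has_gradD(4)[OF kg]
    have comp: "\<bar>conv k g x \<bullet> b\<bar> \<le> M * (J b * inverse \<delta>)" for b
    proof -
      have Kc: "continuous_on UNIV (\<lambda>x. grad k x \<bullet> b)" by (intro continuous_intros has_gradD(2)[OF kg])
      have Ks: "bounded_support (\<lambda>x. grad k x \<bullet> b)"
        using has_grad_bdd_supp[OF kg k(2)] unfolding bounded_support_def by (metis inner_zero_left)
      have iK: "integrable lborel (\<lambda>y. \<bar>grad k y \<bullet> b\<bar>)"
        by (intro integrable_abs continuous_bdd_supp_integrable Kc Ks)
      have m: "(\<lambda>y. \<bar>grad k y \<bullet> b\<bar>) \<in> borel_measurable borel" by measurable
      have "(\<integral>y. \<bar>grad k y \<bullet> b\<bar> \<partial>lborel) =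
          (\<integral>y. inverse (\<delta> ^ DIM('a)) * inverse \<delta> * \<bar>grad \<rho> (- v + inverse \<delta> *\<^sub>R y) \<bullet> b\<bar> \<partial>lborel)"
        unfolding k_def grad_scaled_bump[OF \<rho>s] using \<delta> by (simp add: abs_mult add.commute)
      also have "\<dots> = inverse (\<delta> ^ DIM('a)) * inverse \<delta> * (\<integral>y. \<bar>grad \<rho> (- v + inverse \<delta> *\<^sub>R y) \<bullet> b\<bar> \<partial>lborel)"
        by simp
      also have "(\<integral>y. \<bar>grad \<rho> (- v + inverse \<delta> *\<^sub>R y) \<bullet> b\<bar> \<partial>lborel) = \<delta> ^ DIM('a) * J b"
        using lborel_integral_affine[of "\<lambda>y. \<bar>grad \<rho> y \<bullet> b\<bar>" "inverse \<delta>" "- v"] \<delta>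
        by (simp add: J_def power_inverse)
      finally have gk: "(\<integral>y. \<bar>grad k y \<bullet> b\<bar> \<partial>lborel) = J b * inverse \<delta>" using \<delta> by simp
      have "\<bar>conv k g x \<bullet> b\<bar> = \<bar>conv (\<lambda>x. grad k x \<bullet> b) \<phi> x\<bar>" using sobolev_zero_grad_conv(1)[OF s k] by simp
      also have "\<dots> \<le> (\<integral>y. \<bar>(grad k (x - y) \<bullet> b) * \<phi> y\<bar> \<partial>lborel)"
        unfolding conv_def real_scaleR_def by (rule integral_abs_bound)
      also have "\<dots> \<le> (\<integral>y. M * \<bar>grad k (x - y) \<bullet> b\<bar> \<partial>lborel)"
      proof (rule integral_mono')
        show "integrable lborel (\<lambda>y. M * \<bar>grad k (x - y) \<bullet> b\<bar>)"
          using iffD2[OF integrable_reflect[OF m, of x] iK] by simp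
        show "\<bar>(grad k (x - y) \<bullet> b) * \<phi> y\<bar> \<le> M * \<bar>grad k (x - y) \<bullet> b\<bar>" for y
          using mult_left_mono[OF M[of y], of "\<bar>grad k (x - y) \<bullet> b\<bar>"] by (simp add: abs_mult mult.commute)
        show "0 \<le> M * \<bar>grad k (x - y) \<bullet> b\<bar>" for y using M0 by simp
      qed
      also have "\<dots> = M * (\<integral>y. \<bar>grad k y \<bullet> b\<bar> \<partial>lborel)" using integral_reflect[OF m, of x] by simp
      finally show ?thesis by (simp add: gk)
    qed
    have "norm (conv k g x) \<le> (\<Sum>b\<in>Basis. \<bar>conv k g x \<bullet> b\<bar>)" by (rule norm_le_l1)
    also have "\<dots> \<le> (\<Sum>b\<in>Basis. M * (J b * inverse \<delta>))" by (intro sum_mono comp)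
    also have "\<dots> = M * (\<Sum>b\<in>Basis. J b) * \<delta> powr (- 1)"
      using \<delta> by (simp add: sum_distrib_left sum_distrib_right powr_minus mult.assoc)
    finally show "norm (conv (scaled_bump \<rho> \<delta> v) g x) \<le> M * (\<Sum>b\<in>Basis. J b) * \<delta> powr (- 1)" by (simp add: k_def)
  qed
qed

text \<open>Jensen for the probability density \<open>k\<close> moves the power \<open>p\<close>
  inside, the sup of the kernel is of order \<open>\<delta> ^ (- n)\<close>, and the
  \<open>p\<close>-th root gives the exponent \<open>- n / p\<close>.\<close>

lemma conv_scaled_bump_bound_Lp:
  fixes g :: "'a::euclidean_space \<Rightarrow> 'b::euclidean_space"
  assumes g: "integrable lborel g" and \<rho>: "is_bump \<rho>" and p: "p \<ge> 1" and gp: "integrable lborel (\<lambda>x. norm (g x) powr p)"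
  obtains M' where "M' \<ge> 0" "\<And>\<delta> x. 0 < \<delta> \<Longrightarrow> norm (conv (scaled_bump \<rho> \<delta> v) g x) \<le> M' * \<delta> powr (- (DIM('a) / p))"
proof -
  have \<rho>s: "smooth \<rho>" using \<rho> by (simp add: is_bump_def)
  have "bounded_support \<rho>" using \<rho> by (auto simp: is_bump_def bounded_support_def intro!: exI[of _ 1] less_imp_le)
  then obtain B where B: "B > 0" "\<And>x. norm (\<rho> x) \<le> B"
    using continuous_bdd_supp_bounded[OF smooth_continuous[OF \<rho>s]] by metis
  define J where "J = (\<integral>x. norm (g x) powr p \<partial>lborel)"
  have J0: "J \<ge> 0" unfolding J_def by (intro integral_nonneg_AE) auto
  show thesis
  proof
    show "(B * J) powr (1 / p) \<ge> 0" by simp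
    fix \<delta> :: real and x assume \<delta>: "0 < \<delta>"
    define k where "k = scaled_bump \<rho> \<delta> v"
    have k: "mollifier (\<delta> * (norm v + 1)) k" unfolding k_def by (rule scaled_bump_mollifier[OF \<rho> \<delta>])
    note kD = mollifierD[OF k]
    have w: "integrable lborel (\<lambda>y. k (x - y))" "(\<integral>y. k (x - y) \<partial>lborel) = 1"
      using integrable_reflect[OF kD(7), of x] integral_reflect[OF kD(7), of x] kD(3,6) by auto
    have ik: "integrable lborel (\<lambda>y. k (x - y) * f y)" if "integrable lborel f" for f :: "'a \<Rightarrow> real"
      using integrable_kernel_mult[OF that kD(1,5), of x] by simp
    have "norm (conv k g x) \<le> (\<integral>y. k (x - y) * norm (g y) \<partial>lborel)"
      using integral_norm_bound[of lborel "\<lambda>y. k (x - y) *\<^sub>R g y"] kD(2) by (simp add: conv_def)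
    then have "norm (conv k g x) powr p \<le> (\<integral>y. k (x - y) * norm (g y) \<partial>lborel) powr p"
      using p by (intro powr_mono2) auto
    also have "\<dots> \<le> (\<integral>y. k (x - y) * norm (g y) powr p \<partial>lborel)"
      by (rule powr_jensen[OF p kD(2) w norm_ge_zero ik[OF integrable_norm[OF g]] ik[OF gp]])
    also have "\<dots> = conv k (\<lambda>y. norm (g y) powr p) x" by (simp add: conv_def)
    also have "\<dots> \<le> norm (conv k (\<lambda>y. norm (g y) powr p) x)" by simp
    also have "\<dots> \<le> (inverse (\<delta> ^ DIM('a)) * B) * (\<integral>y. norm (norm (g y) powr p) \<partial>lborel)"
    proof (rule conv_norm_le[OF gp kD(1)])
      show "\<bar>k x\<bar> \<le> inverse (\<delta> ^ DIM('a)) * B" for x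
        unfolding k_def scaled_bump_def using B(2) \<delta> by (simp add: abs_mult mult_left_mono)
    qed
    also have "\<dots> = (B * J) * \<delta> powr (- DIM('a))"
      using \<delta> by (simp add: J_def powr_minus powr_realpow)
    finally have "(norm (conv k g x) powr p) powr (1 / p) \<le> ((B * J) * \<delta> powr (- DIM('a))) powr (1 / p)"
      using p by (intro powr_mono2) auto
    also have "\<dots> = (B * J) powr (1 / p) * \<delta> powr (- (DIM('a) / p))"
      by (simp add: powr_mult powr_powr)
    finally show "norm (conv (scaled_bump \<rho> \<delta> v) g x) \<le> (B * J) powr (1 / p) * \<delta> powr (- (DIM('a) / p))"
      using p by (simp add: powr_powr k_def)
  qed
qed

subsection \<open>Localisation in Lipschitz domains\<close>

text \<open>Supplies, near each point of the closure, a direction \<open>v\<close> such that adding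
  any vector from the support of the shifted bump moves \<open>\<Omega>\<close> into a compact
  subset of itself. This makes the mollification of a localised piece a test function.\<close>

lemma lipschitz_domain_shift:
  fixes \<Omega> :: "'a::euclidean_space set"
  assumes \<Omega>: "bounded_lipschitz_domain \<Omega>" and z: "z \<in> closure \<Omega>"
  shows "\<exists>r>0. \<exists>v. \<exists>\<delta>\<^sub>0>0. \<forall>\<delta>. 0 < \<delta> \<and> \<delta> < \<delta>\<^sub>0 \<longrightarrow>
    (\<exists>K. compact K \<and> K \<subseteq> \<Omega> \<and> (\<forall>x\<in>\<Omega> \<inter> cball z r. \<forall>y. norm (y - \<delta> *\<^sub>R v) < \<delta> \<longrightarrow> x + y \<in> K))"
proof (cases "z \<in> \<Omega>")
  case True
  have "open \<Omega>" using \<Omega> by (simp add: bounded_lipschitz_domain_def)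
  then obtain e where e: "e > 0" "cball z e \<subseteq> \<Omega>" using True open_contains_cball by blast
  \<comment> \<open>In the interior no shift is required: \<open>v = 0\<close>, and half of the
    radius is left for the smoothing.\<close>
  have "x + y \<in> cball z e" if "x \<in> \<Omega> \<inter> cball z (e / 2)" "norm (y - \<delta> *\<^sub>R 0) < \<delta>" "\<delta> < e / 2" for x y \<delta>
  proof -
    have "norm (z - (x + y)) \<le> norm (z - x) + norm y"
      using norm_triangle_ineq4[of "z - x" y] by (simp add: diff_diff_eq)
    then show ?thesis using that by (simp add: dist_norm)
  qed
  then show ?thesis using e
    by (intro exI[of _ "e / 2"] exI[of _ 0] conjI allI impI exI[of _ "cball z e"]) auto
next
  case False
  have "open \<Omega>" using \<Omega> by (simp add: bounded_lipschitz_domain_def)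
  then have "z \<in> frontier \<Omega>" using False z by (simp add: frontier_def interior_open)
  then obtain r\<^sub>0 e \<gamma> L where r0: "r\<^sub>0 > 0" and e: "norm e = 1" and L: "lipschitz_on L {y. y \<bullet> e = 0} \<gamma>"
    and loc: "\<Omega> \<inter> ball z r\<^sub>0 = {x \<in> ball z r\<^sub>0. \<gamma> (x - (x \<bullet> e) *\<^sub>R e) < x \<bullet> e}"
    using \<Omega> unfolding bounded_lipschitz_domain_def lipschitz_boundary_def by blast
  have L0: "L \<ge> 0" using L by (rule lipschitz_on_nonneg)
  have ee: "e \<bullet> e = 1" using e by (simp add: dot_square_norm)
  \<comment> \<open>The orthogonal projection onto the hyperplane where \<open>\<gamma>\<close> is
    Lipschitz; boundary heights are compared through \<open>\<gamma> (P x)\<close>.\<close>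
  define P where "P x = x - (x \<bullet> e) *\<^sub>R e" for x
  have P: "P x \<bullet> e = 0" for x by (simp add: P_def inner_diff_left ee)
  \<comment> \<open>Displacements along \<open>e\<close> are invisible to \<open>P\<close>, so only
    the deviation of the shift from a multiple of \<open>e\<close> counts, and the multiple
    \<open>c\<close> is free.\<close>
  have P_diff: "norm (P x - P y) \<le> norm (x - y - c *\<^sub>R e)" for x y c
  proof -
    define w where "w = x - y - c *\<^sub>R e"
    have "P x - P y = w - (w \<bullet> e) *\<^sub>R e"
      by (simp add: P_def w_def inner_diff_left ee algebra_simps)
    moreover have "norm (w - (w \<bullet> e) *\<^sub>R e) \<le> norm w"
    proof (rule power2_le_imp_le)
      have "(norm (w - (w \<bullet> e) *\<^sub>R e))\<^sup>2 = (norm w)\<^sup>2 - (w \<bullet> e)\<^sup>2"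
        unfolding power2_norm_eq_inner by (simp add: inner_diff_left inner_diff_right ee inner_commute power2_eq_square)
      then show "(norm (w - (w \<bullet> e) *\<^sub>R e))\<^sup>2 \<le> (norm w)\<^sup>2" by simp
    qed simp
    ultimately show ?thesis by (simp add: w_def)
  qed
  have \<gamma>P: "\<gamma> (P x) \<le> \<gamma> (P y) + L * norm (x - y - c *\<^sub>R e)" for x y c
  proof -
    have "dist (\<gamma> (P x)) (\<gamma> (P y)) \<le> L * dist (P x) (P y)"
      by (rule lipschitz_onD[OF L]) (use P in auto)
    also have "\<dots> \<le> L * norm (x - y - c *\<^sub>R e)"
      using P_diff L0 by (intro mult_left_mono) (auto simp: dist_norm)
    finally show ?thesis by (simp add: dist_real_def)
  qed
  \<comment> \<open>The pieces live within \<open>r\<close> of \<open>z\<close>, their shifts within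
    \<open>2 * r\<close>, and both stay inside the ball of radius \<open>3 * r\<close> where the
    graph description holds. A displacement has length at most \<open>\<delta> * (L + 3)\<close>,
    hence the bound on \<open>\<delta>\<close>.\<close>
  define r where "r = r\<^sub>0 / 3"
  define \<delta>\<^sub>0 where "\<delta>\<^sub>0 = r / (L + 3)"
  have r: "r > 0" "r\<^sub>0 = 3 * r" using r0 by (auto simp: r_def)
  have \<delta>0: "\<delta>\<^sub>0 > 0" using r L0 by (simp add: \<delta>\<^sub>0_def)
  \<comment> \<open>A displacement within \<open>\<delta>\<close> of
    \<open>\<delta> *\<^sub>R v\<close> rises by at least \<open>(L + 1) * \<delta>\<close>, while
    the graph below it rises by at most \<open>L * \<delta>\<close>: a margin of
    \<open>\<delta>\<close> remains.\<close>
  define v where "v = (L + 2) *\<^sub>R e"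
  have cont: "continuous_on UNIV (\<lambda>x. \<gamma> (P x))"
    by (rule continuous_on_compose2[OF lipschitz_on_continuous_on[OF L]])
       (auto simp: P intro!: continuous_intros simp: P_def inner_diff_left ee)
  have "\<exists>K. compact K \<and> K \<subseteq> \<Omega> \<and> (\<forall>x\<in>\<Omega> \<inter> cball z r. \<forall>y. norm (y - \<delta> *\<^sub>R v) < \<delta> \<longrightarrow> x + y \<in> K)"
    if \<delta>: "0 < \<delta>" "\<delta> < \<delta>\<^sub>0" for \<delta>
  proof (intro exI conjI ballI allI impI)
    \<comment> \<open>The margin \<open>\<delta>\<close> turns the strict inequality defining
      \<open>\<Omega>\<close> into a closed condition, so compactness comes for free.\<close>
    define K where "K = cball z (2 * r) \<inter> {w. \<gamma> (P w) + \<delta> \<le> w \<bullet> e}"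
    show "compact K"
      unfolding K_def
      by (intro compact_Int_closed compact_cball closed_Collect_le continuous_intros cont)
    show "K \<subseteq> \<Omega>"
    proof
      fix w assume w: "w \<in> K"
      then have "w \<in> ball z r\<^sub>0" "\<gamma> (w - (w \<bullet> e) *\<^sub>R e) < w \<bullet> e"
        using r \<delta> by (auto simp: K_def P_def)
      then have "w \<in> \<Omega> \<inter> ball z r\<^sub>0" unfolding loc by simp
      then show "w \<in> \<Omega>" by simp
    qed
    fix x y assume x: "x \<in> \<Omega> \<inter> cball z r" and y: "norm (y - \<delta> *\<^sub>R v) < \<delta>"
    have yv: "norm (y - (\<delta> * (L + 2)) *\<^sub>R e) < \<delta>" using y by (simp add: v_def)
    have "x \<in> \<Omega> \<inter> ball z r\<^sub>0" using x r by auto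
    then have \<gamma>x: "\<gamma> (P x) < x \<bullet> e" unfolding loc P_def by simp
    have "\<gamma> (P (x + y)) \<le> \<gamma> (P x) + L * norm ((x + y) - x - (\<delta> * (L + 2)) *\<^sub>R e)" by (rule \<gamma>P)
    also have "L * norm ((x + y) - x - (\<delta> * (L + 2)) *\<^sub>R e) \<le> L * \<delta>"
      using yv L0 by (intro mult_left_mono) auto
    finally have 1: "\<gamma> (P (x + y)) \<le> \<gamma> (P x) + L * \<delta>" by simp
    have "\<bar>(y - (\<delta> * (L + 2)) *\<^sub>R e) \<bullet> e\<bar> \<le> norm (y - (\<delta> * (L + 2)) *\<^sub>R e) * norm e"
      by (rule Cauchy_Schwarz_ineq2)
    then have "\<bar>y \<bullet> e - \<delta> * (L + 2)\<bar> < \<delta>" using yv e by (simp add: inner_diff_left ee)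
    then have 2: "y \<bullet> e \<ge> L * \<delta> + \<delta>" by (simp add: algebra_simps)
    have "norm y \<le> norm ((\<delta> * (L + 2)) *\<^sub>R e) + norm (y - (\<delta> * (L + 2)) *\<^sub>R e)" by (rule norm_triangle_sub)
    also have "\<dots> \<le> \<delta> * (L + 2) + \<delta>" using yv e \<delta> L0 by simp
    also have "\<dots> = \<delta> * (L + 3)" by (simp add: algebra_simps)
    also have "\<dots> \<le> r" using \<delta>(2) L0 by (simp add: \<delta>\<^sub>0_def field_simps)
    finally have "norm y \<le> r" .
    moreover have "norm (z - (x + y)) \<le> norm (z - x) + norm y"
      using norm_triangle_ineq4[of "z - x" y] by (simp add: diff_diff_eq)
    ultimately have "x + y \<in> cball z (2 * r)" using x by (simp add: dist_norm)
    then show "x + y \<in> K" using 1 2 \<gamma>x by (simp add: K_def inner_add_left)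
  qed
  then show ?thesis using r(1) \<delta>0 by blast
qed

text \<open>Mollifying the indicators of a disjoint cover gives functions that sum to one without any division.\<close>

lemma smooth_partition:
  fixes X :: "'a::euclidean_space set"
  assumes X: "compact X" and r: "\<And>z. z \<in> X \<Longrightarrow> r z > 0"
  obtains m :: nat and c :: "nat \<Rightarrow> 'a" and \<eta> :: "nat \<Rightarrow> 'a \<Rightarrow> real"
  where "\<And>i. i < m \<Longrightarrow> c i \<in> X" "\<And>i. smooth (\<eta> i)" "\<And>i. bounded_support (\<eta> i)"
    "\<And>i x. i < m \<Longrightarrow> \<eta> i x \<noteq> 0 \<Longrightarrow> x \<in> cball (c i) (r (c i))"
    "\<And>x. x \<in> X \<Longrightarrow> (\<Sum>i<m. \<eta> i x) = 1"
proof -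
  have "\<exists>D\<subseteq>X. finite D \<and> X \<subseteq> (\<Union>z\<in>D. ball z (r z / 2))"
  proof (rule compactE_image[OF X])
    show "X \<subseteq> (\<Union>z\<in>X. ball z (r z / 2))" using r by force
  qed (auto intro: that)
  then obtain D where D: "D \<subseteq> X" "finite D" "X \<subseteq> (\<Union>z\<in>D. ball z (r z / 2))" by blast
  define m where "m = card D"
  obtain c where c: "bij_betw c {..<m} D"
    using ex_bij_betw_nat_finite[OF D(2)] by (auto simp: m_def atLeast0LessThan)
  have cX: "c i \<in> X" if "i < m" for i using c D(1) that by (auto simp: bij_betw_def)
  \<comment> \<open>Padding with empty sets gives a sequence to which \<open>disjointed\<close>
    applies, and makes every member bounded, also from index \<open>m\<close> on.\<close>
  define B where "B i = (if i < m then ball (c i) (r (c i) / 2) else {})" for i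
  have UB: "(\<Union>i<m. B i) = (\<Union>z\<in>D. ball z (r z / 2))"
    using c by (auto simp: B_def bij_betw_def)
  obtain e\<^sub>0 where e0: "e\<^sub>0 > 0" "(\<Union>x\<in>X. cball x e\<^sub>0) \<subseteq> (\<Union>i<m. B i)"
    by (rule compact_subset_open_imp_cball_epsilon_subset[OF X, of "\<Union>i<m. B i"]) (use D UB in \<open>auto simp: B_def\<close>)
  \<comment> \<open>Below half of each radius, the mollified piece stays in its ball; below
    \<open>e\<^sub>0\<close>, the kernel centred at a point of \<open>X\<close> sees only the
    covered region, which is why the sum is exactly 1.\<close>
  define e where "e = Min (insert e\<^sub>0 ((\<lambda>i. r (c i) / 2) ` {..<m}))"
  have e: "e > 0" "e \<le> e\<^sub>0" "\<And>i. i < m \<Longrightarrow> e \<le> r (c i) / 2"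
    unfolding e_def using e0(1) r cX by (auto intro: Min_le simp del: le_divide_eq_numeral1)
  define A where "A i = disjointed B i" for i
  have AB: "A i \<subseteq> B i" for i unfolding A_def by (rule disjointed_subset)
  have [measurable]: "A i \<in> sets borel" for i
    unfolding A_def disjointed_def B_def by auto
  have Abdd: "bounded (A i)" for i using AB by (rule bounded_subset[rotated]) (simp add: B_def)
  have Ai: "integrable lborel (indicator (A i) :: 'a \<Rightarrow> real)" for i
    using emeasure_bounded_finite[OF Abdd] by (intro integrable_real_indicator) auto
  obtain \<rho> :: "'a \<Rightarrow> real" where \<rho>: "is_bump \<rho>" using is_bump_ex by blast
  define k where "k = scaled_bump \<rho> e 0"
  have k: "mollifier e k" using scaled_bump_mollifier[OF \<rho> e(1), of 0] by (simp add: k_def)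
  note kD = mollifierD[OF k]
  have ks: "smooth k" using \<rho> by (simp add: k_def scaled_bump_smooth is_bump_def)
  define \<eta> where "\<eta> i = conv k (indicator (A i) :: 'a \<Rightarrow> real)" for i
  have supp: "\<exists>y\<in>A i. norm (x - y) \<le> e" if "\<eta> i x \<noteq> 0" for i x
    using conv_nonzero[of k _ x] that kD(4) unfolding \<eta>_def by (fastforce simp: indicator_eq_0_iff)
  show thesis
  proof
    show "c i \<in> X" if "i < m" for i by (rule cX[OF that])
    show "smooth (\<eta> i)" for i unfolding \<eta>_def by (rule conv_smooth[OF Ai ks kD(5)])
    show "bounded_support (\<eta> i)" for i
    proof -
      obtain R where R: "\<And>y. y \<in> A i \<Longrightarrow> norm y \<le> R" using Abdd[of i] by (auto simp: bounded_iff)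
      have "norm x \<le> R + e" if nz: "\<eta> i x \<noteq> 0" for x
      proof -
        obtain y where y: "y \<in> A i" "norm (x - y) \<le> e" using supp[OF nz] by blast
        then show ?thesis using R[OF y(1)] norm_triangle_sub[of x y] by linarith
      qed
      then show ?thesis by (auto simp: bounded_support_def)
    qed
    show "x \<in> cball (c i) (r (c i))" if i: "i < m" and nz: "\<eta> i x \<noteq> 0" for i x
    proof -
      obtain y where y: "y \<in> A i" "norm (x - y) \<le> e" using supp[OF nz] by blast
      then have "y \<in> ball (c i) (r (c i) / 2)" using AB[of i] i by (auto simp: B_def)
      moreover have "dist (c i) x \<le> dist (c i) y + dist y x" by (rule dist_triangle)
      ultimately show ?thesis using y(2) e(3)[OF i] by (simp add: dist_norm norm_minus_commute)
    qed
    show "(\<Sum>i<m. \<eta> i x) = 1" if x: "x \<in> X" for x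
    proof -
      have dis: "disjoint_family A" unfolding A_def by (rule disjoint_family_disjointed)
      have UA: "(\<Union>i<m. A i) = (\<Union>i<m. B i)"
        unfolding A_def atLeast0LessThan[symmetric] by (rule finite_UN_disjointed_eq)
      have sumA: "(\<Sum>i<m. indicator (A i) y) = (indicator (\<Union>i<m. B i) y :: real)" for y
        unfolding UA[symmetric]
        by (rule indicator_UN_disjoint[symmetric]) (use dis in \<open>auto simp: disjoint_family_on_def\<close>)
      have "(\<Sum>i<m. \<eta> i x) = (\<integral>y. (\<Sum>i<m. k (x - y) * indicator (A i) y) \<partial>lborel)"
        unfolding \<eta>_def conv_def real_scaleR_def
        using integrable_kernel_mult[OF Ai kD(1,5), of x] by (intro Bochner_Integration.integral_sum[symmetric]) auto
      also have "\<dots> = (\<integral>y. k (x - y) \<partial>lborel)"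
      proof (rule Bochner_Integration.integral_cong[OF refl])
        fix y
        have "y \<in> (\<Union>i<m. B i)" if "k (x - y) \<noteq> 0"
        proof -
          have "y \<in> cball x e\<^sub>0" using kD(4)[OF that] e(2) by (simp add: dist_norm)
          then show ?thesis using e0(2) x by blast
        qed
        then have "k (x - y) * (\<Sum>i<m. indicator (A i) y) = k (x - y)"
          unfolding sumA by (cases "k (x - y) = 0") auto
        then show "(\<Sum>i<m. k (x - y) * indicator (A i) y) = k (x - y)" by (simp add: sum_distrib_left)
      qed
      also have "\<dots> = 1" using integral_reflect[OF kD(7), of x] kD(3) by simp
      finally show ?thesis .
    qed
  qed
qed

text \<open>The gradients of the approximants vanish off \<open>\<Omega>\<close>, and this survives
  convergence in \<open>L^1\<close>.\<close>

lemma sobolev_zero_zero_outside: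
  assumes \<Omega>: "open \<Omega>" and s: "sobolev_zero \<Omega> \<phi> g"
  shows "AE x in lborel. x \<notin> \<Omega> \<longrightarrow> g x = 0"
proof -
  note i = sobolev_zeroD(1,2)[OF s]
  have [measurable]: "\<Omega> \<in> sets borel" using \<Omega> by simp
  have ig: "integrable lborel (\<lambda>x. indicator (- \<Omega>) x * norm (g x))"
    using integrable_mult_indicator[of "- \<Omega>" lborel "\<lambda>x. norm (g x)"] i by simp
  have "(\<integral>x. indicator (- \<Omega>) x * norm (g x) \<partial>lborel) \<le> e" if "e > 0" for e
  proof -
    from sobolev_zeroD(3)[OF s that] obtain \<psi> D where
      \<psi>: "C1c \<Omega> \<psi> D" "(\<integral>x. norm (g x - D x) \<partial>lborel) < e" by blast
    note C = C1cD[OF \<psi>(1)]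
    have D0: "D x = 0" if "x \<notin> \<Omega>" for x
      using has_grad_zero_outside[OF C(1), of x] \<psi>(1) that by (auto simp: C1c_def)
    have "(\<integral>x. indicator (- \<Omega>) x * norm (g x) \<partial>lborel) \<le> (\<integral>x. norm (g x - D x) \<partial>lborel)"
    proof (rule integral_mono[OF ig])
      show "integrable lborel (\<lambda>x. norm (g x - D x))"
        by (intro integrable_norm Bochner_Integration.integrable_diff i C)
      show "indicator (- \<Omega>) x * norm (g x) \<le> norm (g x - D x)" for x
        using D0[of x] by (auto simp: indicator_def)
    qed
    with \<psi>(2) show ?thesis by simp
  qed
  then have "(\<integral>x. indicator (- \<Omega>) x * norm (g x) \<partial>lborel) \<le> 0" by (rule field_le_epsilon) simp
  moreover have "(\<integral>x. indicator (- \<Omega>) x * norm (g x) \<partial>lborel) \<ge> 0" by (intro integral_nonneg_AE) auto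
  ultimately have "(\<integral>x. indicator (- \<Omega>) x * norm (g x) \<partial>lborel) = 0" by simp
  then have "AE x in lborel. indicator (- \<Omega>) x * norm (g x) = 0"
    using integral_nonneg_eq_0_iff_AE[OF ig] by auto
  then show ?thesis by eventually_elim (auto simp: indicator_def)
qed

subsection \<open>Approximation in energy\<close>

lemma test_functions_add:
  assumes "\<phi> \<in> test_functions \<Omega>" "\<psi> \<in> test_functions \<Omega>"
  shows "(\<lambda>x. \<phi> x + \<psi> x) \<in> test_functions \<Omega>" "grad (\<lambda>x. \<phi> x + \<psi> x) x = grad \<phi> x + grad \<psi> x"
proof -
  note D = test_functionD[OF assms(1)] and D' = test_functionD[OF assms(2)]
  have sm: "smooth (\<lambda>x. \<phi> x + \<psi> x)" using D(1) D'(1) by (simp add: smooth_def C_k_add)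
  show "(\<lambda>x. \<phi> x + \<psi> x) \<in> test_functions \<Omega>"
  proof (rule test_functionI[OF sm])
    show "compact (closure {x. \<phi> x \<noteq> 0} \<union> closure {x. \<psi> x \<noteq> 0})"
      "closure {x. \<phi> x \<noteq> 0} \<union> closure {x. \<psi> x \<noteq> 0} \<subseteq> \<Omega>"
      using assms unfolding test_functions_iff by blast+
    show "x \<in> closure {x. \<phi> x \<noteq> 0} \<union> closure {x. \<psi> x \<noteq> 0}" if "\<phi> x + \<psi> x \<noteq> 0" for x
      using that closure_subset[of "{x. \<phi> x \<noteq> 0}"] closure_subset[of "{x. \<psi> x \<noteq> 0}"]
      by (cases "\<phi> x = 0") auto
  qed
  have "has_grad (\<lambda>x. \<phi> x + \<psi> x) (\<lambda>x. grad \<phi> x + grad \<psi> x)"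
    unfolding has_grad_def inner_add_left
    by (intro conjI allI has_derivative_add continuous_intros has_gradD[OF D(3)] has_gradD[OF D'(3)])
  from has_grad_unique[OF smooth_has_grad[OF sm] this]
  show "grad (\<lambda>x. \<phi> x + \<psi> x) x = grad \<phi> x + grad \<psi> x" by (rule fun_cong)
qed

lemma zero_test_function: "(\<lambda>x. 0) \<in> test_functions \<Omega>" "grad (\<lambda>x. 0) x = 0"
  by (auto simp: test_functions_iff smooth_def C_k_const grad_def)

section \<open>The energy as a convex modular\<close>

lemma energy_finite_iff:
  assumes "a \<in> borel_measurable borel" "\<And>x. 0 \<le> a x" "g \<in> borel_measurable borel"
  shows "energy p q a g < \<infinity> \<longleftrightarrow> integrable lborel (integrand p q a g)"
proof -
  note [measurable] = assms(1,3)
  have "integrand p q a g \<in> borel_measurable lborel" by measurable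
  then show ?thesis
    using assms(2) by (simp add: energy_def integrable_iff_bounded integrand_nonneg)
qed

lemma energy_cong_AE: "AE x in lborel. g x = h x \<Longrightarrow> energy p q a g = energy p q a h"
  unfolding energy_def by (rule nn_integral_cong_AE) (auto simp: integrand_def)

lemma energy_add_le:
  fixes a :: "'a::euclidean_space \<Rightarrow> real" and g h :: "'a \<Rightarrow> 'b::euclidean_space"
  assumes pq: "1 \<le> p" "p \<le> q" and a: "a \<in> borel_measurable borel" "\<And>x. 0 \<le> a x"
    and [measurable]: "g \<in> borel_measurable borel" "h \<in> borel_measurable borel" and t: "0 < t" "t < 1"
  shows "energy p q a (\<lambda>x. g x + h x) \<le> ennreal ((1 - t) powr (1 - q)) * energy p q a g + ennreal (t powr (1 - q)) * energy p q a h"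
proof -
  note [measurable] = a(1)
  have "energy p q a (\<lambda>x. g x + h x) \<le>
    (\<integral>\<^sup>+x. ennreal ((1 - t) powr (1 - q)) * ennreal (integrand p q a g x) + ennreal (t powr (1 - q)) * ennreal (integrand p q a h x) \<partial>lborel)"
    unfolding energy_def
  proof (rule nn_integral_mono)
    fix x
    have "ennreal (integrand p q a (\<lambda>x. g x + h x) x) \<le>
        ennreal ((1 - t) powr (1 - q) * integrand p q a g x + t powr (1 - q) * integrand p q a h x)"
      by (intro ennreal_leI integrand_add_le pq a(2) t)
    also have "\<dots> = ennreal ((1 - t) powr (1 - q)) * ennreal (integrand p q a g x) + ennreal (t powr (1 - q)) * ennreal (integrand p q a h x)"
      using a(2) by (simp add: integrand_nonneg ennreal_plus ennreal_mult)
    finally show "ennreal (integrand p q a (\<lambda>x. g x + h x) x) \<le>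
        ennreal ((1 - t) powr (1 - q)) * ennreal (integrand p q a g x) + ennreal (t powr (1 - q)) * ennreal (integrand p q a h x)" .
  qed
  also have "\<dots> = ennreal ((1 - t) powr (1 - q)) * energy p q a g + ennreal (t powr (1 - q)) * energy p q a h"
    unfolding energy_def by (subst nn_integral_add) (auto simp: nn_integral_cmult)
  finally show ?thesis .
qed

lemma integrand_scale_le:
  assumes pq: "1 \<le> p" "p \<le> q" and a: "0 \<le> a x" and B: "\<bar>c x\<bar> \<le> B" "1 \<le> B"
  shows "integrand p q a (\<lambda>x. c x *\<^sub>R g x) x \<le> B powr q * integrand p q a g x"
proof -
  have 1: "norm (c x *\<^sub>R g x) powr r \<le> B powr q * norm (g x) powr r" if "0 \<le> r" "r \<le> q" for r
  proof -
    have "norm (c x *\<^sub>R g x) powr r = \<bar>c x\<bar> powr r * norm (g x) powr r"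
      by (simp add: powr_mult)
    also have "\<dots> \<le> B powr q * norm (g x) powr r"
    proof (rule mult_right_mono)
      have "\<bar>c x\<bar> powr r \<le> B powr r" using B that by (intro powr_mono2) auto
      also have "\<dots> \<le> B powr q" using B that by (intro powr_mono) auto
      finally show "\<bar>c x\<bar> powr r \<le> B powr q" .
    qed simp
    finally show ?thesis .
  qed
  have "a x * norm (c x *\<^sub>R g x) powr q \<le> a x * (B powr q * norm (g x) powr q)"
    by (rule mult_left_mono[OF 1 a]) (use pq in auto)
  then show ?thesis using 1[of p] pq unfolding integrand_def by (simp add: algebra_simps)
qed

text \<open>The weight is a Borel function on the whole space; \<open>S\<close> is \<open>\<Omega>\<close> without the null set on which it differs
  from the given weight, so the comparison holds there pointwise.\<close>

locale double_phase_weight =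
  fixes p q \<kappa> C :: real and a :: "'a::euclidean_space \<Rightarrow> real" and S \<Omega> :: "'a set"
  assumes p: "1 < p" and pq: "p \<le> q" and \<kappa>: "0 < \<kappa>" and C: "0 < C"
    and expo: "q \<le> p + \<kappa> * max (p / DIM('a)) 1"
    and a_meas [measurable]: "a \<in> borel_measurable borel" and a_nonneg: "\<And>x. 0 \<le> a x"
    and S: "S \<subseteq> \<Omega>" "AE x in lborel. x \<in> \<Omega> \<longrightarrow> x \<in> S"
    and a_compare: "\<And>x y. x \<in> S \<Longrightarrow> y \<in> S \<Longrightarrow> a x \<le> C * (a y + norm (x - y) powr \<kappa>)"
    and a_outside: "\<And>x. x \<notin> S \<Longrightarrow> a x = 0"
    and domain: "bounded_lipschitz_domain \<Omega>"
begin

lemma p': "1 \<le> p" using p by simp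

lemma open_\<Omega>: "open \<Omega>" and bounded_\<Omega>: "bounded \<Omega>"
  using domain by (auto simp: bounded_lipschitz_domain_def)

text \<open>Compare with one fixed point of \<open>S\<close> and use that \<open>\<Omega>\<close> is
  bounded. Consequently bounded fields of bounded support have finite energy, among them gradients
  of test functions and the product rule term \<open>\<phi> * grad \<eta>\<close>.\<close>

lemma a_bounded: obtains A where "A \<ge> 0" "\<And>x. a x \<le> A"
proof (cases "S = {}")
  case True
  then show thesis using that[of 0] a_outside by simp
next
  case False
  then obtain y where y: "y \<in> S" by blast
  obtain R where R: "\<And>x. x \<in> \<Omega> \<Longrightarrow> norm x \<le> R" using bounded_\<Omega> by (auto simp: bounded_iff)
  have "a x \<le> C * (a y + (R + R) powr \<kappa>)" for x
  proof (cases "x \<in> S")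
    case True
    have "x \<in> \<Omega>" "y \<in> \<Omega>" using True y S(1) by auto
    then have "norm (x - y) \<le> R + R"
      using norm_triangle_ineq4[of x y] R[of x] R[of y] by linarith
    then have "C * (a y + norm (x - y) powr \<kappa>) \<le> C * (a y + (R + R) powr \<kappa>)"
      using C \<kappa> by (intro mult_left_mono add_left_mono powr_mono2) auto
    then show ?thesis using a_compare[OF True y] by linarith
  next
    case False
    then show ?thesis using a_outside C a_nonneg[of y] by simp
  qed
  moreover have "0 \<le> C * (a y + (R + R) powr \<kappa>)" using C a_nonneg[of y] by simp
  ultimately show thesis using that by blast
qed

lemma integrable_dens_bounded:
  assumes [measurable]: "g \<in> borel_measurable borel" and B: "\<And>x. norm (g x) \<le> B" and R: "\<And>x. g x \<noteq> 0 \<Longrightarrow> norm x \<le> R"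
  shows "integrable lborel (integrand p q a g)"
proof -
  obtain A where A: "A \<ge> 0" "\<And>x. a x \<le> A" using a_bounded by metis
  define K where "K = B powr p + A * B powr q"
  have "integrable lborel (\<lambda>x. K * indicator (cball (0::'a) R) x)"
    by (intro integrable_mult_right integrable_indicator_cball)
  then show ?thesis
  proof (rule Bochner_Integration.integrable_bound)
    show "AE x in lborel. norm (integrand p q a g x) \<le> norm (K * indicator (cball 0 R) x)"
    proof (rule AE_I2)
      fix x
      show "norm (integrand p q a g x) \<le> norm (K * indicator (cball 0 R) x)"
      proof (cases "g x = 0")
        case False
        have "integrand p q a g x \<le> K"
          unfolding integrand_def K_def using A B a_nonneg p pq
          by (intro add_mono mult_mono powr_mono2) auto
        then show ?thesis using R[OF False] integrand_nonneg[of a x p q g] a_nonneg by auto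
      qed (use p pq in \<open>simp add: integrand_def\<close>)
    qed
  qed measurable
qed

text \<open>Only the gradient field is recorded, so sums, limits and changes on null sets can be
  treated without reference to the function it comes from.\<close>

definition approx :: "('a \<Rightarrow> 'a) \<Rightarrow> bool" where
  "approx g \<longleftrightarrow> (\<forall>\<epsilon>>0. \<exists>w\<in>test_functions \<Omega>. energy p q a (\<lambda>x. grad w x - g x) < \<epsilon>)"

lemma energy_half:
  fixes g h :: "'a \<Rightarrow> 'a"
  assumes "g \<in> borel_measurable borel" "h \<in> borel_measurable borel"
    and "energy p q a g \<le> ennreal e" "energy p q a h \<le> ennreal e" "e \<ge> 0"
  shows "energy p q a (\<lambda>x. g x + h x) \<le> ennreal (2 powr q * e)"
proof -
  have *: "((1::real) - 1/2) powr (1 - q) = 2 powr (q - 1)" "(1/2::real) powr (1 - q) = 2 powr (q - 1)"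
    using powr_minus[of "1/2::real" "q - 1"] powr_divide[of 1 "2::real" "q-1"] by simp_all
  have "energy p q a (\<lambda>x. g x + h x) \<le>
      ennreal ((1 - 1/2) powr (1 - q)) * energy p q a g + ennreal ((1/2) powr (1 - q)) * energy p q a h"
    by (intro energy_add_le p' pq a_meas a_nonneg assms) auto
  also have "\<dots> \<le> ennreal (2 powr (q - 1)) * ennreal e + ennreal (2 powr (q - 1)) * ennreal e"
    unfolding * by (intro add_mono mult_left_mono assms) auto
  also have "\<dots> = ennreal (2 powr q * e)"
    using assms(5) by (simp add: ennreal_mult[symmetric] ennreal_plus[symmetric] powr_diff del: ennreal_plus)
  finally show ?thesis .
qed

text \<open>The energy is not a norm. This replaces the triangle inequality whenever two
  approximation errors are added.\<close>

lemma energy_half_small: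
  assumes "\<epsilon> > (0 :: ennreal)"
  shows "\<exists>e>0. \<forall>g\<in>borel_measurable borel. \<forall>h::'a \<Rightarrow> 'a\<in>borel_measurable borel.
      energy p q a g < ennreal e \<longrightarrow> energy p q a h < ennreal e \<longrightarrow> energy p q a (\<lambda>x. g x + h x) < \<epsilon>"
proof -
  obtain e where e: "e > 0" "ennreal e \<le> \<epsilon>"
  proof (cases \<epsilon>)
    case (real e)
    then show thesis using assms that[of e] by auto
  next
    case top
    then show thesis using that[of 1] by simp
  qed
  \<comment> \<open>\<open>2 powr q\<close> is the factor of \<open>energy_half\<close>; the further
    2 makes the final inequality strict.\<close>
  define d where "d = e / (2 powr q * 2)"
  have d: "d > 0" "2 powr q * d < e" using e by (auto simp: d_def)
  have "energy p q a (\<lambda>x. g x + h x) < \<epsilon>"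
    if "g \<in> borel_measurable borel" "h \<in> borel_measurable borel"
      "energy p q a g < ennreal d" "energy p q a h < ennreal d" for g h :: "'a \<Rightarrow> 'a"
  proof -
    have "energy p q a (\<lambda>x. g x + h x) \<le> ennreal (2 powr q * d)"
      using that d by (intro energy_half) auto
    also have "\<dots> < ennreal e" using d e by (intro ennreal_lessI) auto
    finally show ?thesis using e(2) by simp
  qed
  with d(1) show ?thesis by blast
qed

lemma grad_test_measurable: "w \<in> test_functions \<Omega> \<Longrightarrow> grad w \<in> borel_measurable borel"
  using test_functionD(3) has_gradD(4) by blast

lemma approx_add:
  assumes [measurable]: "g \<in> borel_measurable borel" "h \<in> borel_measurable borel" and a: "approx g" "approx h"
  shows "approx (\<lambda>x. g x + h x)"
  unfolding approx_def
proof (intro allI impI)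
  fix \<epsilon> :: ennreal assume "\<epsilon> > 0"
  then obtain e where e: "e > 0" "\<forall>g\<in>borel_measurable borel. \<forall>h::'a \<Rightarrow> 'a\<in>borel_measurable borel.
      energy p q a g < ennreal e \<longrightarrow> energy p q a h < ennreal e \<longrightarrow> energy p q a (\<lambda>x. g x + h x) < \<epsilon>"
    using energy_half_small by blast
  have "ennreal e > 0" using e(1) by simp
  then obtain w1 w2 where w: "w1 \<in> test_functions \<Omega>" "w2 \<in> test_functions \<Omega>"
    "energy p q a (\<lambda>x. grad w1 x - g x) < ennreal e" "energy p q a (\<lambda>x. grad w2 x - h x) < ennreal e"
    using a unfolding approx_def by meson
  note [measurable] = grad_test_measurable[OF w(1)] grad_test_measurable[OF w(2)]
  have "energy p q a (\<lambda>x. (grad w1 x - g x) + (grad w2 x - h x)) < \<epsilon>"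
    by (rule e(2)[rule_format]) (use w in auto)
  moreover have "(\<lambda>x. (grad w1 x - g x) + (grad w2 x - h x)) = (\<lambda>x. grad (\<lambda>x. w1 x + w2 x) x - (g x + h x))"
    by (simp add: test_functions_add(2)[OF w(1,2)] algebra_simps)
  ultimately show "\<exists>w\<in>test_functions \<Omega>. energy p q a (\<lambda>x. grad w x - (g x + h x)) < \<epsilon>"
    using test_functions_add(1)[OF w(1,2)] by auto
qed

lemma approx_zero: "approx (\<lambda>x. 0)"
  unfolding approx_def
  using p pq by (auto simp: energy_def integrand_def zero_test_function intro!: bexI[of _ "\<lambda>x. 0"])

lemma approx_sum:
  assumes "finite I" "\<And>i. i \<in> I \<Longrightarrow> g i \<in> borel_measurable borel" "\<And>i. i \<in> I \<Longrightarrow> approx (g i)"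
  shows "approx (\<lambda>x. \<Sum>i\<in>I. g i x)"
  using assms
proof (induction I rule: finite_induct)
  case empty
  then show ?case by (simp add: approx_zero)
next
  case (insert i I)
  have "approx (\<lambda>x. g i x + (\<Sum>i\<in>I. g i x))"
    by (intro approx_add insert borel_measurable_sum) (use insert in auto)
  then show ?case using insert by simp
qed

lemma approx_cong_AE:
  assumes "approx g" "AE x in lborel. g x = h x"
  shows "approx h"
proof -
  have "energy p q a (\<lambda>x. grad w x - h x) = energy p q a (\<lambda>x. grad w x - g x)" for w
    by (rule energy_cong_AE) (use assms(2) in auto)
  then show ?thesis using assms(1) by (simp add: approx_def)
qed

lemma approx_limit:
  assumes [measurable]: "g \<in> borel_measurable borel"
    and "\<And>\<epsilon>. \<epsilon> > 0 \<Longrightarrow> \<exists>h\<in>borel_measurable borel. approx h \<and> energy p q a (\<lambda>x. h x - g x) < \<epsilon>"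
  shows "approx g"
  unfolding approx_def
proof (intro allI impI)
  fix \<epsilon> :: ennreal assume "\<epsilon> > 0"
  then obtain e where e: "e > 0" "\<forall>g\<in>borel_measurable borel. \<forall>h::'a \<Rightarrow> 'a\<in>borel_measurable borel.
      energy p q a g < ennreal e \<longrightarrow> energy p q a h < ennreal e \<longrightarrow> energy p q a (\<lambda>x. g x + h x) < \<epsilon>"
    using energy_half_small by blast
  have e0: "ennreal e > 0" using e(1) by simp
  from assms(2)[OF e0] obtain h where h[measurable]: "h \<in> borel_measurable borel"
    and h': "approx h" "energy p q a (\<lambda>x. h x - g x) < ennreal e" by blast
  from h'(1) e0 obtain w where w: "w \<in> test_functions \<Omega>" "energy p q a (\<lambda>x. grad w x - h x) < ennreal e"
    unfolding approx_def by blast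
  note [measurable] = grad_test_measurable[OF w(1)]
  have "energy p q a (\<lambda>x. (grad w x - h x) + (h x - g x)) < \<epsilon>"
    by (rule e(2)[rule_format]) (use w h' in auto)
  then show "\<exists>w\<in>test_functions \<Omega>. energy p q a (\<lambda>x. grad w x - g x) < \<epsilon>"
    using w(1) by auto
qed

text \<open>Convergence in energy holds for every shift \<open>v\<close>; the particular
  \<open>v\<close> of the hypothesis serves only to keep the support of the mollified function
  inside \<open>\<Omega>\<close>.\<close>

lemma approx_local:
  assumes s: "sobolev_zero \<Omega> \<phi> g" and M: "\<And>x. \<bar>\<phi> x\<bar> \<le> M" and h: "integrable lborel (integrand p q a g)"
    and supp: "\<And>x. \<phi> x \<noteq> 0 \<Longrightarrow> x \<in> \<Omega> \<inter> cball z r" and \<delta>0: "\<delta>\<^sub>0 > 0"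
    and good: "\<And>\<delta>. 0 < \<delta> \<Longrightarrow> \<delta> < \<delta>\<^sub>0 \<Longrightarrow> \<exists>K. compact K \<and> K \<subseteq> \<Omega> \<and>
       (\<forall>x\<in>\<Omega> \<inter> cball z r. \<forall>y. norm (y - \<delta> *\<^sub>R v) < \<delta> \<longrightarrow> x + y \<in> K)"
  shows "approx g"
  unfolding approx_def
proof (intro allI impI)
  fix \<epsilon> :: ennreal assume \<epsilon>: "\<epsilon> > 0"
  obtain \<rho> :: "'a \<Rightarrow> real" where \<rho>: "is_bump \<rho>" using is_bump_ex by blast
  note i = sobolev_zeroD(1,2)[OF s]
  have [measurable]: "g \<in> borel_measurable borel" using i by simp
  \<comment> \<open>If \<open>q - p \<le> \<kappa>\<close>, boundedness of \<open>\<phi>\<close>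
    gives the rate \<open>s' = 1\<close>. Otherwise the maximum must be \<open>p / n\<close>, which
    says \<open>(n / p) * (q - p) \<le> \<kappa>\<close>, and the \<open>p\<close>-th power
    integrability of \<open>g\<close> gives the rate \<open>s' = n / p\<close>.\<close>
  obtain s' M' where s': "s' * (q - p) \<le> \<kappa>" "M' \<ge> 0"
    "\<And>\<delta> x. 0 < \<delta> \<Longrightarrow> norm (conv (scaled_bump \<rho> \<delta> v) g x) \<le> M' * \<delta> powr (- s')"
  proof (cases "q \<le> p + \<kappa>")
    case True
    obtain M' where M': "M' \<ge> 0" "\<And>\<delta> x. 0 < \<delta> \<Longrightarrow> norm (conv (scaled_bump \<rho> \<delta> v) g x) \<le> M' * \<delta> powr (- 1)"
      using conv_scaled_bump_bound_bounded[OF s \<rho> M, of v] by metis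
    then show thesis using that[of 1 M'] True by auto
  next
    case False
    then have "q \<le> p + \<kappa> * (p / DIM('a))" using expo by (auto simp: max_def split: if_splits)
    then have "(DIM('a) / p) * (q - p) \<le> (DIM('a) / p) * (\<kappa> * (p / DIM('a)))"
      using p by (intro mult_left_mono) auto
    then have sle: "(DIM('a) / p) * (q - p) \<le> \<kappa>" using p by simp
    have gp: "integrable lborel (\<lambda>x. norm (g x) powr p)"
      by (rule Bochner_Integration.integrable_bound[OF h]) (use a_nonneg in \<open>auto simp: integrand_def\<close>)
    obtain M' where M': "M' \<ge> 0" "\<And>\<delta> x. 0 < \<delta> \<Longrightarrow> norm (conv (scaled_bump \<rho> \<delta> v) g x) \<le> M' * \<delta> powr (- (DIM('a) / p))"
      using conv_scaled_bump_bound_Lp[OF i(2) \<rho> p' gp, of v] by metis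
    show thesis by (rule that[OF sle M'])
  qed
  \<comment> \<open>The comparison of weights is known on \<open>S\<close> only, and
    \<open>S\<close> differs from \<open>\<Omega>\<close> by a null set.\<close>
  have gS: "AE y in lborel. y \<notin> S \<longrightarrow> g y = 0"
    using sobolev_zero_zero_outside[OF open_\<Omega> s] S(2) by eventually_elim auto
  obtain \<delta> where \<delta>: "0 < \<delta>" "\<delta> < \<delta>\<^sub>0" "energy p q a (\<lambda>x. conv (scaled_bump \<rho> \<delta> v) g x - g x) < \<epsilon>"
    using mollify_energy[OF p' pq C \<rho> i(2) a_meas a_nonneg h gS a_compare a_outside \<kappa> s'(1,2) s'(3) \<epsilon> \<delta>0] by blast
  have k: "smooth (scaled_bump \<rho> \<delta> v)" "bounded_support (scaled_bump \<rho> \<delta> v)"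
    using \<rho> scaled_bump_bdd_supp[OF \<rho> \<delta>(1)] by (auto intro: scaled_bump_smooth simp: is_bump_def)
  obtain K where K: "compact K" "K \<subseteq> \<Omega>" "\<And>x y. x \<in> \<Omega> \<inter> cball z r \<Longrightarrow> norm (y - \<delta> *\<^sub>R v) < \<delta> \<Longrightarrow> x + y \<in> K"
    using good[OF \<delta>(1,2)] by metis
  have "conv (scaled_bump \<rho> \<delta> v) \<phi> \<in> test_functions \<Omega>"
  proof (rule test_functionI[OF conv_smooth[OF i(1) k] K(1,2)])
    fix x assume "conv (scaled_bump \<rho> \<delta> v) \<phi> x \<noteq> 0"
    then obtain y where y: "scaled_bump \<rho> \<delta> v (x - y) \<noteq> 0" "\<phi> y \<noteq> 0" using conv_nonzero by blast
    have "y + (x - y) \<in> K" by (rule K(3)[OF supp[OF y(2)] scaled_bump_support[OF \<rho> \<delta>(1) y(1)]])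
    then show "x \<in> K" by simp
  qed
  moreover have "energy p q a (\<lambda>x. grad (conv (scaled_bump \<rho> \<delta> v) \<phi>) x - g x) < \<epsilon>"
    using \<delta>(3) by (simp add: sobolev_zero_grad_conv(2)[OF s k])
  ultimately show "\<exists>w\<in>test_functions \<Omega>. energy p q a (\<lambda>x. grad w x - g x) < \<epsilon>" by blast
qed

text \<open>Each product \<open>\<eta> i * \<phi>\<close> satisfies \<open>approx_local\<close> with
  its own shift, and the gradients of the products add up to \<open>g\<close> almost
  everywhere.\<close>

lemma approx_bounded:
  assumes s: "sobolev_zero \<Omega> \<phi> g" and M: "\<And>x. \<bar>\<phi> x\<bar> \<le> M" and h: "integrable lborel (integrand p q a g)"
    and \<phi>0: "\<And>x. x \<notin> \<Omega> \<Longrightarrow> \<phi> x = 0"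
  shows "approx g"
proof -
  note i = sobolev_zeroD(1,2)[OF s]
  have [measurable]: "g \<in> borel_measurable borel" "\<phi> \<in> borel_measurable borel" using i by auto
  obtain R where R: "\<And>x. x \<in> \<Omega> \<Longrightarrow> norm x \<le> R" using bounded_\<Omega> by (auto simp: bounded_iff)
  have "\<forall>z\<in>closure \<Omega>. \<exists>r>0. \<exists>v. \<exists>\<delta>\<^sub>0>0. \<forall>\<delta>. 0 < \<delta> \<and> \<delta> < \<delta>\<^sub>0 \<longrightarrow>
    (\<exists>K. compact K \<and> K \<subseteq> \<Omega> \<and> (\<forall>x\<in>\<Omega> \<inter> cball z r. \<forall>y. norm (y - \<delta> *\<^sub>R v) < \<delta> \<longrightarrow> x + y \<in> K))"
    using lipschitz_domain_shift[OF domain] by blast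
  then obtain r where r: "\<And>z. z \<in> closure \<Omega> \<Longrightarrow> r z > 0"
    and good: "\<And>z. z \<in> closure \<Omega> \<Longrightarrow> \<exists>v. \<exists>\<delta>\<^sub>0>0. \<forall>\<delta>. 0 < \<delta> \<and> \<delta> < \<delta>\<^sub>0 \<longrightarrow>
    (\<exists>K. compact K \<and> K \<subseteq> \<Omega> \<and> (\<forall>x\<in>\<Omega> \<inter> cball z (r z). \<forall>y. norm (y - \<delta> *\<^sub>R v) < \<delta> \<longrightarrow> x + y \<in> K))"
    by metis
  have "compact (closure \<Omega>)" using bounded_\<Omega> by simp
  then obtain m :: nat and c \<eta> where c: "\<And>i. i < m \<Longrightarrow> c i \<in> closure \<Omega>"
    and \<eta>: "\<And>i. smooth (\<eta> i)" "\<And>i. bounded_support (\<eta> i)"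
    and \<eta>_supp: "\<And>i x. i < m \<Longrightarrow> \<eta> i x \<noteq> 0 \<Longrightarrow> x \<in> cball (c i) (r (c i))"
    and \<eta>_sum: "\<And>x. x \<in> closure \<Omega> \<Longrightarrow> (\<Sum>i<m. \<eta> i x) = 1"
    using smooth_partition[of "closure \<Omega>" r] r by metis
  note g\<eta> = smooth_has_grad[OF \<eta>(1)]
  note [measurable] = has_gradD(4,5)[OF g\<eta>]
  \<comment> \<open>The gradient of \<open>\<eta> i * \<phi>\<close> by the product rule.\<close>
  define G where "G i x = \<eta> i x *\<^sub>R g x + \<phi> x *\<^sub>R grad (\<eta> i) x" for i x
  have Gm[measurable]: "G i \<in> borel_measurable borel" for i unfolding G_def by measurable
  have "approx (G i)" if im: "i < m" for i
  proof -
    obtain B1 where B1: "B1 > 0" "\<And>x. norm (\<eta> i x) \<le> B1"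
      using continuous_bdd_supp_bounded[OF has_gradD(3)[OF g\<eta>] \<eta>(2)] by metis
    obtain B2 where B2: "B2 > 0" "\<And>x. norm (grad (\<eta> i) x) \<le> B2"
      using continuous_bdd_supp_bounded[OF has_gradD(2)[OF g\<eta>] has_grad_bdd_supp[OF g\<eta> \<eta>(2)]] by metis
    define B where "B = 1 + B1 + B2"
    have B: "\<bar>\<eta> i x\<bar> \<le> B" "norm (grad (\<eta> i) x) \<le> B" "1 \<le> B" for x
      using B1(1) B2(1) B1(2)[of x] B2(2)[of x] by (auto simp: B_def)
    have M0: "M \<ge> 0" using M[of undefined] abs_ge_zero order_trans by blast
    have sG: "sobolev_zero \<Omega> (\<lambda>x. \<eta> i x * \<phi> x) (G i)" unfolding G_def by (rule sobolev_zero_mult[OF s g\<eta> B(1,2)])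
    have bG: "\<bar>\<eta> i x * \<phi> x\<bar> \<le> B * M" for x
      unfolding abs_mult using B M M0 by (intro mult_mono) auto
    \<comment> \<open>Boundedness of \<open>\<phi>\<close> is essential here: membership of
      \<open>\<phi>\<close> in \<open>W11_0\<close> and finite energy of \<open>g\<close> are not
      invoked for the power \<open>q\<close> of \<open>\<phi>\<close> itself.\<close>
    have d1: "integrable lborel (integrand p q a (\<lambda>x. \<phi> x *\<^sub>R grad (\<eta> i) x))"
    proof (rule integrable_dens_bounded)
      show "norm (\<phi> x *\<^sub>R grad (\<eta> i) x) \<le> M * B" for x
        using M B M0 by (auto intro: mult_mono)
      show "norm x \<le> R" if "\<phi> x *\<^sub>R grad (\<eta> i) x \<noteq> 0" for x
        using that \<phi>0[of x] R[of x] by auto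
    qed measurable
    have dG: "integrable lborel (integrand p q a (G i))"
    proof (rule Bochner_Integration.integrable_bound)
      show "integrable lborel (\<lambda>x. 2 powr (q - 1) * (B powr q * integrand p q a g x + integrand p q a (\<lambda>x. \<phi> x *\<^sub>R grad (\<eta> i) x) x))"
        using h d1 by auto
      show "AE x in lborel. norm (integrand p q a (G i) x) \<le>
         norm (2 powr (q - 1) * (B powr q * integrand p q a g x + integrand p q a (\<lambda>x. \<phi> x *\<^sub>R grad (\<eta> i) x) x))"
      proof (rule AE_I2)
        fix x
        have "integrand p q a (G i) x \<le> 2 powr (q - 1) * (integrand p q a (\<lambda>x. \<eta> i x *\<^sub>R g x) x + integrand p q a (\<lambda>x. \<phi> x *\<^sub>R grad (\<eta> i) x) x)"
          unfolding G_def by (rule integrand_half_le(1)[where a=a, OF p' pq a_nonneg])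
        also have "\<dots> \<le> 2 powr (q - 1) * (B powr q * integrand p q a g x + integrand p q a (\<lambda>x. \<phi> x *\<^sub>R grad (\<eta> i) x) x)"
          by (intro mult_left_mono add_right_mono integrand_scale_le p' pq a_nonneg B) auto
        finally show "norm (integrand p q a (G i) x) \<le>
           norm (2 powr (q - 1) * (B powr q * integrand p q a g x + integrand p q a (\<lambda>x. \<phi> x *\<^sub>R grad (\<eta> i) x) x))"
          using integrand_nonneg[where a=a and x=x, OF a_nonneg, of p q "G i"] unfolding real_norm_def by linarith
      qed
    qed measurable
    from good[OF c[OF im]] obtain v \<delta>\<^sub>0 where \<delta>0: "\<delta>\<^sub>0 > 0" and gd: "\<And>\<delta>. 0 < \<delta> \<Longrightarrow> \<delta> < \<delta>\<^sub>0 \<Longrightarrow>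
      \<exists>K. compact K \<and> K \<subseteq> \<Omega> \<and> (\<forall>x\<in>\<Omega> \<inter> cball (c i) (r (c i)). \<forall>y. norm (y - \<delta> *\<^sub>R v) < \<delta> \<longrightarrow> x + y \<in> K)"
      by metis
    have sp: "x \<in> \<Omega> \<inter> cball (c i) (r (c i))" if "\<eta> i x * \<phi> x \<noteq> 0" for x
      using that \<phi>0[of x] \<eta>_supp[OF im, of x] by (cases "x \<in> \<Omega>") auto
    show ?thesis by (rule approx_local[OF sG bG dG sp \<delta>0 gd])
  qed
  then have "approx (\<lambda>x. \<Sum>i<m. G i x)" by (intro approx_sum Gm) auto
  moreover have "AE x in lborel. (\<Sum>i<m. G i x) = g x"
    using sobolev_zero_zero_outside[OF open_\<Omega> s]
  proof eventually_elim
    case (elim x)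
    have sumG: "(\<Sum>i<m. G i x) = (\<Sum>i<m. \<eta> i x) *\<^sub>R g x + \<phi> x *\<^sub>R (\<Sum>i<m. grad (\<eta> i) x)"
      by (simp add: G_def sum.distrib scaleR_sum_left scaleR_sum_right)
    show ?case
    proof (cases "x \<in> \<Omega>")
      case True
      \<comment> \<open>The sum of the \<open>\<eta> i\<close> is constant on the open set
        \<open>\<Omega>\<close>, so their gradients cancel there and only \<open>g\<close> is
        left.\<close>
      have "((\<lambda>x. \<Sum>i<m. \<eta> i x) has_derivative (\<lambda>h. \<Sum>i<m. grad (\<eta> i) x \<bullet> h)) (at x)"
        by (intro has_derivative_sum has_gradD(1)[OF g\<eta>])
      then have "((\<lambda>x. 1) has_derivative (\<lambda>h. \<Sum>i<m. grad (\<eta> i) x \<bullet> h)) (at x)"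
        by (rule has_derivative_transform_within_open[OF _ open_\<Omega> True]) (use \<eta>_sum closure_subset[of \<Omega>] in auto)
      then have "(\<lambda>h. \<Sum>i<m. grad (\<eta> i) x \<bullet> h) = (\<lambda>h. 0)"
        by (rule has_derivative_unique) (rule has_derivative_const)
      then have "(\<Sum>i<m. grad (\<eta> i) x) \<bullet> h = 0" for h
        unfolding inner_sum_left by (rule fun_cong)
      then have "(\<Sum>i<m. grad (\<eta> i) x) = 0" using inner_eq_zero_iff by blast
      then show ?thesis using \<eta>_sum[of x] True closure_subset[of \<Omega>] sumG by auto
    next
      case False
      then show ?thesis using elim \<phi>0 sumG by simp
    qed
  qed
  ultimately show ?thesis by (rule approx_cong_AE)
qed

text \<open>The truncations multiply \<open>g\<close> by factors between 0 and 1 that tend to 1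
  pointwise, so the truncated gradients have finite energy and converge to \<open>g\<close> in
  energy; \<open>approx_limit\<close> then removes the truncation.\<close>

lemma approx_sobolev_zero:
  assumes s: "sobolev_zero \<Omega> \<phi> g" and h: "integrable lborel (integrand p q a g)" and \<phi>0: "\<And>x. x \<notin> \<Omega> \<Longrightarrow> \<phi> x = 0"
  shows "approx g"
proof (rule approx_limit)
  note i = sobolev_zeroD(1,2)[OF s]
  show gm[measurable]: "g \<in> borel_measurable borel" using i by simp
  have [measurable]: "\<phi> \<in> borel_measurable borel" using i by simp
  \<comment> \<open>\<open>Suc k\<close> keeps the truncation level positive.\<close>
  define T where "T k t = real (Suc k) * arctan (t / real (Suc k))" for k t
  define T' where "T' k t = inverse (1 + (t / real (Suc k))\<^sup>2)" for k t
  have T: "(T k has_real_derivative T' k t) (at t)" for k t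
    unfolding T_def[abs_def] T'_def by (auto intro!: derivative_eq_intros)
  have pos: "1 + (t / real (Suc k))\<^sup>2 \<ge> 1" for t k by simp
  then have pos': "1 + (t / real (Suc k))\<^sup>2 \<noteq> 0" for t k by (metis not_one_le_zero)
  have T'c: "continuous_on UNIV (T' k)" for k
    unfolding T'_def[abs_def] by (intro continuous_intros) (use pos' in auto)
  have T'1: "0 \<le> T' k t" "T' k t \<le> 1" for k t
    unfolding T'_def using pos[of t k] by (auto intro!: inverse_le_1_iff[THEN iffD2])
  have [measurable]: "T' k \<in> borel_measurable borel" for k using T'c by (rule borel_measurable_continuous_onI)
  have Tb: "\<bar>T k t\<bar> \<le> real (Suc k) * (pi / 2)" for k t
    unfolding T_def abs_mult using arctan_bounded[of "t / real (Suc k)"] by (intro mult_mono) auto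
  have app: "approx (\<lambda>x. T' k (\<phi> x) *\<^sub>R g x)" for k
  proof (rule approx_bounded)
    show "sobolev_zero \<Omega> (\<lambda>x. T k (\<phi> x)) (\<lambda>x. T' k (\<phi> x) *\<^sub>R g x)"
      by (rule sobolev_zero_compose[OF s T T'c]) (use T'1 in \<open>auto simp: T_def\<close>)
    show "\<bar>T k (\<phi> x)\<bar> \<le> real (Suc k) * (pi / 2)" for x by (rule Tb)
    show "integrable lborel (integrand p q a (\<lambda>x. T' k (\<phi> x) *\<^sub>R g x))"
    proof (rule Bochner_Integration.integrable_bound[OF h])
      show "AE x in lborel. norm (integrand p q a (\<lambda>x. T' k (\<phi> x) *\<^sub>R g x) x) \<le> norm (integrand p q a g x)"
      proof (rule AE_I2)
        fix x
        have "integrand p q a (\<lambda>x. T' k (\<phi> x) *\<^sub>R g x) x \<le> integrand p q a g x"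
          using T'1[of k "\<phi> x"] p pq a_nonneg by (intro integrand_mono) (auto intro: mult_left_le_one_le)
        then show "norm (integrand p q a (\<lambda>x. T' k (\<phi> x) *\<^sub>R g x) x) \<le> norm (integrand p q a g x)"
          using a_nonneg[of x] by (simp add: integrand_nonneg)
      qed
    qed measurable
    show "T k (\<phi> x) = 0" if "x \<notin> \<Omega>" for x using \<phi>0[OF that] by (simp add: T_def)
  qed
  \<comment> \<open>Since the factor lies in \<open>[0, 1]\<close>, its distance to 1 is at most 1,
    so the integrand of \<open>g\<close> itself dominates.\<close>
  have lim: "(\<lambda>k. energy p q a (\<lambda>x. T' k (\<phi> x) *\<^sub>R g x - g x)) \<longlonglongrightarrow> (\<integral>\<^sup>+x. 0 \<partial>(lborel :: 'a measure))"
    unfolding energy_def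
  proof (rule nn_integral_dominated_convergence[where w="\<lambda>x. ennreal (integrand p q a g x)"])
    show "(\<integral>\<^sup>+x. ennreal (integrand p q a g x) \<partial>lborel) < \<infinity>"
      using h energy_finite_iff[OF a_meas a_nonneg gm, of p q] by (simp add: energy_def)
    show "AE x in lborel. ennreal (integrand p q a (\<lambda>x. T' k (\<phi> x) *\<^sub>R g x - g x) x) \<le> ennreal (integrand p q a g x)" for k
    proof (rule AE_I2, rule ennreal_leI, rule integrand_mono)
      fix x
      have "T' k (\<phi> x) *\<^sub>R g x - g x = (T' k (\<phi> x) - 1) *\<^sub>R g x" by (simp add: scaleR_diff_left)
      then show "norm (T' k (\<phi> x) *\<^sub>R g x - g x) \<le> norm (g x)"
        using T'1[of k "\<phi> x"] by (simp add: mult_left_le_one_le)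
    qed (use p pq a_nonneg in auto)
    show "AE x in lborel. (\<lambda>k. ennreal (integrand p q a (\<lambda>x. T' k (\<phi> x) *\<^sub>R g x - g x) x)) \<longlonglongrightarrow> 0"
    proof (rule AE_I2)
      fix x
      have "(\<lambda>k. \<phi> x / real (Suc k)) \<longlonglongrightarrow> 0"
        by (intro real_tendsto_divide_at_top[OF tendsto_const] filterlim_compose[OF filterlim_real_sequentially filterlim_Suc])
      then have "(\<lambda>k. T' k (\<phi> x)) \<longlonglongrightarrow> inverse (1 + 0\<^sup>2)"
        unfolding T'_def by (intro tendsto_intros) auto
      then have "(\<lambda>k. T' k (\<phi> x) *\<^sub>R g x - g x) \<longlonglongrightarrow> inverse (1 + 0\<^sup>2) *\<^sub>R g x - g x"
        by (intro tendsto_intros)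
      then have t: "(\<lambda>k. T' k (\<phi> x) *\<^sub>R g x - g x) \<longlonglongrightarrow> 0" by simp
      have "(\<lambda>k. norm (T' k (\<phi> x) *\<^sub>R g x - g x) powr r) \<longlonglongrightarrow> norm (0::'a) powr r" if "r > 0" for r
        using that t by (intro tendsto_powr' tendsto_norm tendsto_const) auto
      then have "(\<lambda>k. norm (T' k (\<phi> x) *\<^sub>R g x - g x) powr p + a x * norm (T' k (\<phi> x) *\<^sub>R g x - g x) powr q) \<longlonglongrightarrow>
          norm (0::'a) powr p + a x * norm (0::'a) powr q"
        using p pq by (intro tendsto_add tendsto_mult_left) auto
      then have "(\<lambda>k. integrand p q a (\<lambda>x. T' k (\<phi> x) *\<^sub>R g x - g x) x) \<longlonglongrightarrow> 0" by (simp add: integrand_def)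
      from tendsto_ennrealI[OF this]
      show "(\<lambda>k. ennreal (integrand p q a (\<lambda>x. T' k (\<phi> x) *\<^sub>R g x - g x) x)) \<longlonglongrightarrow> 0" by simp
    qed
  qed measurable
  fix \<epsilon> :: ennreal assume "\<epsilon> > 0"
  then obtain k where k: "energy p q a (\<lambda>x. T' k (\<phi> x) *\<^sub>R g x - g x) < \<epsilon>"
    using order_tendstoD(2)[OF lim, of \<epsilon>] by (auto simp: eventually_sequentially)
  show "\<exists>h\<in>borel_measurable borel. approx h \<and> energy p q a (\<lambda>x. h x - g x) < \<epsilon>"
  proof (intro bexI conjI)
    show "approx (\<lambda>x. T' k (\<phi> x) *\<^sub>R g x)" by (rule app)
    show "energy p q a (\<lambda>x. T' k (\<phi> x) *\<^sub>R g x - g x) < \<epsilon>" by (rule k)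
  qed measurable
qed

text \<open>Weight and weak gradient are replaced by Borel versions up to null sets in
  \<open>\<Omega>\<close>; off \<open>\<Omega>\<close> the integrand of \<open>U\<close> is 0
  because \<open>0 powr p = 0 powr q = 0\<close>.\<close>

lemma double_phase_eq_energy:
  assumes r: "borel_version \<Omega> b a" and U: "AE x in lborel. x \<in> \<Omega> \<longrightarrow> weak_gradient \<Omega> u x = U x" "\<And>x. x \<notin> \<Omega> \<Longrightarrow> U x = 0"
  shows "double_phase p q b \<Omega> u = energy p q a U"
proof -
  have [measurable]: "\<Omega> \<in> sets borel" using open_\<Omega> by simp
  have "double_phase p q b \<Omega> u = (\<integral>\<^sup>+x. ennreal (norm (weak_gradient \<Omega> u x) powr p
      + b x * norm (weak_gradient \<Omega> u x) powr q) * indicator \<Omega> x \<partial>lebesgue)"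
    unfolding double_phase_def by (rule nn_integral_restrict_space) simp
  also have "\<dots> = (\<integral>\<^sup>+x. ennreal (integrand p q a U x) \<partial>lebesgue)"
  proof (rule nn_integral_cong_AE, rule AE_completion)
    show "AE x in lborel. ennreal (norm (weak_gradient \<Omega> u x) powr p
      + b x * norm (weak_gradient \<Omega> u x) powr q) * indicator \<Omega> x = ennreal (integrand p q a U x)"
      using U(1) borel_versionD(3)[OF r]
    proof eventually_elim
      case (elim x)
      then show ?case using U(2)[of x] p pq by (cases "x \<in> \<Omega>") (auto simp: integrand_def)
    qed
  qed
  also have "\<dots> = energy p q a U" by (simp add: energy_def nn_integral_completion)
  finally show ?thesis .
qed

text \<open>One inequality is inclusion, as test functions have finite energy. For the other, a
  competitor \<open>u + \<phi>\<close> is compared with \<open>u + w\<close>, whose gradient is that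
  of \<open>u + \<phi>\<close> plus the error \<open>grad w - g\<close>.\<close>

lemma no_lavrentiev_gap:
  assumes r: "borel_version \<Omega> b a" and u: "u \<in> W11 \<Omega>"
  shows "(INF v \<in> {\<lambda>x. u x + \<phi> x | \<phi>. \<phi> \<in> energy_space p q b \<Omega>}. double_phase p q b \<Omega> v) =
         (INF w \<in> {\<lambda>x. u x + \<phi> x | \<phi>. \<phi> \<in> test_functions \<Omega>}. double_phase p q b \<Omega> w)"
proof (rule antisym)
  have [measurable]: "\<Omega> \<in> sets borel" using open_\<Omega> by simp
  have test_energy: "\<phi> \<in> energy_space p q b \<Omega>" if \<phi>: "\<phi> \<in> test_functions \<Omega>" for \<phi>
  proof -
    note D = test_functionD[OF \<phi>]
    have "double_phase p q b \<Omega> \<phi> = energy p q a (grad \<phi>)"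
      by (rule double_phase_eq_energy[OF r weak_gradient_AE[OF open_\<Omega> test_has_weak_gradient[OF open_\<Omega> \<phi>]] D(5)])
    moreover have "energy p q a (grad \<phi>) < \<infinity>"
    proof -
      have gs: "bounded_support (grad \<phi>)" by (rule has_grad_bdd_supp[OF D(3,2)])
      then obtain R where R: "\<And>x. grad \<phi> x \<noteq> 0 \<Longrightarrow> norm x \<le> R" by (auto simp: bounded_support_def)
      obtain B where B: "\<And>x. norm (grad \<phi> x) \<le> B"
        using continuous_bdd_supp_bounded[OF has_gradD(2)[OF D(3)] gs] by metis
      have "integrable lborel (integrand p q a (grad \<phi>))"
        by (rule integrable_dens_bounded[OF has_gradD(4)[OF D(3)] B R])
      then show ?thesis using energy_finite_iff[OF a_meas a_nonneg has_gradD(4)[OF D(3)]] by blast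
    qed
    ultimately show ?thesis using test_in_W11_0[OF open_\<Omega> \<phi>] by (simp add: energy_space_def)
  qed
  then show "(INF v \<in> {\<lambda>x. u x + \<phi> x | \<phi>. \<phi> \<in> energy_space p q b \<Omega>}. double_phase p q b \<Omega> v) \<le>
         (INF w \<in> {\<lambda>x. u x + \<phi> x | \<phi>. \<phi> \<in> test_functions \<Omega>}. double_phase p q b \<Omega> w)"
    by (intro INF_superset_mono) auto
  obtain H where H: "has_weak_gradient \<Omega> u H" "integrable (lebesgue_on \<Omega>) H" using u by (auto simp: W11_def)
  obtain U where rU: "borel_version \<Omega> H U" using borel_version_ex[of \<Omega> H] H(2) by auto
  note [measurable] = borel_versionD(1)[OF rU]
  let ?I = "INF w \<in> {\<lambda>x. u x + \<phi> x | \<phi>. \<phi> \<in> test_functions \<Omega>}. double_phase p q b \<Omega> w"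
  have sum_energy: "double_phase p q b \<Omega> (\<lambda>x. u x + \<phi> x) = energy p q a (\<lambda>x. U x + g x)"
    if \<phi>: "has_weak_gradient \<Omega> \<phi> G" "borel_version \<Omega> G g" for \<phi> G g
  proof (rule double_phase_eq_energy[OF r])
    have "has_weak_gradient \<Omega> (\<lambda>x. u x + 1 * \<phi> x) (\<lambda>x. H x + 1 *\<^sub>R G x)"
      by (rule has_weak_gradient_add[OF open_\<Omega> H(1) \<phi>(1)])
    then have "has_weak_gradient \<Omega> (\<lambda>x. u x + \<phi> x) (\<lambda>x. H x + G x)" by simp
    from weak_gradient_AE[OF open_\<Omega> this] borel_versionD(3)[OF rU] borel_versionD(3)[OF \<phi>(2)]
    show "AE x in lborel. x \<in> \<Omega> \<longrightarrow> weak_gradient \<Omega> (\<lambda>x. u x + \<phi> x) x = U x + g x"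
      by eventually_elim auto
    show "U x + g x = 0" if "x \<notin> \<Omega>" for x using borel_versionD(2)[OF rU that] borel_versionD(2)[OF \<phi>(2) that] by simp
  qed
  show "?I \<le> (INF v \<in> {\<lambda>x. u x + \<phi> x | \<phi>. \<phi> \<in> energy_space p q b \<Omega>}. double_phase p q b \<Omega> v)"
  proof (rule INF_greatest, safe)
    fix \<phi> assume \<phi>: "\<phi> \<in> energy_space p q b \<Omega>"
    then have \<phi>W: "\<phi> \<in> W11_0 \<Omega>" "double_phase p q b \<Omega> \<phi> < \<infinity>" by (auto simp: energy_space_def)
    obtain \<phi>' g G where G: "has_weak_gradient \<Omega> \<phi> G" "borel_version \<Omega> \<phi> \<phi>'" "borel_version \<Omega> G g" "sobolev_zero \<Omega> \<phi>' g"
      using W11_0_sobolev_zero[OF open_\<Omega> \<phi>W(1)] by metis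
    have gm[measurable]: "g \<in> borel_measurable borel" using borel_versionD(1)[OF G(3)] .
    have "AE x in lborel. x \<in> \<Omega> \<longrightarrow> weak_gradient \<Omega> \<phi> x = g x"
      using weak_gradient_AE[OF open_\<Omega> G(1)] borel_versionD(3)[OF G(3)] by eventually_elim auto
    from double_phase_eq_energy[OF r this borel_versionD(2)[OF G(3)]]
    have "integrable lborel (integrand p q a g)"
      using \<phi>W(2) energy_finite_iff[OF a_meas a_nonneg gm] by simp
    then have app: "approx g" by (rule approx_sobolev_zero[OF G(4) _ borel_versionD(2)[OF G(2)]])
    let ?E = "energy p q a (\<lambda>x. U x + g x)"
    \<comment> \<open>The numbers \<open>t\<close> and \<open>e\<close> are independent:
      \<open>e\<close> comes from approximation, \<open>t\<close> from convexity.\<close>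
    have step: "?I \<le> ennreal ((1 - t) powr (1 - q)) * ?E + ennreal (t powr (1 - q)) * ennreal e"
      if t: "0 < t" "t < 1" and e: "e > 0" for t e
    proof -
      obtain w where w: "w \<in> test_functions \<Omega>" "energy p q a (\<lambda>x. grad w x - g x) < ennreal e"
        using app e unfolding approx_def by (metis ennreal_less_zero_iff)
      note D = test_functionD[OF w(1)]
      note [measurable] = has_gradD(4)[OF D(3)]
      have "?I \<le> double_phase p q b \<Omega> (\<lambda>x. u x + w x)" using w(1) by (intro INF_lower) auto
      also have "\<dots> = energy p q a (\<lambda>x. U x + grad w x)"
        by (rule sum_energy[OF test_has_weak_gradient[OF open_\<Omega> w(1)] borel_version_self]) (use D(5) in auto)
      also have "\<dots> = energy p q a (\<lambda>x. (U x + g x) + (grad w x - g x))" by (simp add: algebra_simps)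
      also have "\<dots> \<le> ennreal ((1 - t) powr (1 - q)) * ?E + ennreal (t powr (1 - q)) * energy p q a (\<lambda>x. grad w x - g x)"
        by (intro energy_add_le p' pq a_meas a_nonneg t) measurable
      also have "\<dots> \<le> ennreal ((1 - t) powr (1 - q)) * ?E + ennreal (t powr (1 - q)) * ennreal e"
        using w(2) by (intro add_left_mono mult_left_mono) auto
      finally show ?thesis .
    qed
    have "?I \<le> ?E"
    proof (cases ?E)
      case (real E)
      show ?thesis
      proof (rule ennreal_le_epsilon)
        fix e :: real assume e: "e > 0"
        \<comment> \<open>First \<open>t\<close> is fixed so small that the factor of the energy
          costs at most \<open>e / 2\<close>.\<close>
        have "((\<lambda>t. (1 - t) powr (1 - q) * E) \<longlongrightarrow> (1 - 0) powr (1 - q) * E) (at_right 0)"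
          by (intro tendsto_intros) auto
        then have "\<forall>\<^sub>F t in at_right 0. (1 - t) powr (1 - q) * E < E + e / 2"
          using order_tendstoD(2)[of _ E "at_right 0" "E + e / 2"] e by simp
        moreover have "\<forall>\<^sub>F t::real in at_right 0. 0 < t \<and> t < 1"
          using eventually_at_right_real[of 0 1] by simp
        ultimately have "\<forall>\<^sub>F t in at_right 0. (1 - t) powr (1 - q) * E < E + e / 2 \<and> 0 < t \<and> t < 1"
          by (rule eventually_conj)
        then obtain t where t: "(1 - t) powr (1 - q) * E < E + e / 2" "0 < t" "t < 1"
          using eventually_happens'[OF trivial_limit_at_right_real] by blast
        \<comment> \<open>\<open>t powr (1 - q)\<close> grows without bound as \<open>t\<close>
          tends to 0, so the approximation error is chosen after \<open>t\<close> and compensates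
          exactly this factor.\<close>
        define d where "d = (e / 2) / t powr (1 - q)"
        have d: "d > 0" "t powr (1 - q) * d = e / 2" using e t by (auto simp: d_def)
        have "?I \<le> ennreal ((1 - t) powr (1 - q)) * ennreal E + ennreal (t powr (1 - q)) * ennreal d"
          using step[OF t(2,3) d(1)] real by simp
        also have "\<dots> = ennreal ((1 - t) powr (1 - q) * E + e / 2)"
          using real d e by (simp add: ennreal_mult[symmetric] ennreal_plus[symmetric] del: ennreal_plus)
        also have "\<dots> \<le> ennreal (E + e)" using t by (intro ennreal_leI) simp
        also have "\<dots> = ?E + ennreal e" using real e by simp
        finally show "?I \<le> ?E + ennreal e" .
      qed
    qed simp
    then show "?I \<le> double_phase p q b \<Omega> (\<lambda>x. u x + \<phi> x)"
      using sum_energy[OF G(1,3)] by simp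
  qed
qed

end

section \<open>Passage to a Borel weight\<close>

theorem theorem2:
  fixes \<Omega> :: "(real ^ 'n) set" and a u\<^sub>0 :: "real ^ 'n \<Rightarrow> real" and p q \<kappa> :: real
  assumes "CARD('n) \<ge> 2"
    and "bounded_lipschitz_domain \<Omega>"
    and "\<kappa> > 0"
    and "1 < p" and "p < q" and "q \<le> p + \<kappa> * max (p / real CARD('n)) 1"
    and "a \<in> Z_class \<kappa> \<Omega>"
    and "u\<^sub>0 \<in> W11 \<Omega>"
    and "double_phase p q a \<Omega> u\<^sub>0 < \<infinity>"
  shows "(INF v \<in> {\<lambda>x. u\<^sub>0 x + \<phi> x | \<phi>. \<phi> \<in> energy_space p q a \<Omega>}. double_phase p q a \<Omega> v) =
         (INF w \<in> {\<lambda>x. u\<^sub>0 x + \<phi> x | \<phi>. \<phi> \<in> test_functions \<Omega>}. double_phase p q a \<Omega> w)"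
proof -
  have \<Omega>: "open \<Omega>" using assms(2) by (simp add: bounded_lipschitz_domain_def)
  then have [measurable]: "\<Omega> \<in> sets borel" by simp
  obtain C where C: "C > 0" "\<And>x y. x \<in> \<Omega> \<Longrightarrow> y \<in> \<Omega> \<Longrightarrow> a x \<le> C * (a y + norm (x - y) powr \<kappa>)"
    and a: "a \<in> borel_measurable (lebesgue_on \<Omega>)" "\<And>x. x \<in> \<Omega> \<Longrightarrow> 0 \<le> a x"
    using assms(7) by (auto simp: Z_class_def)
  obtain a\<^sub>0 where r0: "borel_version \<Omega> a a\<^sub>0" using borel_version_ex[OF _ a(1)] by auto
  \<comment> \<open>The Borel version agrees with \<open>a\<close> only almost everywhere. Removing
    a Borel null set \<open>N\<close> containing all exceptions keeps the comparison inequality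
    valid for every pair of remaining points.\<close>
  from borel_versionD(3)[OF r0] obtain N where N: "{x \<in> space lborel. \<not> (x \<in> \<Omega> \<longrightarrow> a x = a\<^sub>0 x)} \<subseteq> N" "N \<in> null_sets lborel"
    by (auto elim!: AE_E simp: null_sets_def)
  define S where "S = \<Omega> - N"
  \<comment> \<open>Setting the weight to 0 on \<open>N\<close> and outside \<open>\<Omega>\<close>
    keeps it Borel and nonnegative everywhere and leaves all integrals over \<open>\<Omega>\<close>
    unchanged.\<close>
  define a' where "a' x = indicator S x * a\<^sub>0 x" for x
  have [measurable]: "N \<in> sets borel" "a\<^sub>0 \<in> borel_measurable borel" using N(2) borel_versionD(1)[OF r0] by auto
  have [measurable]: "S \<in> sets borel" unfolding S_def by simp
  have a'S: "a' x = a x" if "x \<in> S" for x using that N(1) by (auto simp: a'_def S_def)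
  have AES: "AE x in lborel. x \<in> \<Omega> \<longrightarrow> x \<in> S"
    using AE_not_in[OF N(2)] by eventually_elim (simp add: S_def)
  interpret double_phase_weight p q \<kappa> C a' S \<Omega>
  proof
    show "q \<le> p + \<kappa> * max (p / DIM(real ^ 'n)) 1" using assms(6) by simp
    show "a' \<in> borel_measurable borel" unfolding a'_def by measurable
    show "0 \<le> a' x" for x
    proof (cases "x \<in> S")
      case True
      then show ?thesis using a'S a(2)[of x] by (simp add: S_def)
    qed (simp add: a'_def)
    show "a' x \<le> C * (a' y + norm (x - y) powr \<kappa>)" if "x \<in> S" "y \<in> S" for x y
      using that C(2)[of x y] a'S by (simp add: S_def)
    show "a' x = 0" if "x \<notin> S" for x using that by (simp add: a'_def)
  qed (use assms C AES in \<open>auto simp: S_def\<close>)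
  have "borel_version \<Omega> a a'"
    unfolding borel_version_def
  proof (intro conjI allI impI)
    show "AE x in lborel. x \<in> \<Omega> \<longrightarrow> a x = a' x" using AES by eventually_elim (simp add: a'S)
    show "a' x = 0" if "x \<notin> \<Omega>" for x using that by (simp add: a'_def S_def)
  qed (rule a_meas)
  then show ?thesis by (rule no_lavrentiev_gap[OF _ assms(8)])
qed

end
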